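(* Let $\Omega$ be a bounded domain of $\mathbb{R}^n$, let $1<p<2$ and $\sigma>0$. Let $\bm{a}:\Omega\times\mathbb{R}^n\to\mathbb{R}^n$ be a Carathéodory function (measurable in $x$, continuous in $\xi$) satisfying: there is $\gamma>0$ such that $$(\bm{a}(x,\xi)-\bm{a}(x,\eta))\cdot(\xi-\eta)\ge\gamma\,(1+|\xi|+|\eta|)^{p-2}|\xi-\eta|^2$$ for all $x\in\Omega$ and $\xi,\eta\in\mathbb{R}^n$. Let $H:\Omega\times\mathbb{R}\times\mathbb{R}^n\to\mathbb{R}$ be continuous and satisfy: (H-1) $H(x,t,\xi)-H(x,s,\xi)\ge\omega(x,t-s)+\tau(x,t-s)|\xi|^\sigma$ for all $(x,\xi)\in\Omega\times\mathbb{R}^n$ and $s,t\in\mathbb{R}$ with $s<t$, where $\omega,\tau:\Omega\times(0,\infty)\to\mathbb{R}$ are non-negative, lower semicontinuous in $x\in\Omega$ and non-decreasing in $r\in(0,\infty)$; (H-2) for every compact $K\subset\Omega$ there is $M=M(K)>0$ with $|H(x,t,\eta)-H(x,t,\xi)|\le M\,\big||\eta|^\sigma-|\xi|^\sigma\big|$ for all $(x,t)\in K\times\mathbb{R}$, $\xi,\eta\in\mathbb{R}^n$. Suppose $u,v\in W^{1,\infty}_{loc}(\Omega)$ and one of the following holds: ($\widetilde{A}_1$) $0<\sigma<1$ and $\omega>0$; ($\widetilde{A}_2$) $1\le\sigma$. If $Qu\le Qv$ in $\Omega$ and $u\le v$ on $\partial\Omega$, then $u\le v$ in $\Omega$.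
   Context: Here $Qu:=-\operatorname{div}(\bm{a}(x,\nabla u))+H(x,u,\nabla u)$. "$\omega>0$" means $\omega(x,r)>0$ for all $x\in\Omega$, $r>0$. The inequality $Qu\le Qv$ in $\Omega$ means $$\int_\Omega(\bm{a}(x,\nabla u)-\bm{a}(x,\nabla v))\cdot\nabla\varphi\le\int_\Omega(H(x,v,\nabla v)-H(x,u,\nabla u))\varphi$$ for all $\varphi\in C^1_c(\Omega)$ with $\varphi\ge0$; whenever this is used it is understood that the consistency conditions $|\bm{a}(x,\nabla u)|,|\bm{a}(x,\nabla v)|,H(x,u,0),H(x,v,0)\in L^1_{loc}(\Omega)$ hold, so that the integrals are well defined and the inequality may be used with non-negative test functions $\varphi\in W^{1,p}(\Omega)$ having compact support in $\Omega$. "$u\le v$ in $\Omega$" means $u\le v$ a.e. in $\Omega$; "$u\le v$ on $\partial\Omega$" means $\limsup_{x\to\partial\Omega}(u(x)-v(x))\le0$. *)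

theory Defs
  imports "HOL-Analysis.Analysis" "HOL-Library.Liminf_Limsup"
begin

definition bounded_domain :: "'a::euclidean_space set \<Rightarrow> bool" where
  "bounded_domain \<Omega> \<longleftrightarrow> open \<Omega> \<and> connected \<Omega> \<and> bounded \<Omega> \<and> \<Omega> \<noteq> {}"

definition lsc_on :: "'a::topological_space set \<Rightarrow> ('a \<Rightarrow> real) \<Rightarrow> bool" where
  "lsc_on S f \<longleftrightarrow> (\<forall>x\<in>S. \<forall>c. c < f x \<longrightarrow> eventually (\<lambda>y. c < f y) (at x within S))"

definition caratheodory :: "'a::euclidean_space set \<Rightarrow> ('a \<Rightarrow> 'a \<Rightarrow> 'a) \<Rightarrow> bool" where
  "caratheodory \<Omega> a \<longleftrightarrow>
     (\<forall>\<xi>. (\<lambda>x. a x \<xi>) \<in> borel_measurable (lebesgue_on \<Omega>)) \<and>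
     (\<forall>x\<in>\<Omega>. continuous_on UNIV (a x))"

definition C1c_grad :: "'a::euclidean_space set \<Rightarrow> ('a \<Rightarrow> real) \<Rightarrow> ('a \<Rightarrow> 'a) \<Rightarrow> bool" where
  "C1c_grad \<Omega> \<phi> D\<phi> \<longleftrightarrow>
     (\<forall>x. (\<phi> has_derivative (\<lambda>h. D\<phi> x \<bullet> h)) (at x)) \<and> continuous_on UNIV D\<phi> \<and>
     compact (closure {x. \<phi> x \<noteq> 0}) \<and> closure {x. \<phi> x \<noteq> 0} \<subseteq> \<Omega>"

definition L1_loc :: "'a::euclidean_space set \<Rightarrow> ('a \<Rightarrow> real) \<Rightarrow> bool" where
  "L1_loc \<Omega> f \<longleftrightarrow> (\<forall>K. compact K \<and> K \<subseteq> \<Omega> \<longrightarrow> set_integrable lebesgue K f)"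

definition L1_loc_vec :: "'a::euclidean_space set \<Rightarrow> ('a \<Rightarrow> 'a) \<Rightarrow> bool" where
  "L1_loc_vec \<Omega> g \<longleftrightarrow> (\<forall>K. compact K \<and> K \<subseteq> \<Omega> \<longrightarrow> set_integrable lebesgue K g)"

definition weak_grad :: "'a::euclidean_space set \<Rightarrow> ('a \<Rightarrow> real) \<Rightarrow> ('a \<Rightarrow> 'a) \<Rightarrow> bool" where
  "weak_grad \<Omega> u g \<longleftrightarrow> L1_loc \<Omega> u \<and> L1_loc_vec \<Omega> g \<and>
     (\<forall>\<phi> D\<phi>. C1c_grad \<Omega> \<phi> D\<phi> \<longrightarrow>
        (LINT x:\<Omega>|lebesgue. u x *\<^sub>R D\<phi> x) = - (LINT x:\<Omega>|lebesgue. \<phi> x *\<^sub>R g x))"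

definition Linf_loc :: "'a::euclidean_space set \<Rightarrow> ('a \<Rightarrow> 'b::real_normed_vector) \<Rightarrow> bool" where
  "Linf_loc \<Omega> f \<longleftrightarrow> (\<forall>K. compact K \<and> K \<subseteq> \<Omega> \<longrightarrow>
      (\<exists>C. AE x in lebesgue. x \<in> K \<longrightarrow> norm (f x) \<le> C))"

definition W1inf_loc_grad :: "'a::euclidean_space set \<Rightarrow> ('a \<Rightarrow> real) \<Rightarrow> ('a \<Rightarrow> 'a) \<Rightarrow> bool" where
  "W1inf_loc_grad \<Omega> u g \<longleftrightarrow>
     u \<in> borel_measurable (lebesgue_on \<Omega>) \<and> g \<in> borel_measurable (lebesgue_on \<Omega>) \<and>
     Linf_loc \<Omega> u \<and> Linf_loc \<Omega> g \<and> weak_grad \<Omega> u g"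

text \<open>Weak inequality Qu <= Qv in Omega, with Qu = -div(a(x,grad u)) + H(x,u,grad u),
  including the consistency (local integrability) conditions.\<close>
definition Q_le :: "'a::euclidean_space set \<Rightarrow> ('a \<Rightarrow> 'a \<Rightarrow> 'a) \<Rightarrow> ('a \<Rightarrow> real \<Rightarrow> 'a \<Rightarrow> real)
    \<Rightarrow> ('a \<Rightarrow> real) \<Rightarrow> ('a \<Rightarrow> 'a) \<Rightarrow> ('a \<Rightarrow> real) \<Rightarrow> ('a \<Rightarrow> 'a) \<Rightarrow> bool" where
  "Q_le \<Omega> a H u gu v gv \<longleftrightarrow>
     L1_loc \<Omega> (\<lambda>x. norm (a x (gu x))) \<and> L1_loc \<Omega> (\<lambda>x. norm (a x (gv x))) \<and>
     L1_loc \<Omega> (\<lambda>x. H x (u x) 0) \<and> L1_loc \<Omega> (\<lambda>x. H x (v x) 0) \<and>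
     (\<forall>\<phi> D\<phi>. C1c_grad \<Omega> \<phi> D\<phi> \<and> (\<forall>x. 0 \<le> \<phi> x) \<longrightarrow>
        (LINT x:\<Omega>|lebesgue. (a x (gu x) - a x (gv x)) \<bullet> D\<phi> x)
          \<le> (LINT x:\<Omega>|lebesgue. (H x (v x) (gv x) - H x (u x) (gu x)) * \<phi> x))"

definition le_on_boundary :: "'a::euclidean_space set \<Rightarrow> ('a \<Rightarrow> real) \<Rightarrow> ('a \<Rightarrow> real) \<Rightarrow> bool" where
  "le_on_boundary \<Omega> u v \<longleftrightarrow>
     (\<forall>\<xi>\<in>frontier \<Omega>. Limsup (at \<xi> within \<Omega>) (\<lambda>x. ereal (u x - v x)) \<le> 0)"

end

theory Submission
  imports Defs
begin

text \<open>
  Put \<open>w = u - v\<close> and fix a level \<open>k0 > 0\<close>; the boundary condition makes \<open>{w \<ge> k0}\<close> relatively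
  compact in \<open>\<Omega>\<close>, where \<open>u\<close>, \<open>v\<close> have bounded gradients. Testing with \<open>max 0 (w - k) ^ 3\<close>, \<open>k \<ge> k0\<close>, and
  using \<open>H(x,v,\<nabla>v) - H(x,u,\<nabla>u) \<le> C |\<nabla>w|\<close> on \<open>{w > k0}\<close> (for \<open>\<sigma> < 1\<close> the term \<open>\<omega>\<close> absorbs small \<open>|\<nabla>w|\<close>)
  gives, for \<open>s = max 0 (w - k)\<close>, the estimate \<open>\<integral> s\<^sup>2 |\<nabla>w|\<^sup>2 \<le> A \<integral>\<^bsub>\<nabla>w \<noteq> 0\<^esub> s ^ 4\<close> with \<open>A\<close> independent of \<open>k\<close>.
  The left side controls the translates of \<open>s\<^sup>2\<close> in \<open>L\<^sup>2\<close>, which replaces the Sobolev inequality in the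
  classical argument that lets \<open>k\<close> increase to the essential supremum \<open>m\<close> of \<open>w\<close>. If \<open>{w = m}\<close> has
  positive measure, a translation beyond the diameter bounds that measure by a multiple of
  \<open>|{k < w < m}|\<close>, which tends to 0. Otherwise \<open>|{w > k}|\<close> tends to 0, a short translation already
  makes \<open>s\<^sup>2\<close> nearly orthogonal to itself, and \<open>\<integral> s ^ 4 < \<integral> s ^ 4\<close> follows. Weak derivatives enter only
  through mollification.
\<close>

section \<open>Mollifiers\<close>

text \<open>The cube in the test function serves two purposes. Test functions must be C^1, so a
  truncation has to enter through a power of at least 2; and with exponent 3 the quadratic term is 3
  s^2 |grad w|^2 = (3/4) |grad (s^2)|^2, while Young's inequality leaves s^4 = (s^2)^2 on the right.
  The estimate is thus a homogeneous one for the single function s^2, in integer powers, and it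
  survives as k tends to m because A does not see k. The restriction of the right side to {grad w /=
  0} is what the plateau case rests on: otherwise {w = m} would contribute multiples of (m - k)^4
  |{w = m}| to both sides. It is available because the lower-order term is bounded by C |grad w|
  without an additive constant. Two obstacles shape the set-up. For p < 2 the weight (1 + |xi| +
  |eta|)^(p-2) decays at infinity, so coercivity is uniform only where the gradients are bounded.
  And w is merely Lebesgue measurable, whereas translations and Tonelli are applied to Borel
  functions; hence the passage to Borel representatives, obtained as limits of
  mollifications.\<close>

lemma has_real_derivative_pos_part_power:
  fixes s :: real
  shows "((\<lambda>s. max 0 s ^ Suc (Suc n)) has_real_derivative real (n + 2) * max 0 s ^ Suc n) (at s)"
proof -
  consider "s < 0" | "s > 0" | "s = 0" by linarith
  then show ?thesis
  proof cases
    case 1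
    have "((\<lambda>s::real. 0) has_real_derivative 0) (at s)" by simp
    then have "((\<lambda>s. max 0 s ^ Suc (Suc n)) has_real_derivative 0) (at s)"
      by (rule has_field_derivative_transform_within_open[where S="{..<0}"]) (use 1 in auto)
    then show ?thesis using 1 by simp
  next
    case 2
    have "((\<lambda>s::real. s ^ Suc (Suc n)) has_real_derivative real (n + 2) * s ^ Suc n) (at s)"
      by (rule derivative_eq_intros refl)+ simp
    then have "((\<lambda>s. max 0 s ^ Suc (Suc n)) has_real_derivative real (n + 2) * s ^ Suc n) (at s)"
      by (rule has_field_derivative_transform_within_open[where S="{0<..}"]) (use 2 in auto)
    then show ?thesis using 2 by simp
  next
    case 3
    have "((\<lambda>h::real. (max 0 h ^ Suc (Suc n)) / h) \<longlongrightarrow> 0) (at 0)"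
    proof (rule Lim_null_comparison)
      show "\<forall>\<^sub>F h in at (0::real). norm (max 0 h ^ Suc (Suc n) / h) \<le> \<bar>h\<bar> ^ Suc n"
      proof (rule always_eventually, rule allI)
        fix h :: real
        show "norm (max 0 h ^ Suc (Suc n) / h) \<le> \<bar>h\<bar> ^ Suc n"
          by (cases "h > 0") (simp_all add: max_absorb1 del: power_Suc, simp)
      qed
      have "((\<lambda>h::real. \<bar>h\<bar> ^ Suc n) \<longlongrightarrow> \<bar>0\<bar> ^ Suc n) (at 0)" by (intro tendsto_intros)
      then show "((\<lambda>h::real. \<bar>h\<bar> ^ Suc n) \<longlongrightarrow> 0) (at 0)" by simp
    qed
    then show ?thesis using 3 by (simp add: DERIV_def)
  qed
qed

section \<open>Invariance of Lebesgue measure under translations and reflections\<close>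

lemma lborel_distr_isometry:
  fixes t :: "'a::euclidean_space"
  assumes "\<bar>c\<bar> = 1"
  shows "distr lborel borel (\<lambda>x. t + c *\<^sub>R x) = lborel"
proof -
  have "c \<noteq> 0" using assms by auto
  \<comment> \<open>The factor \<open>\<bar>c\<bar>^DIM('a)\<close> is 1. The value c = 1 gives
    translations; c = -1 gives the reflection y -> x - y needed to integrate a kernel in its second
    variable.\<close>
  then have "lborel = density (distr lborel borel (\<lambda>x. t + c *\<^sub>R x)) (\<lambda>_. (\<bar>c\<bar>^DIM('a)))"
    using lborel_affine[of c t] by simp
  then show ?thesis using assms by (simp add: density_1)
qed

lemma integral_lborel_isometry:
  fixes t :: "'a::euclidean_space" and f :: "'a \<Rightarrow> 'b::{banach,second_countable_topology}"
  assumes "\<bar>c\<bar> = 1" and f[measurable]: "f \<in> borel_measurable borel"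
  shows "(\<integral>x. f (t + c *\<^sub>R x) \<partial>lborel) = (\<integral>x. f x \<partial>lborel)"
    and "integrable lborel (\<lambda>x. f (t + c *\<^sub>R x)) \<longleftrightarrow> integrable lborel f"
proof -
  have "(\<integral>x. f x \<partial>lborel) = (\<integral>x. f x \<partial>distr lborel borel (\<lambda>x. t + c *\<^sub>R x))"
    using lborel_distr_isometry[OF assms(1)] by metis
  also have "\<dots> = (\<integral>x. f (t + c *\<^sub>R x) \<partial>lborel)"
    by (rule integral_distr) auto
  finally show "(\<integral>x. f (t + c *\<^sub>R x) \<partial>lborel) = (\<integral>x. f x \<partial>lborel)" by simp
  have "integrable lborel f \<longleftrightarrow> integrable (distr lborel borel (\<lambda>x. t + c *\<^sub>R x)) f"
    using lborel_distr_isometry[OF assms(1)] by metis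
  also have "\<dots> = integrable lborel (\<lambda>x. f (t + c *\<^sub>R x))"
    by (rule integrable_distr_eq) auto
  finally show "integrable lborel (\<lambda>x. f (t + c *\<^sub>R x)) \<longleftrightarrow> integrable lborel f" by simp
qed

lemma nn_integral_lborel_isometry:
  fixes t :: "'a::euclidean_space" and f :: "'a \<Rightarrow> ennreal"
  assumes "\<bar>c\<bar> = 1" and f[measurable]: "f \<in> borel_measurable borel"
  shows "(\<integral>\<^sup>+x. f (t + c *\<^sub>R x) \<partial>lborel) = (\<integral>\<^sup>+x. f x \<partial>lborel)"
proof -
  have "(\<integral>\<^sup>+x. f x \<partial>lborel) = (\<integral>\<^sup>+x. f x \<partial>distr lborel borel (\<lambda>x. t + c *\<^sub>R x))"
    using lborel_distr_isometry[OF assms(1)] by metis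
  also have "\<dots> = (\<integral>\<^sup>+x. f (t + c *\<^sub>R x) \<partial>lborel)"
    by (rule nn_integral_distr) auto
  finally show ?thesis by simp
qed

lemma AE_lborel_isometry:
  fixes t :: "'a::euclidean_space"
  assumes "\<bar>c\<bar> = 1" and ae: "AE x in lborel. P x"
  shows "AE x in lborel. P (t + c *\<^sub>R x)"
proof -
  have "AE x in distr lborel borel (\<lambda>x. t + c *\<^sub>R x). P x"
    using ae lborel_distr_isometry[OF assms(1)] by metis
  then obtain N where N: "{x\<in>space lborel. \<not> P x} \<subseteq> N" "N \<in> sets borel" "emeasure lborel N = 0"
    using ae by (auto elim!: AE_E)
  have "AE x in lborel. x \<notin> N" using N by (intro AE_not_in) (auto simp: null_sets_def)
  then have "AE x in distr lborel borel (\<lambda>x. t + c *\<^sub>R x). x \<notin> N"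
    unfolding lborel_distr_isometry[OF assms(1), of t] .
  then have "AE x in lborel. t + c *\<^sub>R x \<notin> N"
    by (subst (asm) AE_distr_iff) (use N in \<open>auto simp: pred_def\<close>)
  then show ?thesis using N(1) by (auto elim!: eventually_mono)
qed

text \<open>An explicit C^1 function: the outer square removes the kink of the positive part, the
  inner one that of the norm at 0. One continuous derivative is all that an admissible test function
  must have.\<close>

definition bump :: "real \<Rightarrow> 'a::euclidean_space \<Rightarrow> real" where
  "bump r z = (max 0 (r\<^sup>2 - (norm z)\<^sup>2))\<^sup>2"

definition bump_grad :: "real \<Rightarrow> 'a::euclidean_space \<Rightarrow> 'a" where
  "bump_grad r z = (- 4 * max 0 (r\<^sup>2 - (norm z)\<^sup>2)) *\<^sub>R z"

lemma has_derivative_bump: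
  "(bump r has_derivative (\<lambda>h. bump_grad r z \<bullet> h)) (at z)"
proof -
  have eq: "bump r = (\<lambda>z. (max 0 (r\<^sup>2 - z \<bullet> z))\<^sup>2)"
    by (auto simp: bump_def fun_eq_iff dot_square_norm)
  have 1: "((\<lambda>z. r\<^sup>2 - z \<bullet> z) has_derivative (\<lambda>h. - (2 * (z \<bullet> h)))) (at z)"
    by (auto intro!: derivative_eq_intros simp: fun_eq_iff inner_commute)
  have 2: "((\<lambda>s. (max 0 s)\<^sup>2) has_derivative (\<lambda>h. (2 * max 0 s) * h)) (at s)" for s :: real
    using has_real_derivative_pos_part_power[of 0 s]
    by (simp add: has_field_derivative_def numeral_2_eq_2)
  show ?thesis unfolding eq
    using has_derivative_compose[OF 1 2]
    by (rule has_derivative_eq_rhs) (auto simp: bump_grad_def fun_eq_iff dot_square_norm)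
qed

lemma continuous_on_bump_grad: "continuous_on S (bump_grad r)"
  unfolding bump_grad_def by (intro continuous_intros)

lemma continuous_on_bump: "continuous_on S (bump r)"
  unfolding bump_def by (intro continuous_intros)

lemma bump_nonneg: "0 \<le> bump r z" by (simp add: bump_def)

lemma bump_outside: "r > 0 \<Longrightarrow> norm z \<ge> r \<Longrightarrow> bump r z = 0"
  using power_mono[of r "norm z" 2] by (simp add: bump_def)

lemma bump_grad_outside: "r > 0 \<Longrightarrow> norm z \<ge> r \<Longrightarrow> bump_grad r z = 0"
  using power_mono[of r "norm z" 2] by (simp add: bump_grad_def)

lemma integrable_bump:
  assumes r: "r > 0"
  shows "integrable lborel (bump r :: 'a::euclidean_space \<Rightarrow> real)"
proof -
  have "integrable lborel (\<lambda>x::'a. indicator (cball 0 r) x *\<^sub>R bump r x)"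
    by (rule borel_integrable_compact) (auto intro: continuous_on_bump)
  also have "(\<lambda>x::'a. indicator (cball 0 r) x *\<^sub>R bump r x) = bump r"
    using bump_outside[OF r, where 'a='a] by (auto simp: fun_eq_iff indicator_def)
  finally show ?thesis .
qed

text \<open>On the ball of radius r/2 one has r^2 - |z|^2 >= (3/4) r^2, whence the height (9/16)
  r^4. The purpose is a lower bound for the mass of the same order as the height r^4 times the
  volume of the support.\<close>

lemma integral_bump_ge:
  assumes r: "r > 0"
  shows "(9/16) * r ^ 4 * (measure lborel (ball (0::'a::euclidean_space) 1) * (r/2) ^ DIM('a))
     \<le> (\<integral>z. bump r (z::'a) \<partial>lborel)"
proof -
  have "measure lborel (ball (0::'a) (r/2)) = measure lborel (ball (0::'a) 1) * (r/2) ^ DIM('a)"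
    using r by (simp add: content_ball)
  moreover have "(\<integral>z. (9/16) * r^4 * indicator (ball (0::'a) (r/2)) z \<partial>lborel) \<le> (\<integral>z. bump r (z::'a) \<partial>lborel)"
  proof (rule integral_mono)
    show "integrable lborel (\<lambda>z. (9/16) * r^4 * indicator (ball (0::'a) (r/2)) z :: real)"
      by (intro integrable_mult_right integrable_real_indicator) (use emeasure_lborel_ball_finite[of "0::'a" "r/2"] in auto)
    show "integrable lborel (bump r)" using integrable_bump r .
    fix z :: 'a
    show "(9/16) * r^4 * indicator (ball (0::'a) (r/2)) z \<le> bump r z"
    proof (cases "norm z < r/2")
      case True
      have "(norm z)\<^sup>2 \<le> (r/2)\<^sup>2" using True by (intro power_mono) auto
      then have "(3/4) * r\<^sup>2 \<le> r\<^sup>2 - (norm z)\<^sup>2" by (simp add: power_divide)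
      then have "((3/4) * r\<^sup>2)\<^sup>2 \<le> (max 0 (r\<^sup>2 - (norm z)\<^sup>2))\<^sup>2" by (intro power_mono max.coboundedI2) auto
      then show ?thesis using True by (simp add: bump_def power_mult_distrib power_divide indicator_def)
    qed (auto simp: indicator_def bump_nonneg)
  qed
  ultimately show ?thesis by (simp add: measure_def)
qed

lemma integral_bump_pos: "r > 0 \<Longrightarrow> 0 < (\<integral>z. bump r (z::'a::euclidean_space) \<partial>lborel)"
proof -
  assume r: "r > 0"
  have "measure lborel (ball (0::'a) 1) > 0" using content_ball_pos[of 1 "0::'a"] by simp
  then have "(9/16) * r ^ 4 * (measure lborel (ball (0::'a) 1) * (r/2) ^ DIM('a)) > 0"
    using r by simp
  then show ?thesis using integral_bump_ge[OF r, where 'a='a] by linarith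
qed

lemma bump_le: "r > 0 \<Longrightarrow> bump r z \<le> r ^ 4"
proof -
  assume "r > 0"
  have "(max 0 (r\<^sup>2 - (norm z)\<^sup>2))\<^sup>2 \<le> (r\<^sup>2)\<^sup>2" by (intro power_mono) auto
  then show ?thesis by (simp add: bump_def)
qed

text \<open>The bump is shifted off centre so that averaging against it only involves values on the cube
  with lower corner \<open>x\<close> and side \<open>2 r\<close>: the form in which the library has Lebesgue's
  differentiation theorem.\<close>

definition mollifier :: "real \<Rightarrow> 'a::euclidean_space \<Rightarrow> real" where
  "mollifier r z = bump r (z + r *\<^sub>R One) / (\<integral>z. bump r (z::'a) \<partial>lborel)"

definition mollifier_grad :: "real \<Rightarrow> 'a::euclidean_space \<Rightarrow> 'a" where
  "mollifier_grad r z = bump_grad r (z + r *\<^sub>R One) /\<^sub>R (\<integral>z. bump r (z::'a) \<partial>lborel)"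

lemma has_derivative_mollifier:
  fixes z :: "'a::euclidean_space"
  shows "(mollifier r has_derivative (\<lambda>h. mollifier_grad r z \<bullet> h)) (at z)"
proof -
  have 1: "((\<lambda>z. z + r *\<^sub>R One) has_derivative (\<lambda>h. h)) (at z)"
    by (auto intro!: derivative_eq_intros)
  have "((\<lambda>z. bump r (z + r *\<^sub>R One)) has_derivative (\<lambda>h. bump_grad r (z + r *\<^sub>R One) \<bullet> h)) (at z)"
    by (rule has_derivative_compose[OF 1 has_derivative_bump])
  from has_derivative_mult_left[OF this, of "inverse (\<integral>z. bump r (z::'a) \<partial>lborel)"]
  show ?thesis
    unfolding mollifier_def mollifier_grad_def divide_inverse
    by (rule has_derivative_eq_rhs) (auto simp: mult.commute)
qed

lemma continuous_on_mollifier_grad: "continuous_on S (mollifier_grad r)"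
  unfolding mollifier_grad_def
  by (intro continuous_intros continuous_on_compose2[OF continuous_on_bump_grad[of UNIV]]) auto

lemma continuous_on_mollifier: "continuous_on S (mollifier r)"
  unfolding mollifier_def divide_inverse
  by (intro continuous_intros continuous_on_compose2[OF continuous_on_bump[of UNIV]]) auto

lemma mollifier_nonneg: "0 \<le> mollifier r z"
  by (simp add: mollifier_def bump_nonneg)

lemma integral_mollifier:
  assumes r: "r > 0"
  shows "(\<integral>y. mollifier r (x - y) \<partial>lborel) = 1" "integrable lborel (\<lambda>y. mollifier r (x - y))"
proof -
  have m: "bump r \<in> borel_measurable borel"
    by (intro borel_measurable_continuous_onI continuous_on_bump)
  have eq: "mollifier r (x - y) = bump r ((x + r *\<^sub>R One) + (-1) *\<^sub>R y) / (\<integral>z. bump r (z::'a) \<partial>lborel)" for y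
    by (simp add: mollifier_def algebra_simps)
  show "(\<integral>y. mollifier r (x - y) \<partial>lborel) = 1"
    unfolding eq using integral_lborel_isometry(1)[of "-1", OF _ m, of "x + r *\<^sub>R One"] integral_bump_pos[OF r, where 'a='a] by simp
  show "integrable lborel (\<lambda>y. mollifier r (x - y))"
    unfolding eq using integral_lborel_isometry(2)[of "-1", OF _ m, of "x + r *\<^sub>R One"] integrable_bump[OF r, where 'a='a] by simp
qed

text \<open>The shift by \<open>r *\<^sub>R One\<close> turns |x_i - y_i + r| < r into 0 < y_i - x_i
  < 2r in every coordinate.\<close>

lemma mollifier_support:
  fixes x y :: "'a::euclidean_space"
  assumes r: "r > 0" and nz: "mollifier r (x - y) \<noteq> 0 \<or> mollifier_grad r (x - y) \<noteq> 0"
  shows "y \<in> cbox x (x + (2 * r) *\<^sub>R One)"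
proof -
  have "norm (x - y + r *\<^sub>R One) < r"
    using nz bump_outside[OF r, of "x - y + r *\<^sub>R One"] bump_grad_outside[OF r, of "x - y + r *\<^sub>R One"]
    by (force simp: mollifier_def mollifier_grad_def)
  then have "\<bar>(x - y + r *\<^sub>R One) \<bullet> i\<bar> < r" if "i \<in> Basis" for i
    using Basis_le_norm[OF that, of "x - y + r *\<^sub>R One"] by linarith
  then have "\<bar>x \<bullet> i - y \<bullet> i + r\<bar> < r" if "i \<in> Basis" for i
    using that by (fastforce simp: inner_diff_left inner_add_left)
  then show ?thesis
    by (force simp: mem_box inner_add_left)
qed

text \<open>The l^1 bound on the norm costs 2r per coordinate. The resulting radius is the range of
  the mollifier in every later localisation.\<close>

lemma mollifier_support_dist:
  fixes x y :: "'a::euclidean_space"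
  assumes r: "r > 0" and nz: "mollifier r (x - y) \<noteq> 0 \<or> mollifier_grad r (x - y) \<noteq> 0"
  shows "dist x y \<le> 2 * real DIM('a) * r"
proof -
  have "norm (y - x) \<le> (\<Sum>i\<in>Basis. \<bar>(y - x) \<bullet> i\<bar>)" by (rule norm_le_l1)
  also have "\<dots> \<le> (\<Sum>i\<in>(Basis::'a set). 2 * r)"
    using mollifier_support[OF assms] by (intro sum_mono) (auto simp: mem_box inner_diff_left inner_add_left)
  finally show ?thesis by (simp add: dist_norm norm_minus_commute)
qed

text \<open>Height at most r^4 over mass at least a multiple of r^4 (r/2)^DIM. Writing r/2 = (2r)/4
  expresses this through the volume of the supporting cube of side 2r, at the price of 4^DIM in
  \<open>C\<close>; averages against the mollifier are then dominated by \<open>C\<close> times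
  plain averages over that cube.\<close>

lemma mollifier_le:
  obtains C where "C \<ge> 0" "\<And>r (z::'a::euclidean_space). r > 0 \<Longrightarrow> mollifier r z \<le> C / (2 * r) ^ DIM('a)"
proof
  define c where "c = measure lborel (ball (0::'a) 1)"
  have c: "c > 0" using content_ball_pos[of 1 "0::'a"] by (simp add: c_def)
  define C where "C = 16 / 9 / c * 4 ^ DIM('a)"
  show "C \<ge> 0" using c by (simp add: C_def)
  fix r :: real and z :: 'a assume r: "r > 0"
  have "mollifier r z \<le> r ^ 4 / ((9/16) * r ^ 4 * (c * (r/2) ^ DIM('a)))"
    unfolding mollifier_def
    using r c bump_le[OF r] integral_bump_ge[OF r, where 'a='a]
    by (intro frac_le) (auto simp: c_def)
  also have "\<dots> = C / (2 * r) ^ DIM('a)"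
  proof -
    have "(r/2) ^ DIM('a) = (2 * r) ^ DIM('a) / 4 ^ DIM('a)"
      by (simp only: power_divide[symmetric]) (simp add: field_simps)
    then show ?thesis using r c by (simp add: C_def field_simps)
  qed
  finally show "mollifier r z \<le> C / (2 * r) ^ DIM('a)" .
qed

section \<open>Convolution with a C^1 kernel of compact support\<close>

lemma compact_support_uniformly_continuous:
  fixes f :: "'a::euclidean_space \<Rightarrow> 'b::real_normed_vector"
  assumes c: "continuous_on UNIV f" and z: "\<And>x. norm x > R \<Longrightarrow> f x = 0"
  shows "uniformly_continuous_on UNIV f" "bounded (range f)"
proof -
  have u: "uniformly_continuous_on (cball 0 (R + 1)) f"
    by (rule compact_uniformly_continuous) (auto intro: continuous_on_subset[OF c])
  show "uniformly_continuous_on UNIV f"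
    unfolding uniformly_continuous_on_def
  proof (intro allI impI)
    fix e :: real assume e: "e > 0"
    then obtain d where d: "d > 0" "\<And>x x'. x \<in> cball 0 (R+1) \<Longrightarrow> x' \<in> cball 0 (R+1) \<Longrightarrow> dist x' x < d \<Longrightarrow> dist (f x') (f x) < e"
      using u unfolding uniformly_continuous_on_def by meson
    show "\<exists>d>0. \<forall>x\<in>UNIV. \<forall>x'\<in>UNIV. dist x' x < d \<longrightarrow> dist (f x') (f x) < e"
    \<comment> \<open>Two points closer than 1 either both lie in \<open>cball 0 (R + 1)\<close>,
      where compactness applies, or both have norm above \<open>R\<close>, where \<open>f\<close>
      vanishes.\<close>
    proof (intro exI[of _ "min d 1"] conjI ballI impI)
      fix x x' :: 'a assume dx: "dist x' x < min d 1"
      have t: "norm x' \<le> norm x + dist x' x" "norm x \<le> norm x' + dist x' x"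
        by norm+
      show "dist (f x') (f x) < e"
      proof (cases "norm x \<le> R \<or> norm x' \<le> R")
        case True
        then have "x \<in> cball 0 (R+1)" "x' \<in> cball 0 (R+1)" using t dx by auto
        then show ?thesis using d dx by auto
      next
        case False
        then show ?thesis using z e by auto
      qed
    qed (use d in auto)
  qed
  have "compact (f ` cball 0 R)"
    by (intro compact_continuous_image continuous_on_subset[OF c]) auto
  then have "bounded (insert 0 (f ` cball 0 R))" by (simp add: compact_imp_bounded)
  moreover have "range f \<subseteq> insert 0 (f ` cball 0 R)" using z by (force simp: not_le)
  ultimately show "bounded (range f)" using bounded_subset by blast
qed

lemma measurable_lebesgue_continuous:
  fixes f :: "'a::euclidean_space \<Rightarrow> 'b::euclidean_space"
  assumes "continuous_on UNIV f"
  shows "f \<in> borel_measurable lebesgue"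
  using borel_measurable_continuous_onI[OF assms] by (intro measurable_completion) auto

text \<open>\<open>f\<close> is only integrable, so the derivative must fall on the kernel. Uniform
  continuity of \<open>D\<rho>\<close> bounds the linearisation error of \<open>\<rho>\<close> by
  \<open>norm (x' - x) * (e / A)\<close> uniformly in the integration variable, and integrating this
  against \<open>f\<close> gives differentiability directly.\<close>

lemma has_derivative_convolution:
  fixes f :: "'a::euclidean_space \<Rightarrow> real" and \<rho> :: "'a \<Rightarrow> real"
  assumes f: "integrable lebesgue f"
    and \<rho>: "\<And>x. (\<rho> has_derivative (\<lambda>h. D\<rho> x \<bullet> h)) (at x)"
    and cont: "continuous_on UNIV D\<rho>"
    and out: "\<And>x. norm x > R \<Longrightarrow> \<rho> x = 0" "\<And>x. norm x > R \<Longrightarrow> D\<rho> x = 0"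
  defines "DW \<equiv> (\<lambda>x. \<integral>y. f y *\<^sub>R D\<rho> (x - y) \<partial>lebesgue)"
  shows "((\<lambda>x. \<integral>y. \<rho> (x - y) *\<^sub>R f y \<partial>lebesgue) has_derivative (\<lambda>h. DW x \<bullet> h)) (at x)"
    and "continuous_on UNIV DW"
proof -
  have cr: "continuous_on UNIV \<rho>"
    using \<rho> has_derivative_continuous continuous_at_imp_continuous_on by blast
  obtain B1 where B1: "\<And>x. norm (\<rho> x) \<le> B1"
    using compact_support_uniformly_continuous(2)[OF cr out(1)] unfolding bounded_iff by auto
  obtain B2 where B2: "\<And>x. norm (D\<rho> x) \<le> B2"
    using compact_support_uniformly_continuous(2)[OF cont out(2)] unfolding bounded_iff by auto
  note fm[measurable] = borel_measurable_integrable[OF f]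
  have m1[measurable]: "(\<lambda>y. \<rho> (x - y)) \<in> borel_measurable lebesgue" for x
    by (intro measurable_lebesgue_continuous continuous_on_compose2[OF cr] continuous_intros) auto
  have m2[measurable]: "(\<lambda>y. D\<rho> (x - y)) \<in> borel_measurable lebesgue" for x
    by (intro measurable_lebesgue_continuous continuous_on_compose2[OF cont] continuous_intros) auto
  have i1: "integrable lebesgue (\<lambda>y. \<rho> (x - y) *\<^sub>R f y)" for x
    by (rule Bochner_Integration.integrable_bound[of _ "\<lambda>y. B1 * norm (f y)"])
       (use f in \<open>auto simp: abs_mult intro!: mult_right_mono AE_I2 order_trans[OF B1[unfolded real_norm_def]]\<close>)
  have i2: "integrable lebesgue (\<lambda>y. f y *\<^sub>R D\<rho> (x - y))" for x
    by (rule Bochner_Integration.integrable_bound[of _ "\<lambda>y. norm (f y) * B2"])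
       (use f in \<open>auto simp: abs_mult intro!: mult_left_mono AE_I2 order_trans[OF B2]\<close>)
  have i3: "integrable lebesgue (\<lambda>y. (D\<rho> (x - y) \<bullet> h) * f y)" for x h
  proof -
    have "integrable lebesgue (\<lambda>y. (f y *\<^sub>R D\<rho> (x - y)) \<bullet> h)"
      by (rule integrable_inner_left) (rule i2)
    then show ?thesis by (simp add: mult.commute)
  qed
  \<comment> \<open>The summand 1 keeps \<open>A\<close> positive when \<open>f\<close> vanishes
    almost everywhere, so that dividing by it is harmless.\<close>
  define A where "A = (\<integral>y. norm (f y) \<partial>lebesgue) + 1"
  have A: "A > 0" unfolding A_def by (intro add_nonneg_pos integral_nonneg_AE) auto
  have ucD: "\<exists>d>0. \<forall>x x'. dist x' x < d \<longrightarrow> norm (D\<rho> x' - D\<rho> x) < e" if "e > 0" for e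
    using compact_support_uniformly_continuous(1)[OF cont out(2)] that
    unfolding uniformly_continuous_on_def dist_norm by auto
  have bd: "norm (\<integral>y. F y *\<^sub>R f y \<partial>lebesgue) \<le> e * A"
    if "\<And>y. \<bar>F y\<bar> \<le> e" and "F \<in> borel_measurable lebesgue" for F and e
  proof -
    have e: "e \<ge> 0" using that(1)[of undefined] by auto
    have "norm (F y *\<^sub>R f y) \<le> e * norm (f y)" for y
      using that(1)[of y] by (simp add: abs_mult mult_right_mono)
    moreover have "integrable lebesgue (\<lambda>y. F y *\<^sub>R f y)"
      by (rule Bochner_Integration.integrable_bound[of lebesgue "\<lambda>y. e * norm (f y)"])
         (use f that e in \<open>auto simp: abs_mult intro!: mult_right_mono\<close>)
    ultimately have "norm (\<integral>y. F y *\<^sub>R f y \<partial>lebesgue) \<le> (\<integral>y. e * norm (f y) \<partial>lebesgue)"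
      by (intro Bochner_Integration.integral_norm_bound_integral) (use f in auto)
    also have "\<dots> \<le> e * A" using e unfolding A_def by (simp add: algebra_simps)
    finally show ?thesis .
  qed
  show "((\<lambda>x. \<integral>y. \<rho> (x - y) *\<^sub>R f y \<partial>lebesgue) has_derivative (\<lambda>h. DW x \<bullet> h)) (at x)"
    unfolding has_derivative_at_alt
  proof (intro conjI allI impI)
    show "bounded_linear (\<lambda>h. DW x \<bullet> h)" by (rule bounded_linear_inner_right)
    fix e :: real assume e: "e > 0"
    then obtain d where d: "d > 0" "\<And>x x'. dist x' x < d \<Longrightarrow> norm (D\<rho> x' - D\<rho> x) < e / A"
      using ucD[of "e / A"] A by fastforce
    have lin: "\<bar>\<rho> (x' - y) - \<rho> (x - y) - D\<rho> (x - y) \<bullet> (x' - x)\<bar> \<le> norm (x' - x) * (e / A)"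
      if "norm (x' - x) < d" for x' y
    proof -
      have "norm (\<rho> (x' - y) - \<rho> (x - y) - D\<rho> (x - y) \<bullet> ((x' - y) - (x - y))) \<le> norm ((x' - y) - (x - y)) * (e / A)"
      proof (rule differentiable_bound_linearization[where S="ball (x - y) d" and f'="\<lambda>x h. D\<rho> x \<bullet> h"])
        show "(x - y) + t *\<^sub>R ((x' - y) - (x - y)) \<in> ball (x - y) d" if t: "t \<in> {0..1}" for t
        proof -
          have "norm (t *\<^sub>R (x' - x)) \<le> 1 * norm (x' - x)"
            unfolding norm_scaleR using t by (intro mult_right_mono) auto
          then show ?thesis using \<open>norm (x' - x) < d\<close> by (simp add: dist_norm)
        qed
        show "(\<rho> has_derivative (\<lambda>h. D\<rho> z \<bullet> h)) (at z within ball (x - y) d)" for z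
          using \<rho> has_derivative_at_withinI by blast
        show "onorm ((\<lambda>h. D\<rho> z \<bullet> h) - (\<lambda>h. D\<rho> (x - y) \<bullet> h)) \<le> e / A" if "z \<in> ball (x - y) d" for z
        proof (rule onorm_le)
          fix h
          have "norm (D\<rho> z - D\<rho> (x - y)) \<le> e / A"
            using d(2)[of z "x - y"] that by (auto simp: dist_commute)
          then have "\<bar>(D\<rho> z - D\<rho> (x - y)) \<bullet> h\<bar> \<le> e / A * norm h"
            using Cauchy_Schwarz_ineq2[of "D\<rho> z - D\<rho> (x - y)" h] mult_right_mono[of "norm (D\<rho> z - D\<rho> (x - y))" "e/A" "norm h"]
            by auto
          then show "norm (((\<lambda>h. D\<rho> z \<bullet> h) - (\<lambda>h. D\<rho> (x - y) \<bullet> h)) h) \<le> e / A * norm h"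
            by (simp add: inner_diff_left)
        qed
        show "x - y \<in> ball (x - y) d" using d by simp
      qed
      then show ?thesis by simp
    qed
    show "\<exists>d>0. \<forall>y. norm (y - x) < d \<longrightarrow>
        norm ((\<integral>z. \<rho> (y - z) *\<^sub>R f z \<partial>lebesgue) - (\<integral>y. \<rho> (x - y) *\<^sub>R f y \<partial>lebesgue) - DW x \<bullet> (y - x)) \<le> e * norm (y - x)"
    proof (intro exI[of _ d] conjI allI impI)
      fix x' assume x': "norm (x' - x) < d"
      have "DW x \<bullet> (x' - x) = (\<integral>y. (D\<rho> (x - y) \<bullet> (x' - x)) *\<^sub>R f y \<partial>lebesgue)"
        unfolding DW_def
        by (subst integral_inner_left[symmetric]) (use i2 in \<open>auto simp: mult.commute\<close>)
      then have "(\<integral>z. \<rho> (x' - z) *\<^sub>R f z \<partial>lebesgue) - (\<integral>y. \<rho> (x - y) *\<^sub>R f y \<partial>lebesgue) - DW x \<bullet> (x' - x)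
         = (\<integral>y. \<rho> (x' - y) *\<^sub>R f y - \<rho> (x - y) *\<^sub>R f y - (D\<rho> (x - y) \<bullet> (x' - x)) *\<^sub>R f y \<partial>lebesgue)"
        using i1 i3 by (simp add: Bochner_Integration.integral_diff mult.commute)
      also have "\<dots> = (\<integral>y. (\<rho> (x' - y) - \<rho> (x - y) - (D\<rho> (x - y) \<bullet> (x' - x))) *\<^sub>R f y \<partial>lebesgue)"
        by (simp add: algebra_simps)
      also have "norm \<dots> \<le> (norm (x' - x) * (e / A)) * A"
        by (rule bd) (use lin[OF x'] in \<open>auto intro!: borel_measurable_inner borel_measurable_diff\<close>)
      finally show "norm ((\<integral>z. \<rho> (x' - z) *\<^sub>R f z \<partial>lebesgue) - (\<integral>y. \<rho> (x - y) *\<^sub>R f y \<partial>lebesgue) - DW x \<bullet> (x' - x)) \<le> e * norm (x' - x)"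
        using A by (simp add: mult.commute)
    qed (use d in auto)
  qed
  show "continuous_on UNIV DW"
    unfolding continuous_on_iff
  proof (intro ballI allI impI)
    fix x :: 'a and e :: real assume e: "e > 0"
    then obtain d where d: "d > 0" "\<And>x x'. dist x' x < d \<Longrightarrow> norm (D\<rho> x' - D\<rho> x) < e / (2 * A)"
      using ucD[of "e / (2 * A)"] A by fastforce
    show "\<exists>d>0. \<forall>x'\<in>UNIV. dist x' x < d \<longrightarrow> dist (DW x') (DW x) < e"
    proof (intro exI[of _ d] conjI ballI impI)
      fix x' assume x': "dist x' x < d"
      have "DW x' - DW x = (\<integral>y. f y *\<^sub>R (D\<rho> (x' - y) - D\<rho> (x - y)) \<partial>lebesgue)"
        unfolding DW_def using i2 by (simp add: Bochner_Integration.integral_diff scaleR_diff_right)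
      also have "norm \<dots> \<le> (\<integral>y. (e / (2 * A)) * norm (f y) \<partial>lebesgue)"
      proof (rule Bochner_Integration.integral_norm_bound_integral)
        show "integrable lebesgue (\<lambda>y. f y *\<^sub>R (D\<rho> (x' - y) - D\<rho> (x - y)))"
          using i2 by (simp add: scaleR_diff_right)
        show "norm (f y *\<^sub>R (D\<rho> (x' - y) - D\<rho> (x - y))) \<le> (e / (2 * A)) * norm (f y)" for y
          using d(2)[of "x' - y" "x - y"] x' mult_left_mono[of "norm (D\<rho> (x' - y) - D\<rho> (x - y))" "e / (2 * A)" "norm (f y)"]
          by (simp add: dist_norm mult.commute)
      qed (use f in auto)
      also have "\<dots> \<le> (e / (2 * A)) * A" using e A by (simp add: A_def divide_right_mono mult_left_mono)
      also have "\<dots> < e" using e A by simp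
      finally show "dist (DW x') (DW x) < e" by (simp add: dist_norm)
    qed (use d in auto)
  qed
qed

text \<open>The differentiation theorem concerns one fixed function, whereas
  \<open>norm (f y - f x)\<close> changes with \<open>x\<close>. It is therefore applied to
  \<open>norm (f y - q)\<close> for all \<open>q\<close> in a countable dense set, off a common null
  set; a \<open>q\<close> within e/3 of \<open>f x\<close> then makes three errors of size
  e/3.\<close>

lemma lebesgue_points:
  fixes f :: "'a::euclidean_space \<Rightarrow> 'b::euclidean_space"
  assumes f: "integrable lebesgue f"
  shows "AE x in lebesgue. \<forall>e>0. \<exists>d>0. \<forall>h. 0 < h \<and> h < d \<longrightarrow>
    (LINT y:cbox x (x + h *\<^sub>R One)|lebesgue. norm (f y - f x)) / h ^ DIM('a) < e"
proof -
  obtain D :: "'b set" where D: "countable D" "\<And>X. open X \<Longrightarrow> X \<noteq> {} \<Longrightarrow> \<exists>d\<in>D. d \<in> X"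
    by (erule countable_dense_setE)
  have si: "set_integrable lebesgue (cbox a b) (\<lambda>y. norm (f y - q))" for a b :: 'a and q
  proof -
    have "set_integrable lebesgue (cbox a b) f"
      using integrable_mult_indicator[OF _ f, of "cbox a b"] by (simp add: set_integrable_def)
    moreover have "set_integrable lebesgue (cbox a b) (\<lambda>y. q)"
      using integrable_on_const[of "cbox a b" q] absolutely_integrable_on_const[of "cbox a b" q] by auto
    ultimately show ?thesis
      by (intro set_integrable_norm set_integral_diff)
  qed
  have "AE x in lebesgue. \<forall>q\<in>D. \<forall>e>0. \<exists>d>0. \<forall>h. 0 < h \<and> h < d \<longrightarrow>
      norm (integral (cbox x (x + h *\<^sub>R One)) (\<lambda>y. norm (f y - q)) /\<^sub>R h ^ DIM('a) - norm (f x - q)) < e"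
  proof (rule AE_ball_countable'[OF _ D(1)])
    fix q assume "q \<in> D"
    have "(\<lambda>y. norm (f y - q)) integrable_on cbox a b" for a b :: 'a
      using si set_lebesgue_integral_eq_integral(1) by blast
    from integrable_ccontinuous_explicit[OF this] obtain N where N: "negligible N"
       "\<And>x e. \<lbrakk>x \<notin> N; 0 < e\<rbrakk> \<Longrightarrow> \<exists>d>0. \<forall>h. 0 < h \<and> h < d \<longrightarrow>
          norm (integral (cbox x (x + h *\<^sub>R One)) (\<lambda>y. norm (f y - q)) /\<^sub>R h ^ DIM('a) - norm (f x - q)) < e"
      by metis
    have "AE x in lebesgue. x \<notin> N"
      using N(1) by (intro AE_not_in) (simp add: negligible_iff_null_sets)
    then show "AE x in lebesgue. \<forall>e>0. \<exists>d>0. \<forall>h. 0 < h \<and> h < d \<longrightarrow>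
      norm (integral (cbox x (x + h *\<^sub>R One)) (\<lambda>y. norm (f y - q)) /\<^sub>R h ^ DIM('a) - norm (f x - q)) < e"
      by (rule eventually_mono) (use N(2) in blast)
  qed
  then show ?thesis
  proof (rule eventually_mono, intro allI impI)
    fix x and e :: real
    assume H: "\<forall>q\<in>D. \<forall>e>0. \<exists>d>0. \<forall>h. 0 < h \<and> h < d \<longrightarrow>
      norm (integral (cbox x (x + h *\<^sub>R One)) (\<lambda>y. norm (f y - q)) /\<^sub>R h ^ DIM('a) - norm (f x - q)) < e"
      and e: "e > 0"
    obtain q where q: "q \<in> D" "q \<in> ball (f x) (e/3)" using D(2)[of "ball (f x) (e/3)"] e by auto
    obtain d where d: "d > 0" "\<And>h. 0 < h \<and> h < d \<Longrightarrow>
      norm (integral (cbox x (x + h *\<^sub>R One)) (\<lambda>y. norm (f y - q)) /\<^sub>R h ^ DIM('a) - norm (f x - q)) < e/3"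
      using H[rule_format, OF q(1), of "e/3"] e by auto
    show "\<exists>d>0. \<forall>h. 0 < h \<and> h < d \<longrightarrow>
      (LINT y:cbox x (x + h *\<^sub>R One)|lebesgue. norm (f y - f x)) / h ^ DIM('a) < e"
    proof (intro exI[of _ d] conjI allI impI)
      fix h assume h: "0 < h \<and> h < d"
      let ?Q = "cbox x (x + h *\<^sub>R One)"
      have mQ: "measure lebesgue ?Q = h ^ DIM('a)"
        using h content_cbox[of x "x + h *\<^sub>R One"] by (auto simp: inner_add_left)
      have iq: "set_integrable lebesgue ?Q (\<lambda>y. norm (q - f x))"
        using absolutely_integrable_on_const[of ?Q] by auto
      have "(LINT y:?Q|lebesgue. norm (f y - f x)) \<le> (LINT y:?Q|lebesgue. norm (f y - q) + norm (q - f x))"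
        by (rule set_integral_mono) (use si iq in \<open>auto intro!: set_integral_add intro: norm_triangle_sub order_trans[OF _ norm_triangle_ineq]\<close>)
      also have "\<dots> = (LINT y:?Q|lebesgue. norm (f y - q)) + (LINT y:?Q|lebesgue. norm (q - f x))"
        by (rule set_integral_add) (use si iq in auto)
      also have "(LINT y:?Q|lebesgue. norm (q - f x)) = norm (q - f x) * h ^ DIM('a)"
        using mQ by (simp add: set_lebesgue_integral_def)
      also have "(LINT y:?Q|lebesgue. norm (f y - q)) = integral ?Q (\<lambda>y. norm (f y - q))"
        by (rule set_lebesgue_integral_eq_integral(2)[OF si])
      finally have "(LINT y:?Q|lebesgue. norm (f y - f x)) / h ^ DIM('a) \<le> integral ?Q (\<lambda>y. norm (f y - q)) /\<^sub>R h ^ DIM('a) + norm (q - f x)"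
        using h by (simp add: field_simps)
      also have "\<dots> < e"
        using d(2)[OF h] q(2) unfolding real_norm_def mem_ball dist_norm norm_minus_commute[of q] by linarith
      finally show "(LINT y:?Q|lebesgue. norm (f y - f x)) / h ^ DIM('a) < e" .
    qed (use d in auto)
  qed
qed

section \<open>Convergence, bounds and gradients of mollified functions\<close>

definition mollify :: "real \<Rightarrow> ('a::euclidean_space \<Rightarrow> 'b::euclidean_space) \<Rightarrow> 'a \<Rightarrow> 'b" where
  "mollify r f x = (\<integral>y. mollifier r (x - y) *\<^sub>R f y \<partial>lebesgue)"

lemma mollifier_measurable:
  "(\<lambda>y. mollifier r (x - y)) \<in> borel_measurable lebesgue"
  "(\<lambda>y. mollifier r (x - y)) \<in> borel_measurable lborel"
proof -
  have "continuous_on UNIV (\<lambda>y. mollifier r (x - y))"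
    by (intro continuous_on_compose2[OF continuous_on_mollifier[of UNIV]] continuous_intros) auto
  then show "(\<lambda>y. mollifier r (x - y)) \<in> borel_measurable lebesgue"
    "(\<lambda>y. mollifier r (x - y)) \<in> borel_measurable lborel"
    by (auto intro: measurable_lebesgue_continuous borel_measurable_continuous_onI)
qed

lemma integral_mollifier_lebesgue:
  assumes r: "r > 0"
  shows "(\<integral>y. mollifier r (x - y) \<partial>lebesgue) = 1" "integrable lebesgue (\<lambda>y. mollifier r (x - y))"
  using integral_mollifier[OF r, of x] mollifier_measurable(2)[of r x]
  by (simp_all add: integral_completion integrable_completion)

lemma integrable_mollify:
  fixes f :: "'a::euclidean_space \<Rightarrow> 'b::euclidean_space"
  assumes r: "r > 0" and f: "integrable lebesgue f"
  shows "integrable lebesgue (\<lambda>y. mollifier r (x - y) *\<^sub>R f y)"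
proof -
  obtain C where C: "\<And>r (z::'a::euclidean_space). r > 0 \<Longrightarrow> mollifier r z \<le> C / (2 * r) ^ DIM('a)"
    using mollifier_le by metis
  show ?thesis
  proof (rule Bochner_Integration.integrable_bound[of _ "\<lambda>y. (C / (2 * r) ^ DIM('a)) * norm (f y)"])
    show "(\<lambda>y. mollifier r (x - y) *\<^sub>R f y) \<in> borel_measurable lebesgue"
      using borel_measurable_integrable[OF f] mollifier_measurable by (intro borel_measurable_scaleR) auto
    show "AE y in lebesgue. norm (mollifier r (x - y) *\<^sub>R f y) \<le> norm ((C / (2 * r) ^ DIM('a)) * norm (f y))"
    proof (rule AE_I2)
      fix y
      have "mollifier r (x - y) * norm (f y) \<le> (C / (2 * r) ^ DIM('a)) * norm (f y)"
        using C[OF r] by (intro mult_right_mono) auto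
      then show "norm (mollifier r (x - y) *\<^sub>R f y) \<le> norm ((C / (2 * r) ^ DIM('a)) * norm (f y))"
        using mollifier_nonneg[of r "x - y"] by (simp only: norm_scaleR real_norm_def abs_of_nonneg)
    qed
  qed (use f in auto)
qed

text \<open>The kernel has mass 1, so the error at \<open>x\<close> is the kernel average of
  \<open>f y - f x\<close>. Its height and support bound this by \<open>C\<close> times the mean of
  \<open>norm (f y - f x)\<close> over a cube with corner \<open>x\<close>, which tends to 0 at a
  Lebesgue point.\<close>

lemma mollify_tendsto:
  fixes f :: "'a::euclidean_space \<Rightarrow> 'b::euclidean_space"
  assumes f: "integrable lebesgue f" and r: "\<And>n. r n > 0" "r \<longlonglongrightarrow> 0"
  shows "AE x in lebesgue. (\<lambda>n. mollify (r n) f x) \<longlonglongrightarrow> f x"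
proof -
  obtain C where C: "C \<ge> 0" "\<And>r (z::'a::euclidean_space). r > 0 \<Longrightarrow> mollifier r z \<le> C / (2 * r) ^ DIM('a)"
    using mollifier_le by metis
  show ?thesis
    using lebesgue_points[OF f]
  proof (rule eventually_mono)
    fix x
    assume L: "\<forall>e>0. \<exists>d>0. \<forall>h. 0 < h \<and> h < d \<longrightarrow>
      (LINT y:cbox x (x + h *\<^sub>R One)|lebesgue. norm (f y - f x)) / h ^ DIM('a) < e"
    have key: "norm (mollify s f x - f x) \<le> C * ((LINT y:cbox x (x + (2 * s) *\<^sub>R One)|lebesgue. norm (f y - f x)) / (2 * s) ^ DIM('a))"
      if s: "s > 0" for s
    proof -
      let ?Q = "cbox x (x + (2 * s) *\<^sub>R One)"
      have sf: "set_integrable lebesgue ?Q (\<lambda>y. f y - f x)"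
        using integrable_mult_indicator[OF _ f, of ?Q] absolutely_integrable_on_const[of ?Q]
        by (intro set_integral_diff) (auto simp: set_integrable_def)
      have id: "integrable lebesgue (\<lambda>y. mollifier s (x - y) *\<^sub>R (f y - f x))"
        using integrable_mollify[OF s f, of x] integral_mollifier_lebesgue(2)[OF s, of x] by (simp add: scaleR_diff_right)
      have "mollify s f x - f x = (\<integral>y. mollifier s (x - y) *\<^sub>R (f y - f x) \<partial>lebesgue)"
        using integrable_mollify[OF s f, of x] integral_mollifier_lebesgue[OF s, of x]
        by (simp add: mollify_def scaleR_diff_right Bochner_Integration.integral_diff)
      also have "norm \<dots> \<le> (\<integral>y. (C / (2 * s) ^ DIM('a)) * (indicator ?Q y *\<^sub>R norm (f y - f x)) \<partial>lebesgue)"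
      proof (rule Bochner_Integration.integral_norm_bound_integral[OF id])
        show "integrable lebesgue (\<lambda>y. (C / (2 * s) ^ DIM('a)) * (indicator ?Q y *\<^sub>R norm (f y - f x)))"
          using set_integrable_norm[OF sf] by (simp add: set_integrable_def)
        fix y
        show "norm (mollifier s (x - y) *\<^sub>R (f y - f x)) \<le> (C / (2 * s) ^ DIM('a)) * (indicator ?Q y *\<^sub>R norm (f y - f x))"
        proof (cases "y \<in> ?Q")
          case True
          then show ?thesis using C(2)[OF s, of "x - y"] mollifier_nonneg[of s "x - y"]
            mult_right_mono[OF C(2)[OF s, of "x - y"], of "norm (f y - f x)"] by simp
        next
          case False
          then have "mollifier s (x - y) = 0" using mollifier_support[OF s] by blast
          then show ?thesis using False by simp
        qed
      qed
      also have "\<dots> = C * ((LINT y:?Q|lebesgue. norm (f y - f x)) / (2 * s) ^ DIM('a))"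
        by (simp add: set_lebesgue_integral_def)
      finally show ?thesis .
    qed
    show "(\<lambda>n. mollify (r n) f x) \<longlonglongrightarrow> f x"
    proof (rule tendstoI)
      fix e :: real assume e: "e > 0"
      obtain d where d: "d > 0" "\<And>h. 0 < h \<and> h < d \<Longrightarrow>
        (LINT y:cbox x (x + h *\<^sub>R One)|lebesgue. norm (f y - f x)) / h ^ DIM('a) < e / (C + 1)"
        using L[rule_format, of "e / (C + 1)"] e C(1) by auto
      have "\<forall>\<^sub>F n in sequentially. r n < d / 2" using order_tendstoD(2)[OF r(2), of "d / 2"] d(1) by simp
      then show "\<forall>\<^sub>F n in sequentially. dist (mollify (r n) f x) (f x) < e"
      proof (rule eventually_mono)
        fix n assume n: "r n < d / 2"
        let ?I = "(LINT y:cbox x (x + (2 * r n) *\<^sub>R One)|lebesgue. norm (f y - f x)) / (2 * r n) ^ DIM('a)"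
        have "?I < e / (C + 1)" using d(2)[of "2 * r n"] n r(1)[of n] by simp
        then have "C * ?I \<le> C * (e / (C + 1))" using C(1) by (intro mult_left_mono) auto
        also have "\<dots> < e" using C(1) e by (simp add: field_simps)
        finally show "dist (mollify (r n) f x) (f x) < e"
          using key[OF r(1)[of n]] by (simp add: dist_norm)
      qed
    qed
  qed
qed

text \<open>The mollifier is a probability density of finite range, so the bound on \<open>f\<close>
  is asked for only within that range. This locality is what later keeps the approximations below
  the level away from the superlevel set.\<close>

lemma mollify_le:
  fixes f :: "'a::euclidean_space \<Rightarrow> real"
  assumes r: "r > 0" and f: "integrable lebesgue f"
    and le: "AE y in lebesgue. dist x y \<le> 2 * real DIM('a) * r \<longrightarrow> f y \<le> k"
  shows "mollify r f x \<le> k"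
proof -
  have "mollify r f x \<le> (\<integral>y. mollifier r (x - y) * k \<partial>lebesgue)"
    unfolding mollify_def
  proof (rule integral_mono_AE)
    show "integrable lebesgue (\<lambda>y. mollifier r (x - y) * k)"
      using integral_mollifier_lebesgue(2)[OF r, of x] by simp
    show "AE y in lebesgue. mollifier r (x - y) *\<^sub>R f y \<le> mollifier r (x - y) * k"
      using le
    proof (rule eventually_mono)
      fix y assume y: "dist x y \<le> 2 * real DIM('a) * r \<longrightarrow> f y \<le> k"
      show "mollifier r (x - y) *\<^sub>R f y \<le> mollifier r (x - y) * k"
        using mollifier_support_dist[OF r, of x y] y mollifier_nonneg[of r "x - y"]
        by (cases "mollifier r (x - y) = 0") (auto intro: mult_left_mono)
    qed
  qed (rule integrable_mollify[OF r f])
  also have "\<dots> = k" using integral_mollifier_lebesgue[OF r, of x] by simp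
  finally show ?thesis .
qed

lemma norm_mollify_le:
  fixes f :: "'a::euclidean_space \<Rightarrow> 'b::euclidean_space"
  assumes r: "r > 0" and f: "integrable lebesgue f" and le: "AE y in lebesgue. norm (f y) \<le> B"
  shows "norm (mollify r f x) \<le> B"
proof -
  have "norm (mollify r f x) \<le> (\<integral>y. norm (mollifier r (x - y) *\<^sub>R f y) \<partial>lebesgue)"
    unfolding mollify_def by (rule integral_norm_bound)
  also have "\<dots> = mollify r (\<lambda>y. norm (f y)) x"
    using mollifier_nonneg[of r, where 'a='a] by (simp add: mollify_def)
  also have "\<dots> \<le> B"
    by (rule mollify_le[OF r]) (use f le in auto)
  finally show ?thesis .
qed

lemma has_derivative_mollify:
  fixes f :: "'a::euclidean_space \<Rightarrow> real"
  assumes r: "r > 0" and f: "integrable lebesgue f"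
  shows "(mollify r f has_derivative (\<lambda>h. (\<integral>y. f y *\<^sub>R mollifier_grad r (x - y) \<partial>lebesgue) \<bullet> h)) (at x)"
    and "continuous_on UNIV (\<lambda>x. \<integral>y. f y *\<^sub>R mollifier_grad r (x - y) \<partial>lebesgue)"
proof -
  have o1: "mollifier r x = 0" "mollifier_grad r x = 0" if "norm x > 2 * real DIM('a) * r" for x :: 'a
    using mollifier_support_dist[OF r, of x 0] that by auto
  note * = has_derivative_convolution[OF f has_derivative_mollifier[of r] continuous_on_mollifier_grad o1]
  show "(mollify r f has_derivative (\<lambda>h. (\<integral>y. f y *\<^sub>R mollifier_grad r (x - y) \<partial>lebesgue) \<bullet> h)) (at x)"
    using *(1) unfolding mollify_def[abs_def] by simp
  show "continuous_on UNIV (\<lambda>x. \<integral>y. f y *\<^sub>R mollifier_grad r (x - y) \<partial>lebesgue)"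
    using *(2) by simp
qed

lemma C1c_grad_mollifier:
  assumes r: "r > 0" and sub: "cball x (2 * real DIM('a) * r) \<subseteq> \<Omega>"
  shows "C1c_grad \<Omega> (\<lambda>y::'a::euclidean_space. mollifier r (x - y)) (\<lambda>y. - mollifier_grad r (x - y))"
proof -
  have s: "{y. mollifier r (x - y) \<noteq> 0} \<subseteq> cball x (2 * real DIM('a) * r)"
    using mollifier_support_dist[OF r, of x] by auto
  then have cl: "closure {y. mollifier r (x - y) \<noteq> 0} \<subseteq> cball x (2 * real DIM('a) * r)"
    by (meson closed_cball closure_minimal)
  have "((\<lambda>y. mollifier r (x - y)) has_derivative (\<lambda>h. - mollifier_grad r (x - y) \<bullet> h)) (at y)" for y
  proof -
    have 1: "((\<lambda>y. x - y) has_derivative (\<lambda>h. - h)) (at y)" by (auto intro!: derivative_eq_intros)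
    show ?thesis using has_derivative_compose[OF 1 has_derivative_mollifier[of r "x - y"]] by simp
  qed
  moreover have "compact (closure {y. mollifier r (x - y) \<noteq> 0})"
    using s bounded_subset[OF bounded_cball] by (simp add: compact_closure)
  moreover have "continuous_on UNIV (\<lambda>y. - mollifier_grad r (x - y))"
    by (intro continuous_intros continuous_on_compose2[OF continuous_on_mollifier_grad[of UNIV]]) auto
  ultimately show ?thesis using cl sub unfolding C1c_grad_def by blast
qed

text \<open>For such \<open>x\<close> the function \<open>y \<mapsto> mollifier r (x - y)\<close> is
  itself an admissible test function; its gradient in y carries a minus sign that cancels the one in
  the definition of the weak gradient. The cut-off to \<open>K\<close> is harmless since the kernel
  is supported in \<open>K\<close>.\<close>

lemma mollify_weak_grad:
  fixes w :: "'a::euclidean_space \<Rightarrow> real"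
  assumes wg: "weak_grad \<Omega> w g" and r: "r > 0"
    and sub: "cball x (2 * real DIM('a) * r) \<subseteq> K" "K \<subseteq> \<Omega>"
  shows "(\<integral>y. (indicator K y * w y) *\<^sub>R mollifier_grad r (x - y) \<partial>lebesgue) = mollify r (\<lambda>y. indicator K y *\<^sub>R g y) x"
proof -
  have nz: "mollifier r (x - y) = 0" "mollifier_grad r (x - y) = 0" if "y \<notin> K" for y
    using mollifier_support_dist[OF r, of x y] that sub by (auto simp: subset_iff)
  have "(LINT y:\<Omega>|lebesgue. w y *\<^sub>R - mollifier_grad r (x - y)) = - (LINT y:\<Omega>|lebesgue. mollifier r (x - y) *\<^sub>R g y)"
    using wg C1c_grad_mollifier[OF r order_trans[OF sub]] unfolding weak_grad_def by blast
  moreover have "(LINT y:\<Omega>|lebesgue. w y *\<^sub>R - mollifier_grad r (x - y)) = - (\<integral>y. (indicator K y * w y) *\<^sub>R mollifier_grad r (x - y) \<partial>lebesgue)"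
    unfolding set_lebesgue_integral_def integral_minus[symmetric]
    by (rule Bochner_Integration.integral_cong) (use nz sub in \<open>auto simp: indicator_def\<close>)
  moreover have "(LINT y:\<Omega>|lebesgue. mollifier r (x - y) *\<^sub>R g y) = mollify r (\<lambda>y. indicator K y *\<^sub>R g y) x"
    unfolding set_lebesgue_integral_def mollify_def
    by (rule Bochner_Integration.integral_cong) (use nz sub in \<open>auto simp: indicator_def\<close>)
  ultimately show ?thesis by simp
qed

section \<open>Translation estimates\<close>

text \<open>The increment is the mean over t in [0, 1] of the derivative along the segment, so its
  square is at most the mean of the squares. Exchanging the integrals and shifting x by t h removes
  t. Nonnegative integrals allow the exchange without integrability on the product.\<close>

lemma integral_translation_diff_le:
  fixes F :: "'a::euclidean_space \<Rightarrow> real"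
  assumes F: "\<And>x. (F has_derivative (\<lambda>h. DF x \<bullet> h)) (at x)" and c: "continuous_on UNIV DF"
    and out: "\<And>x. norm x > R \<Longrightarrow> F x = 0" "\<And>x. norm x > R \<Longrightarrow> DF x = 0"
  shows "(\<integral>x. (F (h + x) - F x)\<^sup>2 \<partial>lborel) \<le> (norm h)\<^sup>2 * (\<integral>x. (norm (DF x))\<^sup>2 \<partial>lborel)"
proof -
  have cF: "continuous_on UNIV F"
    using F has_derivative_continuous continuous_at_imp_continuous_on by blast
  have [measurable]: "F \<in> borel_measurable borel" "DF \<in> borel_measurable borel"
    using cF c borel_measurable_continuous_onI by auto
  have point: "ennreal ((F (h + x) - F x)\<^sup>2) \<le> (\<integral>\<^sup>+t. ennreal (indicator {0..1} t * (DF (t *\<^sub>R h + x) \<bullet> h)\<^sup>2) \<partial>lborel)" for x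
  proof -
    define q where "q t = DF (t *\<^sub>R h + x) \<bullet> h" for t
    define m where "m = F (h + x) - F x"
    have cq: "continuous_on {0..1} q" unfolding q_def
      by (intro continuous_intros continuous_on_compose2[OF c]) auto
    have d: "((\<lambda>t. F (t *\<^sub>R h + x)) has_vector_derivative q t) (at t within {0..1})" for t
    proof -
      have 1: "((\<lambda>t. t *\<^sub>R h + x) has_derivative (\<lambda>s. s *\<^sub>R h)) (at t within {0..1})"
        by (auto intro!: derivative_eq_intros)
      show ?thesis unfolding has_vector_derivative_def q_def
        using has_derivative_compose[OF 1 F[of "t *\<^sub>R h + x"]] by simp
    qed
    have hb: "has_bochner_integral lborel (\<lambda>t. indicator {0..1} t *\<^sub>R q t) m"
      using has_bochner_integral_FTC_Icc[of 0 1 "\<lambda>t. F (t *\<^sub>R h + x)" q] d cq by (simp add: m_def)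
    have i0: "integrable lborel (\<lambda>t. indicator {0..1::real} t *\<^sub>R (1::real))" by simp
    have i1: "integrable lborel (\<lambda>t. indicator {0..1} t *\<^sub>R q t)" using hb has_bochner_integral_iff by blast
    have i2: "integrable lborel (\<lambda>t. indicator {0..1} t *\<^sub>R (q t)\<^sup>2)"
      by (rule borel_integrable_compact) (auto intro!: continuous_intros cq)
    note i' = i0[unfolded real_scaleR_def] i1[unfolded real_scaleR_def] i2[unfolded real_scaleR_def]
    \<comment> \<open>Cauchy-Schwarz on the unit interval in the form of a nonnegative variance:
      \<open>m\<close> is the mean of \<open>q\<close>, so this integral equals that of q^2 minus
      m^2.\<close>
    have "0 \<le> (\<integral>t. indicator {0..1} t * (q t - m)\<^sup>2 \<partial>lborel)"
      by (intro integral_nonneg_AE) auto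
    also have "(\<lambda>t. indicator {0..1} t * (q t - m)\<^sup>2) =
        (\<lambda>t. indicator {0..1} t * (q t)\<^sup>2 - (2 * m) * (indicator {0..1} t * q t) + m\<^sup>2 * (indicator {0..1} t * 1))"
      by (auto simp: fun_eq_iff indicator_def power2_eq_square algebra_simps)
    also have "integral\<^sup>L lborel \<dots>
       = (\<integral>t. indicator {0..1} t * (q t)\<^sup>2 \<partial>lborel) - (2 * m) * (\<integral>t. indicator {0..1} t * q t \<partial>lborel)
          + m\<^sup>2 * (\<integral>t. indicator {0..1::real} t * 1 \<partial>lborel)"
      by (subst Bochner_Integration.integral_add Bochner_Integration.integral_diff integral_mult_right_zero,
          (intro integrable_mult_right Bochner_Integration.integrable_diff i')+)+ simp
    also have "(\<integral>t. indicator {0..1} t * q t \<partial>lborel) = m" using hb has_bochner_integral_iff by auto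
    finally have "m\<^sup>2 \<le> (\<integral>t. indicator {0..1} t *\<^sub>R (q t)\<^sup>2 \<partial>lborel)" by (simp add: power2_eq_square)
    moreover have "(\<integral>\<^sup>+t. ennreal (indicator {0..1} t *\<^sub>R (q t)\<^sup>2) \<partial>lborel) = ennreal (\<integral>t. indicator {0..1} t *\<^sub>R (q t)\<^sup>2 \<partial>lborel)"
      by (rule nn_integral_eq_integral[OF i2]) auto
    ultimately show ?thesis by (simp add: q_def m_def ennreal_leI)
  qed
  have cs: "integrable lborel f" if "continuous_on UNIV f" "\<And>x. norm x > R' \<Longrightarrow> f x = 0" for f :: "'a \<Rightarrow> real" and R'
  proof -
    have "integrable lborel (\<lambda>x. indicator (cball 0 R') x *\<^sub>R f x)"
      by (rule borel_integrable_compact) (auto intro: continuous_on_subset[OF that(1)])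
    also have "(\<lambda>x. indicator (cball 0 R') x *\<^sub>R f x) = f"
      using that(2) by (auto simp: fun_eq_iff indicator_def)
    finally show ?thesis .
  qed
  have iD: "integrable lborel (\<lambda>x. (norm (DF x))\<^sup>2)"
    by (rule cs[of _ R]) (use out in \<open>auto intro!: continuous_intros c\<close>)
  have iF: "integrable lborel (\<lambda>x. (F (h + x) - F x)\<^sup>2)"
  proof (rule cs[of _ "R + norm h"])
    show "continuous_on UNIV (\<lambda>x. (F (h + x) - F x)\<^sup>2)"
      by (intro continuous_intros continuous_on_compose2[OF cF]) auto
    fix x :: 'a assume x: "norm x > R + norm h"
    have "norm x \<le> norm (h + x) + norm h" using norm_triangle_ineq4[of "h + x" h] by simp
    then have "norm (h + x) > R" "norm x > R" using x norm_ge_zero[of h] by linarith+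
    then show "(F (h + x) - F x)\<^sup>2 = 0" using out by simp
  qed
  have "ennreal (\<integral>x. (F (h + x) - F x)\<^sup>2 \<partial>lborel) = (\<integral>\<^sup>+x. ennreal ((F (h + x) - F x)\<^sup>2) \<partial>lborel)"
    by (rule nn_integral_eq_integral[OF iF, symmetric]) auto
  also have "\<dots> \<le> (\<integral>\<^sup>+x. (\<integral>\<^sup>+t. ennreal (indicator {0..1} t * (DF (t *\<^sub>R h + x) \<bullet> h)\<^sup>2) \<partial>lborel) \<partial>lborel)"
    by (rule nn_integral_mono) (rule point)
  also have "\<dots> = (\<integral>\<^sup>+t. (\<integral>\<^sup>+x. ennreal (indicator {0..1} t * (DF (t *\<^sub>R h + x) \<bullet> h)\<^sup>2) \<partial>lborel) \<partial>lborel)"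
    by (rule lborel_pair.Fubini'[symmetric]) measurable
  also have "\<dots> = (\<integral>\<^sup>+t. indicator {0..1::real} t * (\<integral>\<^sup>+x. ennreal ((DF x \<bullet> h)\<^sup>2) \<partial>lborel) \<partial>lborel)"
  proof (rule nn_integral_cong)
    fix t :: real
    have "(\<integral>\<^sup>+x. ennreal ((DF (t *\<^sub>R h + x) \<bullet> h)\<^sup>2) \<partial>lborel) = (\<integral>\<^sup>+x. ennreal ((DF x \<bullet> h)\<^sup>2) \<partial>lborel)"
      using nn_integral_lborel_isometry[of 1 "\<lambda>x. ennreal ((DF x \<bullet> h)\<^sup>2)" "t *\<^sub>R h"] by simp
    then show "(\<integral>\<^sup>+x. ennreal (indicator {0..1} t * (DF (t *\<^sub>R h + x) \<bullet> h)\<^sup>2) \<partial>lborel) = indicator {0..1::real} t * (\<integral>\<^sup>+x. ennreal ((DF x \<bullet> h)\<^sup>2) \<partial>lborel)"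
      by (cases "t \<in> {0..1}") auto
  qed
  also have "\<dots> = (\<integral>\<^sup>+x. ennreal ((DF x \<bullet> h)\<^sup>2) \<partial>lborel)"
    by (subst nn_integral_multc) auto
  also have "\<dots> \<le> (\<integral>\<^sup>+x. ennreal ((norm h)\<^sup>2 * (norm (DF x))\<^sup>2) \<partial>lborel)"
  proof (intro nn_integral_mono ennreal_leI)
    fix x
    have "\<bar>DF x \<bullet> h\<bar>\<^sup>2 \<le> (norm (DF x) * norm h)\<^sup>2"
      by (intro power_mono Cauchy_Schwarz_ineq2) auto
    then show "(DF x \<bullet> h)\<^sup>2 \<le> (norm h)\<^sup>2 * (norm (DF x))\<^sup>2" by (simp add: power_mult_distrib mult.commute)
  qed
  also have "\<dots> = ennreal (\<integral>x. (norm h)\<^sup>2 * (norm (DF x))\<^sup>2 \<partial>lborel)"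
    by (rule nn_integral_eq_integral) (use iD in auto)
  finally have "(\<integral>x. (F (h + x) - F x)\<^sup>2 \<partial>lborel) \<le> (\<integral>x. (norm h)\<^sup>2 * (norm (DF x))\<^sup>2 \<partial>lborel)"
    by (subst (asm) ennreal_le_iff) (auto intro!: integral_nonneg_AE)
  then show ?thesis by simp
qed

text \<open>Averaging over h: integrated over the whole space the overlap equals
  \<open>I\<^sup>2\<close>, which Cauchy-Schwarz on the support \<open>S\<close> bounds by |S| Q <=
  V Q / 4. If every h in the ball had overlap above Q / 2, the same integral would be at least V Q /
  2.\<close>

lemma exists_small_overlap:
  fixes \<Phi> :: "'a::euclidean_space \<Rightarrow> real"
  assumes \<Phi>[measurable]: "\<Phi> \<in> borel_measurable borel" and nn: "\<And>x. \<Phi> x \<ge> 0"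
    and i1: "integrable lborel \<Phi>" and i2: "integrable lborel (\<lambda>x. (\<Phi> x)\<^sup>2)"
    and Q: "(\<integral>x. (\<Phi> x)\<^sup>2 \<partial>lborel) > 0"
    and fin: "emeasure lborel {x. \<Phi> x \<noteq> 0} \<le> ennreal (measure lborel (ball (0::'a) r) / 4)" and r: "r > 0"
  obtains h where "norm h < r" "(\<integral>x. \<Phi> x * \<Phi> (h + x) \<partial>lborel) \<le> (\<integral>x. (\<Phi> x)\<^sup>2 \<partial>lborel) / 2"
proof -
  define Q where "Q = (\<integral>x. (\<Phi> x)\<^sup>2 \<partial>lborel)"
  define V where "V = measure lborel (ball (0::'a) r)"
  define I where "I = (\<integral>x. \<Phi> x \<partial>lborel)"
  define S where "S = {x. \<Phi> x \<noteq> 0}"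
  have Sm[measurable]: "S \<in> sets borel" unfolding S_def by measurable
  have V: "V > 0" using content_ball_pos[OF r, of "0::'a"] by (simp add: V_def)
  have Sf: "emeasure lborel S < \<infinity>" using fin by (auto simp: S_def intro: le_less_trans)
  have SV: "measure lborel S \<le> V / 4"
    using fin enn2real_mono[OF fin] V by (simp add: S_def V_def measure_def)
  have I0: "I \<ge> 0" unfolding I_def by (intro integral_nonneg_AE) (use nn in auto)
  have CS: "I\<^sup>2 \<le> measure lborel S * Q"
  proof (cases "measure lborel S = 0")
    case True
    then have "emeasure lborel S = 0" using Sf by (auto simp: measure_def enn2real_eq_0_iff)
    then have "AE x in lborel. x \<notin> S" by (intro AE_not_in) (auto simp: null_sets_def)
    then have "AE x in lborel. \<Phi> x = 0" by (auto simp: S_def)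
    then have "I = 0" unfolding I_def using integral_eq_zero_AE by auto
    then show ?thesis using True by simp
  next
    case False
    define \<mu> where "\<mu> = measure lborel S"
    have mu: "\<mu> > 0" using False by (simp add: \<mu>_def zero_less_measure_iff)
    have iS: "integrable lborel (\<lambda>x. indicator S x :: real)" using Sf by (intro integrable_real_indicator) auto
    \<comment> \<open>A variance once more: \<open>I / \<mu>\<close> is the mean of
      \<open>\<Phi>\<close> over its support.\<close>
    have "0 \<le> (\<integral>x. (\<Phi> x - (I / \<mu>) * indicator S x)\<^sup>2 \<partial>lborel)" by (intro integral_nonneg_AE) auto
    also have "(\<lambda>x. (\<Phi> x - (I / \<mu>) * indicator S x)\<^sup>2) = (\<lambda>x. (\<Phi> x)\<^sup>2 - (2 * I / \<mu>) * \<Phi> x + (I / \<mu>)\<^sup>2 * indicator S x)"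
      by (auto simp: fun_eq_iff indicator_def S_def power2_eq_square algebra_simps)
    also have "(\<integral>x. (\<Phi> x)\<^sup>2 - (2 * I / \<mu>) * \<Phi> x + (I / \<mu>)\<^sup>2 * indicator S x \<partial>lborel) = Q - (2 * I / \<mu>) * I + (I / \<mu>)\<^sup>2 * \<mu>"
      using i1 i2 iS by (simp add: Q_def I_def \<mu>_def)
    also have "\<dots> = Q - I\<^sup>2 / \<mu>" using mu by (simp add: power2_eq_square field_simps)
    finally show ?thesis using mu by (simp add: \<mu>_def field_simps)
  qed
  have bnd: "(\<integral>\<^sup>+h. (\<integral>\<^sup>+x. ennreal (\<Phi> x * \<Phi> (h + x)) \<partial>lborel) \<partial>lborel) = ennreal (I\<^sup>2)"
  proof -
    have "(\<integral>\<^sup>+h. (\<integral>\<^sup>+x. ennreal (\<Phi> x * \<Phi> (h + x)) \<partial>lborel) \<partial>lborel) = (\<integral>\<^sup>+x. (\<integral>\<^sup>+h. ennreal (\<Phi> x * \<Phi> (h + x)) \<partial>lborel) \<partial>lborel)"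
      by (rule lborel_pair.Fubini') measurable
    also have "\<dots> = (\<integral>\<^sup>+x. ennreal (\<Phi> x) * ennreal I \<partial>lborel)"
    proof (rule nn_integral_cong)
      fix x
      have "(\<integral>\<^sup>+h. ennreal (\<Phi> x * \<Phi> (h + x)) \<partial>lborel) = (\<integral>\<^sup>+h. ennreal (\<Phi> x) * ennreal (\<Phi> (h + x)) \<partial>lborel)"
        using nn by (simp add: ennreal_mult)
      also have "\<dots> = ennreal (\<Phi> x) * (\<integral>\<^sup>+h. ennreal (\<Phi> (x + 1 *\<^sub>R h)) \<partial>lborel)"
        by (subst nn_integral_cmult) (auto simp: add.commute)
      also have "(\<integral>\<^sup>+h. ennreal (\<Phi> (x + 1 *\<^sub>R h)) \<partial>lborel) = (\<integral>\<^sup>+h. ennreal (\<Phi> h) \<partial>lborel)"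
        by (rule nn_integral_lborel_isometry) auto
      also have "\<dots> = ennreal I" unfolding I_def by (rule nn_integral_eq_integral[OF i1]) (use nn in auto)
      finally show "(\<integral>\<^sup>+h. ennreal (\<Phi> x * \<Phi> (h + x)) \<partial>lborel) = ennreal (\<Phi> x) * ennreal I" .
    qed
    also have "\<dots> = (\<integral>\<^sup>+x. ennreal (\<Phi> x) \<partial>lborel) * ennreal I"
      by (rule nn_integral_multc) auto
    also have "(\<integral>\<^sup>+x. ennreal (\<Phi> x) \<partial>lborel) = ennreal I"
      unfolding I_def by (rule nn_integral_eq_integral[OF i1]) (use nn in auto)
    finally show ?thesis using I0 by (simp add: ennreal_mult[symmetric] power2_eq_square)
  qed
  have "\<exists>h. norm h < r \<and> (\<integral>\<^sup>+x. ennreal (\<Phi> x * \<Phi> (h + x)) \<partial>lborel) \<le> ennreal (Q / 2)"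
  proof (rule ccontr)
    assume "\<not> ?thesis"
    then have big: "ennreal (Q/2) \<le> (\<integral>\<^sup>+x. ennreal (\<Phi> x * \<Phi> (h + x)) \<partial>lborel)" if "norm h < r" for h
      using that by (meson linear)
    have "(\<integral>\<^sup>+h. ennreal (Q/2) * indicator (ball (0::'a) r) h \<partial>lborel) \<le> (\<integral>\<^sup>+h. (\<integral>\<^sup>+x. ennreal (\<Phi> x * \<Phi> (h + x)) \<partial>lborel) \<partial>lborel)"
      by (intro nn_integral_mono) (use big in \<open>auto simp: indicator_def\<close>)
    then have "ennreal (Q/2) * emeasure lborel (ball (0::'a) r) \<le> ennreal (I\<^sup>2)"
      unfolding bnd by (subst (asm) nn_integral_cmult_indicator) auto
    moreover have "emeasure lborel (ball (0::'a) r) = ennreal V"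
      unfolding V_def using emeasure_lborel_ball_finite[of "0::'a" r] by (intro emeasure_eq_ennreal_measure) auto
    ultimately have "Q / 2 * V \<le> I\<^sup>2"
      using V Q by (simp add: Q_def ennreal_mult[symmetric])
    also have "\<dots> \<le> V / 4 * Q"
      using CS mult_right_mono[OF SV, of Q] Q[folded Q_def] by linarith
    finally show False using mult_pos_pos[OF Q[folded Q_def] V] by (simp add: mult.commute)
  qed
  then obtain h where h: "norm h < r" "(\<integral>\<^sup>+x. ennreal (\<Phi> x * \<Phi> (h + x)) \<partial>lborel) \<le> ennreal (Q / 2)" by blast
  have "(\<integral>x. \<Phi> x * \<Phi> (h + x) \<partial>lborel) \<le> Q / 2"
  proof -
    have "(\<integral>x. \<Phi> x * \<Phi> (h + x) \<partial>lborel) = enn2real (\<integral>\<^sup>+x. ennreal (\<Phi> x * \<Phi> (h + x)) \<partial>lborel)"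
      by (rule integral_eq_nn_integral) (use nn in auto)
    also have "\<dots> \<le> enn2real (ennreal (Q/2))" by (rule enn2real_mono[OF h(2)]) auto
    finally show ?thesis using Q by (simp add: Q_def)
  qed
  then show ?thesis using that h(1) by (simp add: Q_def)
qed

text \<open>\<open>G\<close> stands for |grad w|, but only the listed integral inequalities link it
  to \<open>w\<close>. Expanding the square turns \<open>trans\<close> into a lower bound for the
  overlap of s^2 with its translates, so a contradiction needs an h with small overlap: disjoint
  supports provide it when the top level is a plateau, averaging when it is a null set.\<close>

lemma no_positive_superlevel:
  fixes w G :: "'a::euclidean_space \<Rightarrow> real"
  assumes wm[measurable]: "w \<in> borel_measurable borel" and Gm[measurable]: "G \<in> borel_measurable borel"
    and bnd: "AE x in lborel. w x \<le> B"
    and supp: "AE x in lborel. w x > k0 \<longrightarrow> norm x \<le> R"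
    and A: "A \<ge> 0"
    and int: "\<And>k. k \<ge> k0 \<Longrightarrow> integrable lborel (\<lambda>x. (max 0 (w x - k))\<^sup>2 * (G x)\<^sup>2)"
    and energy: "\<And>k. k \<ge> k0 \<Longrightarrow> (\<integral>x. (max 0 (w x - k))\<^sup>2 * (G x)\<^sup>2 \<partial>lborel)
                   \<le> A * (\<integral>x. indicator {x. G x \<noteq> 0} x * (max 0 (w x - k)) ^ 4 \<partial>lborel)"
    and trans: "\<And>k h. k \<ge> k0 \<Longrightarrow> (\<integral>x. ((max 0 (w (h + x) - k))\<^sup>2 - (max 0 (w x - k))\<^sup>2)\<^sup>2 \<partial>lborel)
                   \<le> 4 * (norm h)\<^sup>2 * (\<integral>x. (max 0 (w x - k))\<^sup>2 * (G x)\<^sup>2 \<partial>lborel)"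
  shows "emeasure lborel {x. w x > k0} = 0"
proof (rule ccontr)
  assume pos: "emeasure lborel {x. w x > k0} \<noteq> 0"
  define S where "S = {x. w x > k0}"
  have [measurable]: "S \<in> sets borel" unfolding S_def by measurable
  have Sf: "emeasure lborel S < \<infinity>"
  proof -
    have "emeasure lborel S \<le> emeasure lborel (cball (0::'a) R)"
      by (rule emeasure_mono_AE) (use supp in \<open>auto simp: S_def\<close>)
    also have "\<dots> < \<infinity>" using emeasure_lborel_cball_finite[of "0::'a" R] by simp
    finally show ?thesis .
  qed
  have Sfin: "emeasure lborel T \<noteq> \<infinity>" "emeasure lborel T < \<infinity>" if "T \<subseteq> S" for T
    using emeasure_mono[OF that, of lborel] Sf by auto
  have iS: "integrable lborel (\<lambda>x. c * indicator T x)" if "T \<subseteq> S" "T \<in> sets borel" for T and c :: real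
    using Sfin[OF that(1)] that(2) by (intro integrable_mult_right integrable_real_indicator) auto
  \<comment> \<open>\<open>m\<close> is the essential supremum of \<open>w\<close>.\<close>
  define T where "T = {t. emeasure lborel {x. w x > t} = 0}"
  have BT: "B \<in> T"
    using bnd AE_iff_measurable[of "{x. w x > B}" lborel "\<lambda>x. w x \<le> B"] by (auto simp: T_def not_le)
  have Tlow: "t > k0" if "t \<in> T" for t
  proof (rule ccontr)
    assume "\<not> t > k0"
    then have "emeasure lborel {x. w x > k0} \<le> emeasure lborel {x. w x > t}"
      by (intro emeasure_mono) auto
    then show False using that pos by (simp add: T_def)
  qed
  define m where "m = Inf T"
  have bb: "bdd_below T" using Tlow by (meson bdd_belowI less_imp_le)
  have nonnull: "emeasure lborel {x. w x > k} \<noteq> 0" if "k < m" for k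
    using cInf_lower[OF _ bb, of k] that by (auto simp: T_def m_def)
  have null: "emeasure lborel {x. w x > m} = 0"
  proof -
    have "emeasure lborel {x. w x > m + 1 / real (Suc n)} = 0" for n
    proof -
      obtain t where t: "t \<in> T" "t < m + 1 / real (Suc n)"
        using cInf_lessD[of T "m + 1 / real (Suc n)"] BT by (auto simp: m_def)
      have "emeasure lborel {x. w x > m + 1 / real (Suc n)} \<le> emeasure lborel {x. w x > t}"
        by (intro emeasure_mono) (use t in auto)
      then show ?thesis using t(1) by (simp add: T_def)
    qed
    then have "emeasure lborel (\<Union>n. {x. w x > m + 1 / real (Suc n)}) = 0"
      by (intro emeasure_UN_eq_0) auto
    moreover have "(\<Union>n. {x. w x > m + 1 / real (Suc n)}) = {x. w x > m}"
    proof (auto)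
      fix x assume "m < w x"
      then obtain n where "1 / real (Suc n) < w x - m" using nat_approx_posE[of "w x - m"] by auto
      then show "\<exists>n. m + 1 / (1 + real n) < w x" by (intro exI[of _ n]) simp
    next
      fix x n assume "m + 1 / (1 + real n) < w x"
      moreover have "0 < 1 / (1 + real n)" by simp
      ultimately show "m < w x" by linarith
    qed
    ultimately show ?thesis by simp
  qed
  have wle: "AE x in lborel. w x \<le> m"
    using null AE_iff_measurable[of "{x. w x > m}" lborel "\<lambda>x. w x \<le> m"] by (auto simp: not_le)
  have mT: "m \<in> T" using null by (simp add: T_def)
  have mk: "m > k0" using Tlow[OF mT] .
  have frac: "(m - k0) / real (Suc n) \<le> m - k0" "(m - k0) / real (Suc n) > 0" for n
    using mk frac_le[of "m - k0" "m - k0" 1 "real (Suc n)"] by auto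
  define s where "s k x = max 0 (w x - k)" for k x
  have sm[measurable]: "s k \<in> borel_measurable borel" for k unfolding s_def by measurable
  have s0: "s k x \<ge> 0" for k x by (simp add: s_def)
  have sle: "AE x in lborel. s k x \<le> m - k" if "k < m" for k
    using wle by (rule eventually_mono) (use that in \<open>auto simp: s_def\<close>)
  have spow: "AE x in lborel. s k x ^ n \<le> (m - k) ^ n * indicator {x. w x > k} x" if "k < m" "n > 0" for k n
    using sle[OF that(1)]
  proof (rule eventually_mono)
    fix x assume x: "s k x \<le> m - k"
    show "s k x ^ n \<le> (m - k) ^ n * indicator {x. w x > k} x"
    proof (cases "w x > k")
      case True then show ?thesis using power_mono[OF x s0] by simp
    next
      case False then have "s k x = 0" by (simp add: s_def)
      then show ?thesis using that False by (simp add: zero_power)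
    qed
  qed
  have spow4: "AE x in lborel. s k x ^ 4 \<le> (m - k) ^ 4 * indicator {x. w x > k} x" if "k < m" for k
    by (rule spow[OF that]) simp
  have sub: "{x. w x > k} \<subseteq> S" if "k \<ge> k0" for k using that by (auto simp: S_def)
  have ispow: "integrable lborel (\<lambda>x. s k x ^ n)" if "k0 \<le> k" "k < m" "n > 0" for k n
  proof (rule Bochner_Integration.integrable_bound[OF iS[OF sub[OF that(1)], of "(m - k) ^ n"]])
    show "AE x in lborel. norm (s k x ^ n) \<le> norm ((m - k) ^ n * indicator {x. w x > k} x)"
      using spow[OF that(2,3)] by (rule eventually_mono) (use s0 that in \<open>auto simp: abs_mult\<close>)
  qed auto
  have ispowG: "integrable lborel (\<lambda>x. indicator {x. G x \<noteq> 0} x * s k x ^ n)" if "k0 \<le> k" "k < m" "n > 0" for k n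
    by (rule Bochner_Integration.integrable_bound[OF ispow[OF that]]) (auto simp: indicator_def)
  note energy = energy[folded s_def] and int = int[folded s_def]
  note trans = trans[folded s_def]
  have en_le: "(\<integral>x. indicator {x. G x \<noteq> 0} x * s k x ^ 4 \<partial>lborel) \<le> (\<integral>x. s k x ^ 4 \<partial>lborel)"
    if "k0 \<le> k" "k < m" for k
    by (rule integral_mono) (use ispow[OF that, of 4] ispowG[OF that, of 4] in \<open>auto simp: indicator_def\<close>)
  define P where "P = {x. w x = m}"
  have [measurable]: "P \<in> sets borel" unfolding P_def by measurable
  have PS: "P \<subseteq> S" using mk by (auto simp: P_def S_def)
  \<comment> \<open>The energy estimate itself forces the gradient to vanish on the top level set.\<close>
  have G0: "AE x in lborel. w x = m \<longrightarrow> G x = 0"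
  proof -
    have iG: "integrable lborel (\<lambda>x. indicator P x * (G x)\<^sup>2)"
    proof (rule Bochner_Integration.integrable_bound)
      show "integrable lborel (\<lambda>x. (1 / (m - k0)\<^sup>2) * ((s k0 x)\<^sup>2 * (G x)\<^sup>2))"
        using int[of k0] by (intro integrable_mult_right) auto
      show "AE x in lborel. norm (indicator P x * (G x)\<^sup>2) \<le> norm ((1 / (m - k0)\<^sup>2) * ((s k0 x)\<^sup>2 * (G x)\<^sup>2))"
        by (rule AE_I2) (use mk in \<open>auto simp: indicator_def P_def s_def\<close>)
    qed measurable
    \<comment> \<open>On \<open>P\<close> the truncation equals m - k exactly, so (m - k)^2 times
      the integral is at most A (m - k)^4 |S|. Two powers of m - k survive the division and vanish
      as k tends to m.\<close>
    have bd: "(\<integral>x. indicator P x * (G x)\<^sup>2 \<partial>lborel) \<le> A * (m - k)\<^sup>2 * measure lborel S" if k: "k0 \<le> k" "k < m" for k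
    proof -
      have "(m - k)\<^sup>2 * (\<integral>x. indicator P x * (G x)\<^sup>2 \<partial>lborel) = (\<integral>x. (m - k)\<^sup>2 * (indicator P x * (G x)\<^sup>2) \<partial>lborel)"
        by simp
      also have "\<dots> \<le> (\<integral>x. (s k x)\<^sup>2 * (G x)\<^sup>2 \<partial>lborel)"
        by (rule integral_mono) (use iG int[OF k(1)] k in \<open>auto simp: indicator_def P_def s_def\<close>)
      also have "\<dots> \<le> A * (\<integral>x. s k x ^ 4 \<partial>lborel)"
        using energy[OF k(1)] mult_left_mono[OF en_le[OF k] A] by linarith
      also have "\<dots> \<le> A * (\<integral>x. (m - k) ^ 4 * indicator S x \<partial>lborel)"
      proof (rule mult_left_mono[OF integral_mono_AE A])
        show "AE x in lborel. s k x ^ 4 \<le> (m - k) ^ 4 * indicator S x"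
          using spow4[OF k(2)]
        proof (rule eventually_mono)
          fix x assume x: "s k x ^ 4 \<le> (m - k) ^ 4 * indicator {x. w x > k} x"
          have "indicator {x. w x > k} x \<le> (indicator S x :: real)" using sub[OF k(1)] by (auto simp: indicator_def)
          then show "s k x ^ 4 \<le> (m - k) ^ 4 * indicator S x"
            using mult_left_mono[of "indicator {x. w x > k} x" "indicator S x" "(m - k) ^ 4"] x by auto
        qed
      qed (use ispow[OF k, of 4] iS[of S] in auto)
      also have "\<dots> = (m - k)\<^sup>2 * (A * (m - k)\<^sup>2 * measure lborel S)"
        by (simp add: power2_eq_square power4_eq_xxxx)
      finally show ?thesis using k by (simp add: mult_le_cancel_left_pos)
    qed
    have "(\<lambda>n. A * (m - (m - (m - k0) / real (Suc n)))\<^sup>2 * measure lborel S) \<longlonglongrightarrow> 0"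
    proof -
      have "(\<lambda>n. (m - k0) * inverse (real (Suc n))) \<longlonglongrightarrow> (m - k0) * 0"
        by (intro tendsto_mult tendsto_const LIMSEQ_inverse_real_of_nat)
      from tendsto_mult[OF tendsto_mult[OF tendsto_const[of A] tendsto_power[OF this, of 2]] tendsto_const[of "measure lborel S"]]
      show ?thesis by (simp add: divide_inverse)
    qed
    then have "(\<integral>x. indicator P x * (G x)\<^sup>2 \<partial>lborel) \<le> 0"
    proof (rule LIMSEQ_le_const, intro exI[of _ 0] allI impI)
      fix n
      show "(\<integral>x. indicator P x * (G x)\<^sup>2 \<partial>lborel) \<le> A * (m - (m - (m - k0) / real (Suc n)))\<^sup>2 * measure lborel S"
        by (intro bd) (use frac[of n] in auto)
    qed
    moreover have "(\<integral>x. indicator P x * (G x)\<^sup>2 \<partial>lborel) \<ge> 0" by (intro integral_nonneg_AE) auto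
    ultimately have "(\<integral>x. indicator P x * (G x)\<^sup>2 \<partial>lborel) = 0" by linarith
    then have "AE x in lborel. indicator P x * (G x)\<^sup>2 = 0"
      using integral_nonneg_eq_0_iff_AE[OF iG] by auto
    then show ?thesis by (rule eventually_mono) (auto simp: indicator_def P_def split: if_splits)
  qed
  \<comment> \<open>With the plateau {w = m} left out, these sets shrink to the empty set as
    \<open>k\<close> increases to \<open>m\<close>; since \<open>S\<close> has finite measure, their
    measures tend to 0.\<close>
  define N where "N k = {x. k < w x \<and> w x < m}" for k
  have [measurable]: "N k \<in> sets borel" for k unfolding N_def by measurable
  have NS: "N k \<subseteq> S" if "k0 \<le> k" for k using that by (auto simp: N_def S_def)
  have small: "\<exists>k. k0 \<le> k \<and> k < m \<and> measure lborel (N k) < e" if "e > 0" for e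
  proof -
    \<comment> \<open>Equals \<open>k0\<close> at n = 0 and increases to \<open>m\<close>, so every
      term is an admissible level.\<close>
    define K where "K n = m - (m - k0) / real (Suc n)" for n
    have K: "k0 \<le> K n" "K n < m" for n
      using frac[of n] by (auto simp: K_def)
    have mono: "K n \<le> K n'" if "n \<le> n'" for n n'
      using that mk by (auto simp: K_def intro!: divide_left_mono)
    have "(\<lambda>n. measure lborel (N (K n))) \<longlonglongrightarrow> measure lborel (\<Inter>n. N (K n))"
    proof (rule Lim_measure_decseq)
      show "decseq (\<lambda>n. N (K n))" using mono by (force simp: decseq_def N_def intro: le_less_trans)
      show "emeasure lborel (N (K n)) \<noteq> \<infinity>" for n using Sfin(1)[OF NS[OF K(1)]] .
    qed auto
    moreover have "(\<Inter>n. N (K n)) = {}"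
    proof (rule ccontr)
      assume "(\<Inter>n. N (K n)) \<noteq> {}"
      then obtain x where x: "\<And>n. K n < w x" "w x < m" by (auto simp: N_def)
      have "(\<lambda>n. m - (m - k0) * inverse (real (Suc n))) \<longlonglongrightarrow> m - (m - k0) * 0"
        by (intro tendsto_mult tendsto_diff tendsto_const LIMSEQ_inverse_real_of_nat)
      then have "K \<longlonglongrightarrow> m" by (simp add: K_def[abs_def] divide_inverse)
      then have "m \<le> w x" by (rule LIMSEQ_le_const2) (use x in \<open>auto intro: less_imp_le\<close>)
      then show False using x by simp
    qed
    ultimately have "(\<lambda>n. measure lborel (N (K n))) \<longlonglongrightarrow> 0" by simp
    then have "\<forall>\<^sub>F n in sequentially. measure lborel (N (K n)) < e" using order_tendstoD(2) that by blast
    then obtain n where "measure lborel (N (K n)) < e" by (auto simp: eventually_sequentially)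
    then show ?thesis using K by blast
  qed
  have shift: "integrable lborel (\<lambda>x. s k (h + x) ^ n)" "(\<integral>x. s k (h + x) ^ n \<partial>lborel) = (\<integral>x. s k x ^ n \<partial>lborel)"
    if "k0 \<le> k" "k < m" "n > 0" for k h n
    using integral_lborel_isometry[of 1 "\<lambda>x. s k x ^ n" h] ispow[OF that] by auto
  have iprod: "integrable lborel (\<lambda>x. (s k x)\<^sup>2 * (s k (h + x))\<^sup>2)" if "k0 \<le> k" "k < m" for k h
  proof (rule Bochner_Integration.integrable_bound)
    show "integrable lborel (\<lambda>x. s k x ^ 4 + s k (h + x) ^ 4)"
      using shift(1)[OF that, of 4] ispow[OF that, of 4] by auto
    have "(s k x)\<^sup>2 * (s k (h + x))\<^sup>2 \<le> s k x ^ 4 + s k (h + x) ^ 4" for x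
    proof -
      have "0 \<le> ((s k x)\<^sup>2 - (s k (h + x))\<^sup>2)\<^sup>2" "0 \<le> s k x ^ 4" "0 \<le> s k (h + x) ^ 4" by auto
      moreover have "((s k x)\<^sup>2 - (s k (h + x))\<^sup>2)\<^sup>2 = s k x ^ 4 + s k (h + x) ^ 4 - 2 * ((s k x)\<^sup>2 * (s k (h + x))\<^sup>2)"
        by (simp add: power2_diff power_mult[symmetric])
      ultimately show ?thesis by linarith
    qed
    then show "AE x in lborel. norm ((s k x)\<^sup>2 * (s k (h + x))\<^sup>2) \<le> norm (s k x ^ 4 + s k (h + x) ^ 4)"
      by (intro AE_I2) (auto intro: order_trans[OF _ abs_ge_self])
  qed measurable
  \<comment> \<open>The two fourth powers have equal integrals by translation invariance; the cross
    term is the overlap.\<close>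
  have expand: "(\<integral>x. ((s k (h + x))\<^sup>2 - (s k x)\<^sup>2)\<^sup>2 \<partial>lborel) = 2 * (\<integral>x. s k x ^ 4 \<partial>lborel) - 2 * (\<integral>x. (s k x)\<^sup>2 * (s k (h + x))\<^sup>2 \<partial>lborel)"
    if "k0 \<le> k" "k < m" for k h
  proof -
    have "(\<lambda>x. ((s k (h + x))\<^sup>2 - (s k x)\<^sup>2)\<^sup>2) = (\<lambda>x. s k (h + x) ^ 4 + s k x ^ 4 - 2 * ((s k x)\<^sup>2 * (s k (h + x))\<^sup>2))"
      by (auto simp: fun_eq_iff power2_diff power_mult[symmetric])
    then show ?thesis
      using shift[OF that, of 4 h] ispow[OF that, of 4] iprod[OF that, of h] by simp
  qed
  show False
  proof (cases "measure lborel P = 0")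
    case False
    define p where "p = measure lborel P"
    have p: "p > 0" using False by (simp add: p_def zero_less_measure_iff)
    \<comment> \<open>Up to null sets the truncation lives in the ball of radius \<open>R\<close>,
      and \<open>x\<close> and \<open>h + x\<close> cannot both lie there once |h| > 2 |R|. The
      overlap is then zero.\<close>
    define h where "h = (2 * \<bar>R\<bar> + 1) *\<^sub>R (SOME b. b \<in> (Basis :: 'a set))"
    have nh: "norm h = 2 * \<bar>R\<bar> + 1" using some_in_eq[of "Basis :: 'a set"] by (simp add: h_def norm_Basis)
    \<comment> \<open>With zero overlap, \<open>trans\<close> and \<open>energy\<close> combine to:
      the integral of s^4 is at most \<open>D\<close> times its integral over {G /= 0}. Dividing by
      D + 1 rather than D below covers D = 0.\<close>
    define D where "D = 2 * (norm h)\<^sup>2 * A"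
    have D: "D \<ge> 0" using A by (simp add: D_def)
    obtain k where k: "k0 \<le> k" "k < m" "measure lborel (N k) < p / (D + 1)"
      using small[of "p / (D + 1)"] p D by auto
    have "AE x in lborel. (s k x)\<^sup>2 * (s k (h + x))\<^sup>2 = 0"
      using supp AE_lborel_isometry[OF abs_one supp, of h]
    proof eventually_elim
      fix x assume x: "w x > k0 \<longrightarrow> norm x \<le> R" "w (h + 1 *\<^sub>R x) > k0 \<longrightarrow> norm (h + 1 *\<^sub>R x) \<le> R"
      have "\<not> (norm x \<le> R \<and> norm (h + x) \<le> R)"
        using norm_triangle_ineq4[of "h + x" x] nh by auto
      then show "(s k x)\<^sup>2 * (s k (h + x))\<^sup>2 = 0" using x k(1) by (auto simp: s_def)
    qed
    then have "(\<integral>x. (s k x)\<^sup>2 * (s k (h + x))\<^sup>2 \<partial>lborel) = 0" by (rule integral_eq_zero_AE)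
    then have "2 * (\<integral>x. s k x ^ 4 \<partial>lborel) \<le> 4 * (norm h)\<^sup>2 * (\<integral>x. (s k x)\<^sup>2 * (G x)\<^sup>2 \<partial>lborel)"
      using expand[OF k(1,2), of h] trans[OF k(1), of h] by simp
    also have "\<dots> \<le> 4 * (norm h)\<^sup>2 * (A * (\<integral>x. indicator {x. G x \<noteq> 0} x * s k x ^ 4 \<partial>lborel))"
      by (intro mult_left_mono energy k) auto
    finally have 0: "2 * (\<integral>x. s k x ^ 4 \<partial>lborel) \<le> 4 * (norm h)\<^sup>2 * (A * (\<integral>x. indicator {x. G x \<noteq> 0} x * s k x ^ 4 \<partial>lborel))" .
    \<comment> \<open>The vanishing of \<open>G\<close> on {w = m} enters here: the plateau drops
      out of the right-hand side and only \<open>N k\<close> remains, whereas the left-hand side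
      keeps (m - k)^4 p.\<close>
    have "(\<integral>x. indicator {x. G x \<noteq> 0} x * s k x ^ 4 \<partial>lborel) \<le> (\<integral>x. (m - k) ^ 4 * indicator (N k) x \<partial>lborel)"
    proof (rule integral_mono_AE)
      show "AE x in lborel. indicator {x. G x \<noteq> 0} x * s k x ^ 4 \<le> (m - k) ^ 4 * indicator (N k) x"
        using spow4[OF k(2)] G0 wle
        by eventually_elim (auto simp: indicator_def N_def split: if_splits)
    qed (use ispowG[OF k(1,2), of 4] iS[OF NS[OF k(1)]] in auto)
    also have "\<dots> = (m - k) ^ 4 * measure lborel (N k)" by simp
    finally have "4 * (norm h)\<^sup>2 * (A * (\<integral>x. indicator {x. G x \<noteq> 0} x * s k x ^ 4 \<partial>lborel))
        \<le> 4 * (norm h)\<^sup>2 * (A * ((m - k) ^ 4 * measure lborel (N k)))"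
      using A by (intro mult_left_mono) auto
    with 0 have 1: "(\<integral>x. s k x ^ 4 \<partial>lborel) \<le> (m - k) ^ 4 * (D * measure lborel (N k))"
      by (simp add: D_def algebra_simps)
    have "(m - k) ^ 4 * p = (\<integral>x. (m - k) ^ 4 * indicator P x \<partial>lborel)" by (simp add: p_def)
    also have "\<dots> \<le> (\<integral>x. s k x ^ 4 \<partial>lborel)"
    proof (rule integral_mono)
      show "integrable lborel (\<lambda>x. s k x ^ 4)" using ispow[OF k(1,2), of 4] by simp
      show "(m - k) ^ 4 * indicator P x \<le> s k x ^ 4" for x
        using k by (auto simp: indicator_def P_def s_def)
    qed (use iS[OF PS] in auto)
    finally have "(m - k) ^ 4 * p \<le> (m - k) ^ 4 * (D * measure lborel (N k))" using 1 by linarith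
    then have "p \<le> D * measure lborel (N k)" using k by (simp add: mult_le_cancel_left_pos)
    also have "\<dots> \<le> D * (p / (D + 1))" using k(3) D by (intro mult_left_mono) auto
    also have "\<dots> < p" using p D by (simp add: field_simps)
    finally show False by simp
  next
    case True
    have PN: "AE x in lborel. w x \<noteq> m"
    proof -
      have "emeasure lborel P = 0" using True Sfin(1)[OF PS] by (auto simp: measure_def enn2real_eq_0_iff)
      then have "P \<in> null_sets lborel" by (auto simp: null_sets_def)
      then show ?thesis using AE_not_in[of P lborel] by (auto simp: P_def)
    qed
    \<comment> \<open>Chosen so that 4 r^2 A = A / (A + 1) < 1, which makes the final absorption
      strict. It does not involve \<open>k\<close>, so the volume \<open>V\<close> is fixed before
      \<open>k\<close> is picked.\<close>
    define r where "r = 1 / (2 * sqrt (A + 1))"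
    have r: "r > 0" using A by (simp add: r_def)
    have r2: "4 * r\<^sup>2 * A < 1" using A by (simp add: r_def power_mult_distrib power_divide)
    define V where "V = measure lborel (ball (0::'a) r)"
    have V: "V > 0" using content_ball_pos[OF r, of "0::'a"] by (simp add: V_def)
    obtain k where k: "k0 \<le> k" "k < m" "measure lborel (N k) < V / 4" using small[of "V / 4"] V by auto
    define Q where "Q = (\<integral>x. s k x ^ 4 \<partial>lborel)"
    have Q0: "Q \<ge> 0" unfolding Q_def by (intro integral_nonneg_AE) auto
    \<comment> \<open>\<open>k\<close> lies below the essential supremum, so {w > k} is not a null
      set. Positivity is what makes the closing comparison strict.\<close>
    have Q: "Q > 0"
    proof (rule ccontr)
      assume "\<not> Q > 0"
      then have "Q = 0" using Q0 by simp
      then have "AE x in lborel. s k x ^ 4 = 0"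
        using integral_nonneg_eq_0_iff_AE[OF ispow[OF k(1,2), of 4]] by (auto simp: Q_def)
      then have "AE x in lborel. \<not> w x > k" by (rule eventually_mono) (auto simp: s_def)
      then have "emeasure lborel {x. w x > k} = 0"
        using AE_iff_measurable[of "{x. w x > k}" lborel "\<lambda>x. \<not> w x > k"] by auto
      then show False using nonnull[OF k(2)] by simp
    qed
    have "emeasure lborel {x. (s k x)\<^sup>2 \<noteq> 0} \<le> emeasure lborel (N k)"
    proof (rule emeasure_mono_AE)
      show "AE x in lborel. x \<in> {x. (s k x)\<^sup>2 \<noteq> 0} \<longrightarrow> x \<in> N k"
        using wle PN by eventually_elim (auto simp: s_def N_def)
    qed auto
    also have "\<dots> = ennreal (measure lborel (N k))"
      using Sfin(1)[OF NS[OF k(1)]] by (simp add: emeasure_eq_ennreal_measure)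
    also have "\<dots> \<le> ennreal (V / 4)" using k(3) by (intro ennreal_leI) auto
    finally have em: "emeasure lborel {x. (s k x)\<^sup>2 \<noteq> 0} \<le> ennreal (measure lborel (ball (0::'a) r) / 4)" by (simp add: V_def)
    have i4: "integrable lborel (\<lambda>x. ((s k x)\<^sup>2)\<^sup>2)" "(\<integral>x. ((s k x)\<^sup>2)\<^sup>2 \<partial>lborel) = Q"
      using ispow[OF k(1,2), of 4] by (simp_all add: power_mult[symmetric] Q_def)
    obtain h where h: "norm h < r" "(\<integral>x. (s k x)\<^sup>2 * (s k (h + x))\<^sup>2 \<partial>lborel) \<le> (\<integral>x. ((s k x)\<^sup>2)\<^sup>2 \<partial>lborel) / 2"
      using exists_small_overlap[of "\<lambda>x. (s k x)\<^sup>2" r, OF _ _ ispow[OF k(1,2)] i4(1) _ em r] i4(2) Q by auto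
    \<comment> \<open>An overlap of at most Q / 2 leaves at least the full Q on the left of the
      translation estimate.\<close>
    have "Q \<le> 2 * Q - 2 * (\<integral>x. (s k x)\<^sup>2 * (s k (h + x))\<^sup>2 \<partial>lborel)" using h(2) i4(2) by simp
    also have "\<dots> \<le> 4 * (norm h)\<^sup>2 * (\<integral>x. (s k x)\<^sup>2 * (G x)\<^sup>2 \<partial>lborel)"
      using expand[OF k(1,2), of h] trans[OF k(1), of h] by (simp add: Q_def)
    also have "\<dots> \<le> 4 * r\<^sup>2 * (A * Q)"
    proof (intro mult_mono)
      show "(norm h)\<^sup>2 \<le> r\<^sup>2" using h(1) by (intro power_mono) auto
      show "(\<integral>x. (s k x)\<^sup>2 * (G x)\<^sup>2 \<partial>lborel) \<le> A * Q"
        using energy[OF k(1)] mult_left_mono[OF en_le[OF k(1,2)] A] by (simp add: Q_def)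
      show "0 \<le> (\<integral>x. (s k x)\<^sup>2 * (G x)\<^sup>2 \<partial>lborel)" by (intro integral_nonneg_AE) auto
    qed auto
    also have "\<dots> < Q" using mult_strict_right_mono[OF r2 Q] by (simp add: mult.assoc)
    finally show False by simp
  qed
qed

section \<open>Passing to the limit in the smooth approximation\<close>

text \<open>The interface between mollification and the level argument. The bounds in
  \<open>low\<close> hold at every point, so truncations at levels k >= k0 vanish identically off
  the compact set \<open>L\<close>; \<open>bound\<close> supplies majorants for dominated
  convergence; \<open>w\<close> and \<open>g\<close> are Borel because their translates are
  integrated over \<open>lborel\<close>.\<close>

locale smooth_approximation =
  fixes L :: "'a::euclidean_space set" and W :: "nat \<Rightarrow> 'a \<Rightarrow> real" and DW :: "nat \<Rightarrow> 'a \<Rightarrow> 'a"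
    and w :: "'a \<Rightarrow> real" and g :: "'a \<Rightarrow> 'a" and B k0 :: real
  assumes L: "compact L"
    and deriv: "\<And>n x. (W n has_derivative (\<lambda>h. DW n x \<bullet> h)) (at x)"
    and cont: "\<And>n. continuous_on UNIV (DW n)"
    and low: "\<And>n x. x \<notin> L \<Longrightarrow> W n x \<le> k0" "\<And>x. x \<notin> L \<Longrightarrow> w x \<le> k0"
    and conv: "AE x in lborel. x \<in> L \<longrightarrow> (\<lambda>n. W n x) \<longlonglongrightarrow> w x"
    and conv': "AE x in lborel. x \<in> L \<longrightarrow> (\<lambda>n. DW n x) \<longlonglongrightarrow> g x"
    and bound: "\<And>n x. \<bar>W n x\<bar> \<le> B" "\<And>n x. x \<in> L \<Longrightarrow> norm (DW n x) \<le> B"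
    and w_meas [measurable]: "w \<in> borel_measurable borel" and g_meas [measurable]: "g \<in> borel_measurable borel"
begin

definition s :: "real \<Rightarrow> 'a \<Rightarrow> real" where "s k x = max 0 (w x - k)"
definition S :: "real \<Rightarrow> nat \<Rightarrow> 'a \<Rightarrow> real" where "S k n x = max 0 (W n x - k)"

section \<open>Truncations of the approximations and of their limit\<close>

lemma W_cont: "continuous_on UNIV (W n)"
  using deriv has_derivative_continuous continuous_at_imp_continuous_on by blast

lemma meas [measurable]: "W n \<in> borel_measurable borel" "DW n \<in> borel_measurable borel"
    "S k n \<in> borel_measurable borel" "s k \<in> borel_measurable borel" "L \<in> sets borel"
proof -
  show [measurable]: "W n \<in> borel_measurable borel" "DW n \<in> borel_measurable borel"
    using W_cont cont borel_measurable_continuous_onI by auto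
  show "S k n \<in> borel_measurable borel" "s k \<in> borel_measurable borel"
    unfolding S_def s_def by measurable
  show "L \<in> sets borel" using L by (simp add: borel_compact)
qed

lemma B_nonneg: "0 \<le> B" using bound(1)[of undefined undefined] by linarith

lemma S_nonneg: "0 \<le> S k n x" and s_nonneg: "0 \<le> s k x" by (auto simp: S_def s_def)

lemma S_le: "S k n x \<le> B + \<bar>k\<bar>"
  using bound(1)[of n x] B_nonneg by (auto simp: S_def)

lemma outside: assumes "k \<ge> k0" "x \<notin> L" shows "S k n x = 0" "s k x = 0"
  using low(1)[OF assms(2), of n] low(2)[OF assms(2)] assms(1) by (auto simp: S_def s_def)

lemma bounded_ind:
  obtains R where "R > 0" "\<And>x. x \<in> L \<Longrightarrow> norm x \<le> R"
  using compact_imp_bounded[OF L] bounded_pos by blast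

lemma S_tendsto: "k \<ge> k0 \<Longrightarrow> AE x in lborel. (\<lambda>n. S k n x) \<longlonglongrightarrow> s k x"
  using conv
proof (rule eventually_mono)
  fix x assume k: "k \<ge> k0" and x: "x \<in> L \<longrightarrow> (\<lambda>n. W n x) \<longlonglongrightarrow> w x"
  show "(\<lambda>n. S k n x) \<longlonglongrightarrow> s k x"
  proof (cases "x \<in> L")
    case True
    then show ?thesis using x unfolding S_def s_def by (intro tendsto_intros) auto
  next
    case False then show ?thesis using outside[OF k] by simp
  qed
qed

lemma limit_bounds: "AE x in lborel. x \<in> L \<longrightarrow> \<bar>w x\<bar> \<le> B \<and> norm (g x) \<le> B"
  using conv conv'
proof eventually_elim
  fix x assume x: "x \<in> L \<longrightarrow> (\<lambda>n. W n x) \<longlonglongrightarrow> w x" "x \<in> L \<longrightarrow> (\<lambda>n. DW n x) \<longlonglongrightarrow> g x"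
  show "x \<in> L \<longrightarrow> \<bar>w x\<bar> \<le> B \<and> norm (g x) \<le> B"
  proof (intro impI conjI)
    assume xL: "x \<in> L"
    have "(\<lambda>n. \<bar>W n x\<bar>) \<longlonglongrightarrow> \<bar>w x\<bar>" using x(1) xL by (intro tendsto_intros) auto
    then show "\<bar>w x\<bar> \<le> B" by (rule LIMSEQ_le_const2) (use bound(1) in auto)
    have "(\<lambda>n. norm (DW n x)) \<longlonglongrightarrow> norm (g x)" using x(2) xL by (intro tendsto_intros) auto
    then show "norm (g x) \<le> B" by (rule LIMSEQ_le_const2) (use bound(2)[OF xL] in auto)
  qed
qed

lemma s_le: "k \<ge> k0 \<Longrightarrow> AE x in lborel. s k x \<le> B + \<bar>k\<bar>"
  using limit_bounds
proof (rule eventually_mono)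
  fix x assume k: "k \<ge> k0" and x: "x \<in> L \<longrightarrow> \<bar>w x\<bar> \<le> B \<and> norm (g x) \<le> B"
  show "s k x \<le> B + \<bar>k\<bar>"
    using x outside(2)[OF k, of x] B_nonneg by (cases "x \<in> L") (auto simp: s_def)
qed

lemma integrable_L:
  fixes f :: "'a \<Rightarrow> real"
  assumes "f \<in> borel_measurable borel" "AE x in lborel. \<bar>f x\<bar> \<le> C * indicator L x"
  shows "integrable lborel f"
proof (rule Bochner_Integration.integrable_bound)
  show "integrable lborel (\<lambda>x. C * indicator L x)"
    using emeasure_compact_finite[OF L] by (intro integrable_mult_right integrable_real_indicator) auto
  show "AE x in lborel. norm (f x) \<le> norm (C * indicator L x)"
    using assms(2) by (rule eventually_mono) auto
qed (use assms in auto)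

text \<open>Used with p = 0 for the square, whose translates are estimated, and with p = 1 for the
  cube, which is the test function.\<close>

lemma has_derivative_S_power:
  "((\<lambda>x. S k n x ^ Suc (Suc p)) has_derivative
     (\<lambda>h. ((real (p + 2) * S k n x ^ Suc p) *\<^sub>R DW n x) \<bullet> h)) (at x)"
proof -
  have 1: "((\<lambda>x. W n x - k) has_derivative (\<lambda>h. DW n x \<bullet> h)) (at x)"
    using has_derivative_diff[OF deriv has_derivative_const[of k]] by simp
  have 2: "((\<lambda>s. max 0 s ^ Suc (Suc p)) has_derivative (\<lambda>h. real (p + 2) * max 0 s ^ Suc p * h)) (at s)" for s :: real
    using has_real_derivative_pos_part_power[of p s] by (simp only: has_field_derivative_def)
  show ?thesis unfolding S_def
    using has_derivative_compose[OF 1 2] by (rule has_derivative_eq_rhs) (auto simp: fun_eq_iff)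
qed

lemma continuous_S: "continuous_on UNIV (S k n)"
  unfolding S_def by (intro continuous_intros W_cont)

lemma S_pow_le: "S k n x ^ p \<le> (B + \<bar>k\<bar>) ^ p"
  by (intro power_mono S_le S_nonneg)

text \<open>The smooth translation estimate holds for \<open>(S k n x)\<^sup>2\<close>, and both
  sides pass to the limit by dominated convergence. The factor 4 is the square of the 2 in the
  gradient 2 S DW.\<close>

lemma translation:
  assumes k: "k \<ge> k0"
  shows "(\<integral>x. ((s k (h + x))\<^sup>2 - (s k x)\<^sup>2)\<^sup>2 \<partial>lborel) \<le> 4 * (norm h)\<^sup>2 * (\<integral>x. (s k x)\<^sup>2 * (norm (g x))\<^sup>2 \<partial>lborel)"
proof -
  obtain R where R: "R > 0" "\<And>x. x \<in> L \<Longrightarrow> norm x \<le> R" using bounded_ind by blast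
  define E where "E = B + \<bar>k\<bar>"
  have E: "E \<ge> 0" using B_nonneg by (simp add: E_def)
  have SE: "S k n x \<le> E" for n x using S_le by (simp add: E_def)
  have n_ineq: "(\<integral>x. ((S k n (h + x))\<^sup>2 - (S k n x)\<^sup>2)\<^sup>2 \<partial>lborel) \<le> (norm h)\<^sup>2 * (\<integral>x. (norm ((2 * S k n x) *\<^sub>R DW n x))\<^sup>2 \<partial>lborel)" for n
  proof (rule integral_translation_diff_le[where R=R])
    show "((\<lambda>x. (S k n x)\<^sup>2) has_derivative (\<lambda>h. ((2 * S k n x) *\<^sub>R DW n x) \<bullet> h)) (at x)" for x
      using has_derivative_S_power[of k n 0 x] by (simp add: numeral_2_eq_2)
    show "continuous_on UNIV (\<lambda>x. (2 * S k n x) *\<^sub>R DW n x)"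
      by (intro continuous_intros continuous_S cont)
    fix x :: 'a assume "norm x > R"
    then have "x \<notin> L" using R(2) by force
    then show "(S k n x)\<^sup>2 = 0" "(2 * S k n x) *\<^sub>R DW n x = 0" using outside(1)[OF k] by auto
  qed
  \<comment> \<open>The integrand is nonzero only if \<open>x\<close> or \<open>h + x\<close> meets
    \<open>L\<close>, hence the ball of radius R + |h|. The height \<open>E ^ 4\<close> suffices
    because two numbers in [0, E^2] differ by at most E^2.\<close>
  have lhs: "(\<lambda>n. \<integral>x. ((S k n (h + x))\<^sup>2 - (S k n x)\<^sup>2)\<^sup>2 \<partial>lborel) \<longlonglongrightarrow> (\<integral>x. ((s k (h + x))\<^sup>2 - (s k x)\<^sup>2)\<^sup>2 \<partial>lborel)"
  proof (rule integral_dominated_convergence[where w="\<lambda>x. E ^ 4 * indicator (cball 0 (R + norm h)) x"])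
    show "integrable lborel (\<lambda>x. E ^ 4 * indicator (cball (0::'a) (R + norm h)) x)"
      using emeasure_lborel_cball_finite[of "0::'a" "R + norm h"] by (intro integrable_mult_right integrable_real_indicator) auto
    show "AE x in lborel. (\<lambda>n. ((S k n (h + x))\<^sup>2 - (S k n x)\<^sup>2)\<^sup>2) \<longlonglongrightarrow> ((s k (h + x))\<^sup>2 - (s k x)\<^sup>2)\<^sup>2"
      using S_tendsto[OF k] AE_lborel_isometry[OF abs_one S_tendsto[OF k], of h]
      by eventually_elim (auto intro!: tendsto_intros)
    show "AE x in lborel. norm (((S k n (h + x))\<^sup>2 - (S k n x)\<^sup>2)\<^sup>2) \<le> E ^ 4 * indicator (cball 0 (R + norm h)) x" for n
    proof (rule AE_I2)
      fix x :: 'a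
      have b2: "0 \<le> (S k n y)\<^sup>2" "(S k n y)\<^sup>2 \<le> E\<^sup>2" for y using SE[of n y] S_nonneg[of k n y] by (auto intro: power_mono)
      show "norm (((S k n (h + x))\<^sup>2 - (S k n x)\<^sup>2)\<^sup>2) \<le> E ^ 4 * indicator (cball 0 (R + norm h)) x"
      proof (cases "x \<in> cball 0 (R + norm h)")
        case True
        have "\<bar>(S k n (h + x))\<^sup>2 - (S k n x)\<^sup>2\<bar> \<le> E\<^sup>2" using b2[of x] b2[of "h + x"] by linarith
        then have "\<bar>(S k n (h + x))\<^sup>2 - (S k n x)\<^sup>2\<bar>\<^sup>2 \<le> (E\<^sup>2)\<^sup>2" by (intro power_mono) auto
        then show ?thesis using True by (simp add: power_mult[symmetric])
      next
        case False
        have "norm x \<le> norm (h + x) + norm h" using norm_triangle_ineq4[of "h + x" h] by simp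
        moreover have "norm x > R + norm h" using False by simp
        ultimately have "norm (h + x) > R" "norm x > R" using norm_ge_zero[of h] by linarith+
        then have "x \<notin> L" "h + x \<notin> L" using R(2) by force+
        then show ?thesis using False outside(1)[OF k] by simp
      qed
    qed
  qed measurable
  have rhs: "(\<lambda>n. \<integral>x. (norm ((2 * S k n x) *\<^sub>R DW n x))\<^sup>2 \<partial>lborel) \<longlonglongrightarrow> (\<integral>x. (norm ((2 * s k x) *\<^sub>R g x))\<^sup>2 \<partial>lborel)"
  proof (rule integral_dominated_convergence[where w="\<lambda>x. (2 * E * B)\<^sup>2 * indicator L x"])
    show "integrable lborel (\<lambda>x. (2 * E * B)\<^sup>2 * indicator L x)"
      using emeasure_compact_finite[OF L] by (intro integrable_mult_right integrable_real_indicator) auto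
    show "AE x in lborel. (\<lambda>n. (norm ((2 * S k n x) *\<^sub>R DW n x))\<^sup>2) \<longlonglongrightarrow> (norm ((2 * s k x) *\<^sub>R g x))\<^sup>2"
      using S_tendsto[OF k] conv'
    proof eventually_elim
      fix x assume x: "(\<lambda>n. S k n x) \<longlonglongrightarrow> s k x" "x \<in> L \<longrightarrow> (\<lambda>n. DW n x) \<longlonglongrightarrow> g x"
      show "(\<lambda>n. (norm ((2 * S k n x) *\<^sub>R DW n x))\<^sup>2) \<longlonglongrightarrow> (norm ((2 * s k x) *\<^sub>R g x))\<^sup>2"
      proof (cases "x \<in> L")
        case True then show ?thesis using x by (intro tendsto_intros) auto
      next
        case False then show ?thesis using outside[OF k] by simp
      qed
    qed
    show "AE x in lborel. norm ((norm ((2 * S k n x) *\<^sub>R DW n x))\<^sup>2) \<le> (2 * E * B)\<^sup>2 * indicator L x" for n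
    proof (rule AE_I2)
      fix x
      show "norm ((norm ((2 * S k n x) *\<^sub>R DW n x))\<^sup>2) \<le> (2 * E * B)\<^sup>2 * indicator L x"
      proof (cases "x \<in> L")
        case True
        have "norm ((2 * S k n x) *\<^sub>R DW n x) \<le> 2 * E * B"
          using SE[of n x] S_nonneg[of k n x] bound(2)[OF True, of n] E by (auto simp: intro!: mult_mono)
        then show ?thesis using True power_mono[of "norm ((2 * S k n x) *\<^sub>R DW n x)" "2 * E * B" 2] by simp
      next
        case False then show ?thesis using outside[OF k] by simp
      qed
    qed
  qed measurable
  have "(\<integral>x. ((s k (h + x))\<^sup>2 - (s k x)\<^sup>2)\<^sup>2 \<partial>lborel) \<le> (norm h)\<^sup>2 * (\<integral>x. (norm ((2 * s k x) *\<^sub>R g x))\<^sup>2 \<partial>lborel)"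
    by (rule LIMSEQ_le[OF lhs tendsto_mult[OF tendsto_const rhs]]) (use n_ineq in auto)
  also have "(\<integral>x. (norm ((2 * s k x) *\<^sub>R g x))\<^sup>2 \<partial>lborel) = (\<integral>x. 4 * ((s k x)\<^sup>2 * (norm (g x))\<^sup>2) \<partial>lborel)"
    by (intro Bochner_Integration.integral_cong) (auto simp: power_mult_distrib)
  finally show ?thesis by simp
qed

lemma integrable_s_power:
  assumes k: "k \<ge> k0" and "p > 0"
  shows "integrable lborel (\<lambda>x. s k x ^ p * norm (g x) ^ q)" "integrable lborel (\<lambda>x. indicator {x. norm (g x) \<noteq> 0} x * s k x ^ p)"
proof -
  have *: "AE x in lborel. 0 \<le> s k x ^ p \<and> s k x ^ p \<le> (B + \<bar>k\<bar>) ^ p \<and> (x \<notin> L \<longrightarrow> s k x ^ p = 0) \<and> (x \<in> L \<longrightarrow> norm (g x) ^ q \<le> B ^ q)"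
    using s_le[OF k] limit_bounds
  proof eventually_elim
    fix x assume x: "s k x \<le> B + \<bar>k\<bar>" "x \<in> L \<longrightarrow> \<bar>w x\<bar> \<le> B \<and> norm (g x) \<le> B"
    show "0 \<le> s k x ^ p \<and> s k x ^ p \<le> (B + \<bar>k\<bar>) ^ p \<and> (x \<notin> L \<longrightarrow> s k x ^ p = 0) \<and> (x \<in> L \<longrightarrow> norm (g x) ^ q \<le> B ^ q)"
      using x s_nonneg[of k x] outside(2)[OF k, of x] \<open>p > 0\<close> by (auto intro: power_mono)
  qed
  show "integrable lborel (\<lambda>x. s k x ^ p * norm (g x) ^ q)"
  proof (rule integrable_L)
    show "AE x in lborel. \<bar>s k x ^ p * norm (g x) ^ q\<bar> \<le> ((B + \<bar>k\<bar>) ^ p * B ^ q) * indicator L x"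
      using *
    proof (rule eventually_mono)
      fix x assume x: "0 \<le> s k x ^ p \<and> s k x ^ p \<le> (B + \<bar>k\<bar>) ^ p \<and> (x \<notin> L \<longrightarrow> s k x ^ p = 0) \<and> (x \<in> L \<longrightarrow> norm (g x) ^ q \<le> B ^ q)"
      show "\<bar>s k x ^ p * norm (g x) ^ q\<bar> \<le> ((B + \<bar>k\<bar>) ^ p * B ^ q) * indicator L x"
      proof (cases "x \<in> L")
        case True
        have "s k x ^ p * norm (g x) ^ q \<le> (B + \<bar>k\<bar>) ^ p * B ^ q"
          using x True B_nonneg by (intro mult_mono) auto
        then show ?thesis using x True by (simp add: abs_mult)
      next
        case False then have "s k x ^ p = 0" using x by blast
        then show ?thesis using False by (simp only: mult_zero_left) simp
      qed
    qed
  qed measurable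
  show "integrable lborel (\<lambda>x. indicator {x. norm (g x) \<noteq> 0} x * s k x ^ p)"
  proof (rule integrable_L)
    show "AE x in lborel. \<bar>indicator {x. norm (g x) \<noteq> 0} x * s k x ^ p\<bar> \<le> (B + \<bar>k\<bar>) ^ p * indicator L x"
      using * by (rule eventually_mono) (use B_nonneg \<open>p > 0\<close> in \<open>auto simp: indicator_def zero_power\<close>)
  qed measurable
qed

text \<open>\<open>S\<close> and \<open>DW\<close> are uniformly bounded on \<open>L\<close>, so
  integrability of \<open>b\<close> and \<open>q\<close> there is enough to pass to the limit in
  \<open>test\<close>. Coercivity yields 3 c times the left side, the lower-order term uses up 2 c
  of it, and dividing C^2 / (8 c) by the remaining c gives the constant.\<close>

lemma energy:
  fixes b :: "'a \<Rightarrow> 'a" and q :: "'a \<Rightarrow> real"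
  assumes b: "set_integrable lebesgue L b" and q: "set_integrable lebesgue L q"
    and test: "\<And>k n. k \<ge> k0 \<Longrightarrow>
       (LINT x:L|lebesgue. b x \<bullet> ((3 * (S k n x)\<^sup>2) *\<^sub>R DW n x)) \<le> (LINT x:L|lebesgue. q x * S k n x ^ 3)"
    and mono: "AE x in lebesgue. x \<in> L \<longrightarrow> w x > k0 \<longrightarrow> c * (norm (g x))\<^sup>2 \<le> b x \<bullet> g x"
    and low_order: "AE x in lebesgue. x \<in> L \<longrightarrow> w x > k0 \<longrightarrow> q x \<le> C * norm (g x)"
    and c: "c > 0" and k: "k \<ge> k0"
  shows "(\<integral>x. (s k x)\<^sup>2 * (norm (g x))\<^sup>2 \<partial>lborel) \<le> (C\<^sup>2 / (8 * c\<^sup>2)) * (\<integral>x. indicator {x. norm (g x) \<noteq> 0} x * s k x ^ 4 \<partial>lborel)"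
proof -
  define E where "E = B + \<bar>k\<bar>"
  have E: "E \<ge> 0" using B_nonneg by (simp add: E_def)
  have SE: "S k n x ^ p \<le> E ^ p" for n x p using S_pow_le by (simp add: E_def)
  have bm[measurable]: "(\<lambda>x. indicator L x *\<^sub>R b x) \<in> borel_measurable lebesgue"
    using b borel_measurable_integrable unfolding set_integrable_def by blast
  have qm[measurable]: "(\<lambda>x. indicator L x *\<^sub>R q x) \<in> borel_measurable lebesgue"
    using q borel_measurable_integrable unfolding set_integrable_def by blast
  have lm[measurable]: "w \<in> borel_measurable lebesgue" "g \<in> borel_measurable lebesgue" "S k n \<in> borel_measurable lebesgue"
     "s k \<in> borel_measurable lebesgue" "DW n \<in> borel_measurable lebesgue" for n
    by (auto intro!: measurable_completion)
  have cs: "AE x in lebesgue. (\<lambda>n. S k n x) \<longlonglongrightarrow> s k x" by (rule AE_completion[OF S_tendsto[OF k]])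
  have cd: "AE x in lebesgue. x \<in> L \<longrightarrow> (\<lambda>n. DW n x) \<longlonglongrightarrow> g x" by (rule AE_completion[OF conv'])
  let ?bn = "\<lambda>n x. (indicator L x *\<^sub>R b x) \<bullet> ((3 * (S k n x)\<^sup>2) *\<^sub>R DW n x)"
  let ?b = "\<lambda>x. (indicator L x *\<^sub>R b x) \<bullet> ((3 * (s k x)\<^sup>2) *\<^sub>R g x)"
  let ?qn = "\<lambda>n x. (indicator L x *\<^sub>R q x) * S k n x ^ 3"
  let ?q = "\<lambda>x. (indicator L x *\<^sub>R q x) * s k x ^ 3"
  have c1: "AE x in lebesgue. (\<lambda>n. ?bn n x) \<longlonglongrightarrow> ?b x"
    using cs cd
  proof eventually_elim
    fix x assume x: "(\<lambda>n. S k n x) \<longlonglongrightarrow> s k x" "x \<in> L \<longrightarrow> (\<lambda>n. DW n x) \<longlonglongrightarrow> g x"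
    show "(\<lambda>n. ?bn n x) \<longlonglongrightarrow> ?b x"
    proof (cases "x \<in> L")
      case True then show ?thesis using x by (intro tendsto_intros) auto
    qed simp
  qed
  have d1: "AE x in lebesgue. norm (?bn n x) \<le> (3 * E\<^sup>2 * B) * norm (indicator L x *\<^sub>R b x)" for n
  proof (rule AE_I2)
    fix x
    show "norm (?bn n x) \<le> (3 * E\<^sup>2 * B) * norm (indicator L x *\<^sub>R b x)"
    proof (cases "x \<in> L")
      case True
      define z where "z = (3 * (S k n x)\<^sup>2) *\<^sub>R DW n x"
      have "norm z \<le> 3 * E\<^sup>2 * B"
        using SE[of n x 2] bound(2)[OF True, of n] E unfolding z_def by (auto intro!: mult_mono)
      then have "norm z * norm (b x) \<le> (3 * E\<^sup>2 * B) * norm (b x)"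
        by (intro mult_right_mono) auto
      moreover have "\<bar>b x \<bullet> z\<bar> \<le> norm z * norm (b x)"
        using Cauchy_Schwarz_ineq2[of "b x" z] by (simp only: mult.commute)
      ultimately show ?thesis using True unfolding z_def[symmetric] by simp
    qed simp
  qed
  have i1: "integrable lebesgue (\<lambda>x. (3 * E\<^sup>2 * B) * norm (indicator L x *\<^sub>R b x))"
    using b unfolding set_integrable_def by (intro integrable_mult_right integrable_norm)
  have ib: "integrable lebesgue ?b"
    by (rule integrable_dominated_convergence[OF _ _ i1 c1 d1]) measurable
  have l1: "(\<lambda>n. \<integral>x. ?bn n x \<partial>lebesgue) \<longlonglongrightarrow> (\<integral>x. ?b x \<partial>lebesgue)"
    by (rule integral_dominated_convergence[OF _ _ i1 c1 d1]) measurable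
  have c2: "AE x in lebesgue. (\<lambda>n. ?qn n x) \<longlonglongrightarrow> ?q x"
    using cs by (rule eventually_mono) (auto intro!: tendsto_intros)
  have d2: "AE x in lebesgue. norm (?qn n x) \<le> E ^ 3 * norm (indicator L x *\<^sub>R q x)" for n
    by (rule AE_I2) (use SE S_nonneg in \<open>auto simp: abs_mult indicator_def mult.commute intro!: mult_left_mono\<close>)
  have i2: "integrable lebesgue (\<lambda>x. E ^ 3 * norm (indicator L x *\<^sub>R q x))"
    using q unfolding set_integrable_def by (intro integrable_mult_right integrable_norm)
  have iq: "integrable lebesgue ?q"
    by (rule integrable_dominated_convergence[OF _ _ i2 c2 d2]) measurable
  have l2: "(\<lambda>n. \<integral>x. ?qn n x \<partial>lebesgue) \<longlonglongrightarrow> (\<integral>x. ?q x \<partial>lebesgue)"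
    by (rule integral_dominated_convergence[OF _ _ i2 c2 d2]) measurable
  have bq: "(\<integral>x. ?b x \<partial>lebesgue) \<le> (\<integral>x. ?q x \<partial>lebesgue)"
  proof (rule LIMSEQ_le[OF l1 l2], intro exI[of _ 0] allI impI)
    fix n
    show "(\<integral>x. ?bn n x \<partial>lebesgue) \<le> (\<integral>x. ?qn n x \<partial>lebesgue)"
      using test[OF k, of n] unfolding set_lebesgue_integral_def inner_scaleR_left real_scaleR_def mult.assoc[symmetric]
      by (simp only: mult.assoc)
  qed
  define J where "J = (\<integral>x. (s k x)\<^sup>2 * (norm (g x))\<^sup>2 \<partial>lborel)"
  define T where "T = (\<integral>x. indicator {x. norm (g x) \<noteq> 0} x * s k x ^ 4 \<partial>lborel)"
  have iJ: "integrable lborel (\<lambda>x. (s k x)\<^sup>2 * (norm (g x))\<^sup>2)" using integrable_s_power(1)[OF k, of 2 2] by simp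
  have iT: "integrable lborel (\<lambda>x. indicator {x. norm (g x) \<noteq> 0} x * s k x ^ 4)" using integrable_s_power(2)[OF k, of 4] by simp
  have mJ: "(\<lambda>x. (s k x)\<^sup>2 * (norm (g x))\<^sup>2) \<in> borel_measurable lborel"
    and mT: "(\<lambda>x. indicator {x. norm (g x) \<noteq> 0} x * s k x ^ 4) \<in> borel_measurable lborel" by measurable
  have iJ': "integrable lebesgue (\<lambda>x. (s k x)\<^sup>2 * (norm (g x))\<^sup>2)" and J': "J = (\<integral>x. (s k x)\<^sup>2 * (norm (g x))\<^sup>2 \<partial>lebesgue)"
    using iJ integrable_completion[OF mJ] integral_completion[OF mJ] by (simp_all add: J_def)
  have iT': "integrable lebesgue (\<lambda>x. indicator {x. norm (g x) \<noteq> 0} x * s k x ^ 4)"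
    and T': "T = (\<integral>x. indicator {x. norm (g x) \<noteq> 0} x * s k x ^ 4 \<partial>lebesgue)"
    using iT integrable_completion[OF mT] integral_completion[OF mT] by (simp_all add: T_def)
  have "3 * c * J = (\<integral>x. 3 * c * ((s k x)\<^sup>2 * (norm (g x))\<^sup>2) \<partial>lebesgue)" by (simp add: J')
  also have "\<dots> \<le> (\<integral>x. ?b x \<partial>lebesgue)"
  proof (rule integral_mono_AE)
    show "AE x in lebesgue. 3 * c * ((s k x)\<^sup>2 * (norm (g x))\<^sup>2) \<le> ?b x"
      using mono
    proof (rule eventually_mono)
      fix x assume x: "x \<in> L \<longrightarrow> w x > k0 \<longrightarrow> c * (norm (g x))\<^sup>2 \<le> b x \<bullet> g x"
      show "3 * c * ((s k x)\<^sup>2 * (norm (g x))\<^sup>2) \<le> ?b x"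
      proof (cases "x \<in> L \<and> w x > k0")
        case True
        then have "3 * (s k x)\<^sup>2 * (c * (norm (g x))\<^sup>2) \<le> 3 * (s k x)\<^sup>2 * (b x \<bullet> g x)" using x by (intro mult_left_mono) auto
        then show ?thesis using True by (simp add: mult_ac)
      next
        case False
        then have "s k x = 0" using outside(2)[OF k, of x] k by (auto simp: s_def)
        then show ?thesis by simp
      qed
    qed
  qed (use ib iJ' in auto)
  also have "\<dots> \<le> (\<integral>x. ?q x \<partial>lebesgue)" by (rule bq)
  also have "\<dots> \<le> (\<integral>x. 2 * c * ((s k x)\<^sup>2 * (norm (g x))\<^sup>2) + C\<^sup>2 / (8 * c) * (indicator {x. norm (g x) \<noteq> 0} x * s k x ^ 4) \<partial>lebesgue)"
  proof (rule integral_mono_AE)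
    show "AE x in lebesgue. ?q x \<le> 2 * c * ((s k x)\<^sup>2 * (norm (g x))\<^sup>2) + C\<^sup>2 / (8 * c) * (indicator {x. norm (g x) \<noteq> 0} x * s k x ^ 4)"
      using low_order
    proof (rule eventually_mono)
      fix x assume x: "x \<in> L \<longrightarrow> w x > k0 \<longrightarrow> q x \<le> C * norm (g x)"
      show "?q x \<le> 2 * c * ((s k x)\<^sup>2 * (norm (g x))\<^sup>2) + C\<^sup>2 / (8 * c) * (indicator {x. norm (g x) \<noteq> 0} x * s k x ^ 4)"
      proof (cases "x \<in> L \<and> w x > k0")
        case True
        then have *: "q x * s k x ^ 3 \<le> C * norm (g x) * s k x ^ 3"
          using x s_nonneg[of k x] by (intro mult_right_mono) auto
        show ?thesis
        \<comment> \<open>Where the gradient vanishes, \<open>low_order\<close> gives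
          \<open>q x \<le> 0\<close>, so no s^4 has to be paid. This is the origin of the indicator
          in the conclusion.\<close>
        proof (cases "norm (g x) = 0")
          case True
          then show ?thesis using * \<open>x \<in> L \<and> w x > k0\<close> by simp
        next
          case False
          \<comment> \<open>Young's inequality as a completed square; C / (4 c) is the coefficient
            for which the cross term becomes C |g| s^3.\<close>
          have "0 \<le> 2 * c * (s k x * norm (g x) - C / (4 * c) * (s k x)\<^sup>2)\<^sup>2" using c by simp
          also have "\<dots> = 2 * c * ((s k x)\<^sup>2 * (norm (g x))\<^sup>2) - C * norm (g x) * s k x ^ 3 + C\<^sup>2 / (8 * c) * s k x ^ 4"
            using c by (simp add: power2_eq_square power3_eq_cube power4_eq_xxxx field_simps)
          finally show ?thesis using * False \<open>x \<in> L \<and> w x > k0\<close> by simp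
        qed
      next
        case False
        then have "s k x = 0" using outside(2)[OF k, of x] k by (auto simp: s_def)
        then show ?thesis by simp
      qed
    qed
  qed (use iq iJ' iT' in auto)
  also have "\<dots> = 2 * c * J + C\<^sup>2 / (8 * c) * T"
    using iJ' iT' by (simp add: J' T')
  finally have "J * c \<le> C\<^sup>2 / (8 * c) * T" by (simp add: mult.commute)
  then have "J \<le> (C\<^sup>2 / (8 * c) * T) / c" using c by (simp only: pos_le_divide_eq)
  also have "\<dots> = (C\<^sup>2 / (8 * c\<^sup>2)) * T" by (simp add: power2_eq_square)
  finally show ?thesis by (simp add: J_def T_def)
qed

lemma essentially_le:
  fixes b :: "'a \<Rightarrow> 'a" and q :: "'a \<Rightarrow> real"
  assumes b: "set_integrable lebesgue L b" and q: "set_integrable lebesgue L q"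
    and test: "\<And>k n. k \<ge> k0 \<Longrightarrow>
       (LINT x:L|lebesgue. b x \<bullet> ((3 * (S k n x)\<^sup>2) *\<^sub>R DW n x)) \<le> (LINT x:L|lebesgue. q x * S k n x ^ 3)"
    and mono: "AE x in lebesgue. x \<in> L \<longrightarrow> w x > k0 \<longrightarrow> c * (norm (g x))\<^sup>2 \<le> b x \<bullet> g x"
    and low_order: "AE x in lebesgue. x \<in> L \<longrightarrow> w x > k0 \<longrightarrow> q x \<le> C * norm (g x)"
    and c: "c > 0"
  shows "AE x in lborel. w x \<le> k0"
proof -
  obtain R where R: "R > 0" "\<And>x. x \<in> L \<Longrightarrow> norm x \<le> R" using bounded_ind by blast
  have "emeasure lborel {x. w x > k0} = 0"
  \<comment> \<open>Off \<open>L\<close> only \<open>w x \<le> k0\<close> is known, hence the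
    essential upper bound \<open>max k0 B\<close>.\<close>
  proof (rule no_positive_superlevel[where G="\<lambda>x. norm (g x)" and B="max k0 B" and R=R and A="C\<^sup>2 / (8 * c\<^sup>2)"])
    show "AE x in lborel. w x \<le> max k0 B"
      using limit_bounds
    proof (rule eventually_mono)
      fix x assume "x \<in> L \<longrightarrow> \<bar>w x\<bar> \<le> B \<and> norm (g x) \<le> B"
      then show "w x \<le> max k0 B" using low(2)[of x] by (cases "x \<in> L") auto
    qed
    show "AE x in lborel. k0 < w x \<longrightarrow> norm x \<le> R"
      by (rule AE_I2) (use low(2) R(2) in force)
    show "integrable lborel (\<lambda>x. (max 0 (w x - k))\<^sup>2 * (norm (g x))\<^sup>2)" if "k \<ge> k0" for k
      using integrable_s_power(1)[OF that, of 2 2] by (simp add: s_def)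
    show "(\<integral>x. (max 0 (w x - k))\<^sup>2 * (norm (g x))\<^sup>2 \<partial>lborel)
        \<le> C\<^sup>2 / (8 * c\<^sup>2) * (\<integral>x. indicator {x. norm (g x) \<noteq> 0} x * (max 0 (w x - k)) ^ 4 \<partial>lborel)" if "k \<ge> k0" for k
      using energy[OF b q test mono low_order c that] by (simp only: s_def)
    show "(\<integral>x. ((max 0 (w (h + x) - k))\<^sup>2 - (max 0 (w x - k))\<^sup>2)\<^sup>2 \<partial>lborel)
        \<le> 4 * (norm h)\<^sup>2 * (\<integral>x. (max 0 (w x - k))\<^sup>2 * (norm (g x))\<^sup>2 \<partial>lborel)" if "k \<ge> k0" for k h
      using translation[OF that, of h] by (simp only: s_def)
  qed auto
  then show ?thesis
    using AE_iff_measurable[of "{x. w x > k0}" lborel "\<lambda>x. w x \<le> k0"] by (auto simp: not_le)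
qed

end

section \<open>Structure conditions and weak gradients\<close>

text \<open>For a simple function in place of \<open>g\<close> the composition is a finite sum of
  measurable pieces, one for each value; continuity in the second argument carries measurability to
  the pointwise limit.\<close>

lemma caratheodory_measurable:
  fixes a :: "'a::euclidean_space \<Rightarrow> 'a \<Rightarrow> 'a"
  assumes a: "caratheodory \<Omega> a" and g: "g \<in> borel_measurable (lebesgue_on \<Omega>)"
  shows "(\<lambda>x. a x (g x)) \<in> borel_measurable (lebesgue_on \<Omega>)"
proof -
  obtain F where F: "\<And>i. simple_function (lebesgue_on \<Omega>) (F i)"
    "\<And>x. x \<in> space (lebesgue_on \<Omega>) \<Longrightarrow> (\<lambda>i. F i x) \<longlonglongrightarrow> g x"
    using borel_measurable_implies_sequence_metric[OF g] by blast
  show ?thesis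
  proof (rule borel_measurable_LIMSEQ_metric)
    fix x assume x: "x \<in> space (lebesgue_on \<Omega>)"
    then have "continuous_on UNIV (a x)" using a by (simp add: caratheodory_def)
    then show "(\<lambda>i. a x (F i x)) \<longlonglongrightarrow> a x (g x)"
      using F(2)[OF x] continuous_on_tendsto_compose[of UNIV "a x" "\<lambda>i. F i x" "g x" sequentially] by auto
  next
    fix i
    let ?M = "lebesgue_on \<Omega>"
    have fin: "finite (F i ` space ?M)" using F(1)[of i] by (rule simple_functionD)
    have "(\<lambda>x. \<Sum>y\<in>F i ` space ?M. indicator (F i -` {y} \<inter> space ?M) x *\<^sub>R a x y) \<in> borel_measurable ?M"
      using a simple_functionD(2)[OF F(1)] unfolding caratheodory_def
      by (intro borel_measurable_sum borel_measurable_scaleR borel_measurable_indicator) auto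
    also have "(\<lambda>x. \<Sum>y\<in>F i ` space ?M. indicator (F i -` {y} \<inter> space ?M) x *\<^sub>R a x y) \<in> borel_measurable ?M
      \<longleftrightarrow> (\<lambda>x. a x (F i x)) \<in> borel_measurable ?M"
    proof (rule measurable_cong)
      fix x assume x: "x \<in> space ?M"
      have "(\<Sum>y\<in>F i ` space ?M. indicator (F i -` {y} \<inter> space ?M) x *\<^sub>R a x y)
          = (\<Sum>y\<in>F i ` space ?M. if y = F i x then a x y else 0)"
        using x by (intro sum.cong) (auto simp: indicator_def)
      also have "\<dots> = a x (F i x)" using fin x by simp
      finally show "(\<Sum>y\<in>F i ` space ?M. indicator (F i -` {y} \<inter> space ?M) x *\<^sub>R a x y) = a x (F i x)" .
    qed
    finally show "(\<lambda>x. a x (F i x)) \<in> borel_measurable ?M" .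
  qed
qed

lemma continuous_compose_measurable:
  fixes H :: "'a::euclidean_space \<Rightarrow> real \<Rightarrow> 'a \<Rightarrow> real"
  assumes H: "continuous_on (\<Omega> \<times> UNIV \<times> UNIV) (\<lambda>(x, t, \<xi>). H x t \<xi>)"
    and u: "u \<in> borel_measurable (lebesgue_on \<Omega>)" and g: "g \<in> borel_measurable (lebesgue_on \<Omega>)"
  shows "(\<lambda>x. H x (u x) (g x)) \<in> borel_measurable (lebesgue_on \<Omega>)"
proof -
  have id: "(\<lambda>x. x) \<in> borel_measurable (lebesgue_on \<Omega>)"
    by (intro measurable_restrict_space1 measurable_completion) simp
  have "(\<lambda>x. (x, u x, g x)) \<in> borel_measurable (lebesgue_on \<Omega>)"
    by (intro borel_measurable_Pair id u g)
  \<comment> \<open>Continuity of \<open>H\<close> is known only over \<open>\<Omega>\<close>, so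
    the triple must be seen as a map into the Borel space restricted to that product.\<close>
  then have "(\<lambda>x. (x, u x, g x)) \<in> measurable (lebesgue_on \<Omega>) (restrict_space borel (\<Omega> \<times> UNIV \<times> UNIV))"
    by (intro measurable_restrict_space2) auto
  from measurable_compose[OF this borel_measurable_continuous_on_restrict[OF H]]
  show ?thesis by simp
qed

text \<open>Values tending to 0 along a sequence in \<open>L\<close> would accumulate at a point
  near which lower semicontinuity keeps \<open>f\<close> above half its positive value
  there.\<close>

lemma lsc_on_compact_pos:
  fixes f :: "'a::metric_space \<Rightarrow> real"
  assumes lsc: "lsc_on \<Omega> f" and L: "compact L" "L \<subseteq> \<Omega>" and pos: "\<And>x. x \<in> \<Omega> \<Longrightarrow> f x > 0"
  obtains c where "c > 0" "\<And>x. x \<in> L \<Longrightarrow> c \<le> f x"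
proof (rule ccontr)
  assume no: "\<not> thesis"
  have "\<exists>x\<in>L. f x < 1 / real (Suc n)" for n
    using that[of "1 / real (Suc n)"] no by (force simp: not_le)
  then obtain X where X: "\<And>n. X n \<in> L" "\<And>n. f (X n) < 1 / real (Suc n)" by metis
  obtain l r where l: "l \<in> L" "strict_mono (r :: nat \<Rightarrow> nat)" "(X \<circ> r) \<longlonglongrightarrow> l"
    using L(1) X(1) unfolding compact_def by metis
  have l\<Omega>: "l \<in> \<Omega>" using l L by auto
  have fl: "f l > 0" using pos l\<Omega> by auto
  then have "eventually (\<lambda>y. f l / 2 < f y) (at l within \<Omega>)"
    using lsc[unfolded lsc_on_def, rule_format, OF l\<Omega>, of "f l / 2"] by simp
  then obtain d where d: "d > 0" "\<And>y. y \<in> \<Omega> \<Longrightarrow> y \<noteq> l \<Longrightarrow> dist y l < d \<Longrightarrow> f l / 2 < f y"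
    unfolding eventually_at by blast
  \<comment> \<open>The filter \<open>at l within \<Omega>\<close> omits \<open>l\<close>, yet the
    sequence may hit it; there f l / 2 < f l by positivity.\<close>
  have d': "f l / 2 < f y" if "y \<in> \<Omega>" "dist y l < d" for y
    using d(2)[of y] that fl by (cases "y = l") auto
  have e1: "\<forall>\<^sub>F n in sequentially. dist ((X \<circ> r) n) l < d" using l(3) d(1) tendstoD by blast
  have "(\<lambda>n. 1 / real (Suc n)) \<longlonglongrightarrow> 0" using LIMSEQ_inverse_real_of_nat by (simp add: inverse_eq_divide)
  then have "((\<lambda>n. 1 / real (Suc n)) \<circ> r) \<longlonglongrightarrow> 0" using l(2) LIMSEQ_subseq_LIMSEQ by blast
  then have e2: "\<forall>\<^sub>F n in sequentially. ((\<lambda>n. 1 / real (Suc n)) \<circ> r) n < f l / 2"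
    by (rule order_tendstoD(2)) (use fl in simp)
  obtain n where "dist ((X \<circ> r) n) l < d" "((\<lambda>n. 1 / real (Suc n)) \<circ> r) n < f l / 2"
    using eventually_happens[OF eventually_conj[OF e1 e2]] by auto
  then show False using d'[of "X (r n)"] X[of "r n"] L(2) by force
qed

text \<open>Mean value theorem, with the slope \<open>\<sigma> * z powr (\<sigma> - 1)\<close>
  bounded on [0, M] because the exponent is nonnegative. The endpoint s = 0 is separate since the
  derivative rule asks for a positive argument.\<close>

lemma powr_diff_le_of_ge_1:
  fixes s t M \<sigma> :: real
  assumes "1 \<le> \<sigma>" "0 \<le> s" "s \<le> t" "t \<le> M"
  shows "t powr \<sigma> - s powr \<sigma> \<le> \<sigma> * M powr (\<sigma> - 1) * (t - s)"
proof (cases "s = t")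
  case False
  then have st: "s < t" using assms by simp
  then have t: "t > 0" using assms by simp
  have tM: "x powr (\<sigma> - 1) \<le> M powr (\<sigma> - 1)" if "0 \<le> x" "x \<le> t" for x
    using that assms by (intro powr_mono2) auto
  show ?thesis
  proof (cases "s = 0")
    case True
    have "t powr \<sigma> = t powr (\<sigma> - 1) * t" using t powr_mult_base[of t "\<sigma> - 1"] by (simp add: mult.commute)
    also have "\<dots> \<le> M powr (\<sigma> - 1) * t" using tM[of t] t by (intro mult_right_mono) auto
    also have "\<dots> \<le> (\<sigma> * M powr (\<sigma> - 1)) * t"
      using assms(1) t mult_right_mono[of 1 \<sigma> "M powr (\<sigma> - 1)"] by (intro mult_right_mono) auto
    finally show ?thesis using True assms by simp
  next
    case False
    then have s: "s > 0" using assms by simp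
    have "\<exists>z. z > s \<and> z < t \<and> t powr \<sigma> - s powr \<sigma> = (t - s) * (\<sigma> * z powr (\<sigma> - 1))"
    proof (rule MVT2[OF st])
      fix x assume "s \<le> x" "x \<le> t"
      then show "((\<lambda>x. x powr \<sigma>) has_real_derivative \<sigma> * x powr (\<sigma> - 1)) (at x)"
        using s by (intro has_real_derivative_powr) auto
    qed
    then obtain z where z: "z > s" "z < t" "t powr \<sigma> - s powr \<sigma> = (t - s) * (\<sigma> * z powr (\<sigma> - 1))" by blast
    have "\<sigma> * z powr (\<sigma> - 1) \<le> \<sigma> * M powr (\<sigma> - 1)"
      using tM[of z] z s assms by (intro mult_left_mono) auto
    then show ?thesis using z(3) st mult_left_mono[of "\<sigma> * z powr (\<sigma> - 1)" "\<sigma> * M powr (\<sigma> - 1)" "t - s"]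
      by (simp add: mult.commute)
  qed
qed simp

text \<open>The power has infinite slope at 0, so a Lipschitz bound needs the deficit
  \<open>e\<close>. The threshold \<open>(e / M) powr (1 / \<sigma>)\<close> is where M t^\<sigma>
  equals e: up to it the left side is not positive, beyond it increments are controlled by the slope
  at the threshold.\<close>

lemma powr_diff_le_of_less_1:
  fixes s t \<sigma> :: real
  assumes "0 < \<sigma>" "\<sigma> < 1" "0 \<le> s" "s \<le> t" and M: "M > 0" and e: "e > 0"
  shows "M * (t powr \<sigma> - s powr \<sigma>) - e \<le> M * ((e / M) powr (1 / \<sigma>)) powr (\<sigma> - 1) * (t - s)"
proof -
  define t0 where "t0 = (e / M) powr (1 / \<sigma>)"
  have t0: "t0 > 0" using M e by (simp add: t0_def)
  have t0s: "t0 powr \<sigma> = e / M" using M e assms(1) by (simp add: t0_def powr_powr)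
  show ?thesis
  proof (cases "t \<le> t0")
    case True
    then have "t powr \<sigma> \<le> e / M" using powr_mono2[of \<sigma> t t0] assms t0s by simp
    then have "M * t powr \<sigma> \<le> e" using M by (simp add: field_simps)
    then have "M * (t powr \<sigma> - s powr \<sigma>) - e \<le> 0" using mult_nonneg_nonneg[of M "s powr \<sigma>"] M powr_ge_zero[of s \<sigma>] unfolding right_diff_distrib by linarith
    also have "0 \<le> M * t0 powr (\<sigma> - 1) * (t - s)" using M assms by simp
    finally show ?thesis by (simp add: t0_def)
  next
    case False
    then have t: "t > 0" using t0 by simp
    \<comment> \<open>A number in [0, 1] does not decrease when raised to a power below 1.
      Multiplied by t^\<sigma> this bounds the increment by t^(\<sigma> - 1) (t - s), also for s =
      0.\<close>
    have "(s / t) powr 1 \<le> (s / t) powr \<sigma>"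
      using assms t by (intro powr_mono') auto
    then have "s / t \<le> s powr \<sigma> / t powr \<sigma>" using assms t by (simp add: powr_divide powr_one)
    then have "t powr \<sigma> * (s / t) \<le> s powr \<sigma>" using t by (simp add: field_simps)
    moreover have "t powr \<sigma> = t powr (\<sigma> - 1) * t" using t powr_mult_base[of t "\<sigma> - 1"] by (simp add: mult.commute)
    ultimately have "t powr \<sigma> - s powr \<sigma> \<le> t powr (\<sigma> - 1) * (t - s)" using t by (simp add: right_diff_distrib)
    also have "\<dots> \<le> t0 powr (\<sigma> - 1) * (t - s)"
      using False t0 assms by (intro mult_right_mono powr_mono2') auto
    finally have "M * (t powr \<sigma> - s powr \<sigma>) \<le> M * (t0 powr (\<sigma> - 1) * (t - s))" using M by (intro mult_left_mono) auto
    then show ?thesis using e by (simp add: t0_def mult.assoc)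
  qed
qed

text \<open>A closure point outside the open set \<open>\<Omega>\<close> lies on its frontier, where
  the limsup is at most 0 < k; hence u - v < k in \<open>\<Omega>\<close> near that point, which
  excludes it from the closure.\<close>

lemma superlevel_compact:
  assumes dom: "bounded_domain \<Omega>" and bdry: "le_on_boundary \<Omega> u v" and k: "k > 0"
  shows "compact (closure {x\<in>\<Omega>. u x - v x \<ge> k})" "closure {x\<in>\<Omega>. u x - v x \<ge> k} \<subseteq> \<Omega>"
proof -
  have o: "open \<Omega>" and b: "bounded \<Omega>" using dom by (auto simp: bounded_domain_def)
  let ?S = "{x\<in>\<Omega>. u x - v x \<ge> k}"
  have "bounded ?S" using b by (rule bounded_subset) auto
  then show "compact (closure ?S)" by (simp add: compact_closure)
  show "closure ?S \<subseteq> \<Omega>"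
  proof (rule ccontr)
    assume "\<not> ?thesis"
    then obtain \<xi> where \<xi>: "\<xi> \<in> closure ?S" "\<xi> \<notin> \<Omega>" by auto
    have "\<xi> \<in> closure \<Omega>" using \<xi>(1) closure_mono[of ?S \<Omega>] by auto
    then have "\<xi> \<in> frontier \<Omega>" using \<xi>(2) o by (simp add: frontier_def interior_open)
    then have "Limsup (at \<xi> within \<Omega>) (\<lambda>x. ereal (u x - v x)) < ereal k"
      using bdry k unfolding le_on_boundary_def by (meson ereal_less(2) le_less_trans)
    then have "\<forall>\<^sub>F x in at \<xi> within \<Omega>. ereal (u x - v x) < ereal k" by (rule Limsup_lessD)
    then obtain d where d: "d > 0" "\<And>x. x \<in> \<Omega> \<Longrightarrow> x \<noteq> \<xi> \<Longrightarrow> dist x \<xi> < d \<Longrightarrow> u x - v x < k"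
      unfolding eventually_at by auto
    obtain y where "y \<in> ?S" "dist y \<xi> < d" using \<xi>(1) d(1) closure_approachable by blast
    then show False using d(2)[of y] \<xi>(2) by auto
  qed
qed

text \<open>Bochner integrals split over a difference only when both terms are integrable, and the
  functions here are just locally integrable while the integrals run over \<open>\<Omega>\<close>.
  The work lies in \<open>fact\<close>: a test function and its gradient are bounded and vanish off
  a compact set, so the products are integrable.\<close>

lemma weak_grad_diff:
  fixes u v :: "'a::euclidean_space \<Rightarrow> real"
  assumes u: "weak_grad \<Omega> u gu" and v: "weak_grad \<Omega> v gv"
  shows "weak_grad \<Omega> (\<lambda>x. u x - v x) (\<lambda>x. gu x - gv x)"
proof -
  have fact: "set_integrable lebesgue \<Omega> (\<lambda>x. f x *\<^sub>R D\<phi> x)" "set_integrable lebesgue \<Omega> (\<lambda>x. \<phi> x *\<^sub>R h x)"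
    if f: "L1_loc \<Omega> f" and h: "L1_loc_vec \<Omega> h" and \<phi>: "C1c_grad \<Omega> \<phi> D\<phi>" for f and h \<phi> D\<phi>
  proof -
    define K where "K = closure {x. \<phi> x \<noteq> 0}"
    have K: "compact K" "K \<subseteq> \<Omega>" using \<phi> by (auto simp: C1c_grad_def K_def)
    have z: "\<phi> x = 0" if "x \<notin> K" for x using that closure_subset[of "{x. \<phi> x \<noteq> 0}"] by (auto simp: K_def)
    have cD: "continuous_on UNIV D\<phi>" and d: "(\<phi> has_derivative (\<lambda>h. D\<phi> x \<bullet> h)) (at x)" for x
      using \<phi> by (auto simp: C1c_grad_def)
    have c\<phi>: "continuous_on UNIV \<phi>"
      using d has_derivative_continuous continuous_at_imp_continuous_on by blast
    \<comment> \<open>The support is defined through \<open>\<phi>\<close> alone; uniqueness of the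
      derivative on the open complement of \<open>K\<close> transfers the vanishing to
      \<open>D\<phi>\<close>.\<close>
    have zD: "D\<phi> x = 0" if x: "x \<notin> K" for x
    proof -
      have "open (- K)" using K by (simp add: compact_imp_closed open_Compl)
      then have "((\<lambda>_. 0) has_derivative (\<lambda>h. D\<phi> x \<bullet> h)) (at x)"
        using has_derivative_transform_within_open[OF d[of x], of "- K" "\<lambda>_. 0"] x z by auto
      then have "(\<lambda>h. D\<phi> x \<bullet> h) = (\<lambda>h. 0)"
        using has_derivative_unique has_derivative_const by blast
      then have "D\<phi> x \<bullet> D\<phi> x = 0" by meson
      then show ?thesis by simp
    qed
    obtain B1 where B1: "\<And>x. x \<in> K \<Longrightarrow> norm (D\<phi> x) \<le> B1"
      using compact_imp_bounded[OF compact_continuous_image[OF continuous_on_subset[OF cD] K(1)]] unfolding bounded_iff by auto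
    obtain B2 where B2: "\<And>x. x \<in> K \<Longrightarrow> \<bar>\<phi> x\<bar> \<le> B2"
      using compact_imp_bounded[OF compact_continuous_image[OF continuous_on_subset[OF c\<phi>] K(1)]] unfolding bounded_iff by auto
    have fi: "integrable lebesgue (\<lambda>x. indicator K x *\<^sub>R f x)" and hi: "integrable lebesgue (\<lambda>x. indicator K x *\<^sub>R h x)"
      using f h K unfolding L1_loc_def L1_loc_vec_def set_integrable_def by blast+
    note m = measurable_lebesgue_continuous[OF cD] measurable_lebesgue_continuous[OF c\<phi>]
    have "integrable lebesgue (\<lambda>x. (indicator K x *\<^sub>R f x) *\<^sub>R D\<phi> x)"
    proof (rule Bochner_Integration.integrable_bound[where f="\<lambda>x. B1 * norm (indicator K x *\<^sub>R f x)"])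
      show "AE x in lebesgue. norm ((indicator K x *\<^sub>R f x) *\<^sub>R D\<phi> x) \<le> norm (B1 * norm (indicator K x *\<^sub>R f x))"
      proof (rule AE_I2)
        fix x
        have "\<bar>f x\<bar> * norm (D\<phi> x) \<le> \<bar>f x\<bar> * \<bar>B1\<bar>" if "x \<in> K"
          using B1[OF that] by (intro mult_left_mono) auto
        then show "norm ((indicator K x *\<^sub>R f x) *\<^sub>R D\<phi> x) \<le> norm (B1 * norm (indicator K x *\<^sub>R f x))"
          by (simp add: indicator_def abs_mult mult.commute[of "\<bar>B1\<bar>"])
      qed
    qed (use fi m borel_measurable_integrable[OF fi] in auto)
    also have "(\<lambda>x. (indicator K x *\<^sub>R f x) *\<^sub>R D\<phi> x) = (\<lambda>x. indicator \<Omega> x *\<^sub>R f x *\<^sub>R D\<phi> x)"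
      using zD K(2) by (auto simp: fun_eq_iff indicator_def)
    finally show "set_integrable lebesgue \<Omega> (\<lambda>x. f x *\<^sub>R D\<phi> x)" by (simp add: set_integrable_def)
    have "integrable lebesgue (\<lambda>x. \<phi> x *\<^sub>R (indicator K x *\<^sub>R h x))"
    proof (rule Bochner_Integration.integrable_bound[where f="\<lambda>x. B2 * norm (indicator K x *\<^sub>R h x)"])
      show "AE x in lebesgue. norm (\<phi> x *\<^sub>R (indicator K x *\<^sub>R h x)) \<le> norm (B2 * norm (indicator K x *\<^sub>R h x))"
      proof (rule AE_I2)
        fix x
        have "\<bar>\<phi> x\<bar> * norm (h x) \<le> \<bar>B2\<bar> * norm (h x)" if "x \<in> K"
          using B2[OF that] by (intro mult_right_mono) auto
        then show "norm (\<phi> x *\<^sub>R (indicator K x *\<^sub>R h x)) \<le> norm (B2 * norm (indicator K x *\<^sub>R h x))"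
          by (simp add: indicator_def abs_mult)
      qed
    next
      show "integrable lebesgue (\<lambda>x. B2 * norm (indicator K x *\<^sub>R h x))"
        by (intro integrable_mult_right integrable_norm hi)
      show "(\<lambda>x. \<phi> x *\<^sub>R (indicator K x *\<^sub>R h x)) \<in> borel_measurable lebesgue"
        by (intro borel_measurable_scaleR[OF m(2) borel_measurable_integrable[OF hi]])
    qed
    also have "(\<lambda>x. \<phi> x *\<^sub>R (indicator K x *\<^sub>R h x)) = (\<lambda>x. indicator \<Omega> x *\<^sub>R \<phi> x *\<^sub>R h x)"
      using z K(2) by (auto simp: fun_eq_iff indicator_def)
    finally show "set_integrable lebesgue \<Omega> (\<lambda>x. \<phi> x *\<^sub>R h x)" by (simp add: set_integrable_def)
  qed
  have L: "L1_loc \<Omega> u" "L1_loc_vec \<Omega> gu" "L1_loc \<Omega> v" "L1_loc_vec \<Omega> gv"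
    using u v by (auto simp: weak_grad_def)
  show ?thesis unfolding weak_grad_def
  proof (intro conjI allI impI)
    show "L1_loc \<Omega> (\<lambda>x. u x - v x)" "L1_loc_vec \<Omega> (\<lambda>x. gu x - gv x)"
      using L by (auto simp: L1_loc_def L1_loc_vec_def)
    fix \<phi> D\<phi> assume \<phi>: "C1c_grad \<Omega> \<phi> D\<phi>"
    have "(LINT x:\<Omega>|lebesgue. (u x - v x) *\<^sub>R D\<phi> x) = (LINT x:\<Omega>|lebesgue. u x *\<^sub>R D\<phi> x) - (LINT x:\<Omega>|lebesgue. v x *\<^sub>R D\<phi> x)"
      unfolding scaleR_diff_left by (rule set_integral_diff(2)) (rule fact(1)[OF L(1,2) \<phi>] fact(1)[OF L(3,4) \<phi>])+
    also have "\<dots> = - (LINT x:\<Omega>|lebesgue. \<phi> x *\<^sub>R gu x) + (LINT x:\<Omega>|lebesgue. \<phi> x *\<^sub>R gv x)"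
      using u v \<phi> by (simp add: weak_grad_def)
    also have "\<dots> = - (LINT x:\<Omega>|lebesgue. \<phi> x *\<^sub>R (gu x - gv x))"
      unfolding scaleR_diff_right by (subst set_integral_diff(2)[OF fact(2)[OF L(1,2) \<phi>] fact(2)[OF L(3,4) \<phi>]]) simp
    finally show "(LINT x:\<Omega>|lebesgue. (u x - v x) *\<^sub>R D\<phi> x) = - (LINT x:\<Omega>|lebesgue. \<phi> x *\<^sub>R (gu x - gv x))" .
  qed
qed

text \<open>Two layers around \<open>K\<close>, of widths d and 2d, lie inside
  \<open>\<Omega>\<close>. The cut-off of \<open>w\<close> to the outer one is mollified with range
  below d: on \<open>L\<close> the kernel stays within \<open>L'\<close>, so gradients are mollified
  weak gradients; off \<open>L\<close> it does not reach \<open>K\<close>, so values stay at most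
  \<open>k0\<close>.\<close>

lemma smooth_approximation_exists:
  fixes w :: "'a::euclidean_space \<Rightarrow> real"
  assumes o: "open \<Omega>" and wg: "weak_grad \<Omega> w g" and lw: "Linf_loc \<Omega> w" and lg: "Linf_loc \<Omega> g"
    and K: "compact K" "K \<noteq> {}" "K \<subseteq> \<Omega>" and k0: "k0 \<ge> 0"
    and sup: "\<And>x. x \<in> \<Omega> \<Longrightarrow> x \<notin> K \<Longrightarrow> w x \<le> k0"
  obtains L W DW w' g' B where "smooth_approximation L W DW w' g' B k0" "K \<subseteq> L" "L \<subseteq> \<Omega>"
    "AE x in lebesgue. x \<in> L \<longrightarrow> w' x = w x \<and> g' x = g x"
proof -
  obtain e where e: "e > 0" "(\<Union>x\<in>K. ball x e) \<subseteq> \<Omega>"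
    using compact_subset_open_imp_ball_epsilon_subset[OF K(1) o K(3)] by blast
  define d where "d = e / 4"
  have d: "d > 0" using e by (simp add: d_def)
  define L where "L = {x. infdist x K \<le> d}"
  define L' where "L' = {x. infdist x K \<le> 2 * d}"
  have cL: "compact L" "compact L'" unfolding L_def L'_def using d by (intro compact_infdist_le K; simp)+
  have LL: "L \<subseteq> L'" using d by (auto simp: L_def L'_def)
  have L\<Omega>: "L' \<subseteq> \<Omega>"
  proof
    fix x assume x: "x \<in> L'"
    obtain y where y: "y \<in> K" "infdist x K = dist x y"
      using infdist_attains_inf[OF compact_imp_closed[OF K(1)] K(2), of x] by metis
    then have "x \<in> ball y e" using e(1) x by (simp add: L'_def d_def dist_commute)
    then show "x \<in> \<Omega>" using e(2) y(1) by blast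
  qed
  have KL: "K \<subseteq> L" using d by (auto simp: L_def)
  define f where "f x = indicator L' x * w x" for x
  define fg where "fg x = indicator L' x *\<^sub>R g x" for x
  have fi: "integrable lebesgue f" and fgi: "integrable lebesgue fg"
    using wg cL(2) L\<Omega> unfolding weak_grad_def L1_loc_def L1_loc_vec_def set_integrable_def f_def[abs_def] fg_def[abs_def]
    by auto
  obtain B1 where B1: "AE x in lebesgue. x \<in> L' \<longrightarrow> norm (w x) \<le> B1" using lw cL(2) L\<Omega> unfolding Linf_loc_def by blast
  obtain B2 where B2: "AE x in lebesgue. x \<in> L' \<longrightarrow> norm (g x) \<le> B2" using lg cL(2) L\<Omega> unfolding Linf_loc_def by blast
  define B where "B = max 0 (max B1 B2)"
  have fB: "AE x in lebesgue. norm (f x) \<le> B"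
    using B1 by (rule eventually_mono) (auto simp: f_def B_def indicator_def)
  have fgB: "AE x in lebesgue. norm (fg x) \<le> B"
    using B2 by (rule eventually_mono) (auto simp: fg_def B_def indicator_def)
  \<comment> \<open>The range \<open>2 * real DIM('a) * r n\<close> equals d / (n + 2), strictly
    below d already at n = 0.\<close>
  define r where "r n = d / (2 * real DIM('a)) * inverse (real (Suc (Suc n)))" for n
  have r: "r n > 0" for n using d by (simp add: r_def)
  have rd: "2 * real DIM('a) * r n < d" for n
    using d by (simp add: r_def divide_simps)
  have r0: "r \<longlonglongrightarrow> 0"
  proof -
    have "(\<lambda>n. d / (2 * real DIM('a)) * inverse (real (Suc (Suc n)))) \<longlonglongrightarrow> d / (2 * real DIM('a)) * 0"
      by (intro tendsto_mult tendsto_const LIMSEQ_Suc[OF LIMSEQ_inverse_real_of_nat])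
    then show ?thesis by (simp add: r_def[abs_def])
  qed
  define W where "W n = mollify (r n) f" for n
  define DW where "DW n x = (\<integral>y. f y *\<^sub>R mollifier_grad (r n) (x - y) \<partial>lebesgue)" for n x
  have tri: "infdist y K \<le> infdist x K + dist x y" for x y :: 'a
    using infdist_triangle[of y K x] by (simp add: dist_commute)
  have DWL: "DW n x = mollify (r n) fg x" if x: "x \<in> L" for n x
  proof -
    have "cball x (2 * real DIM('a) * r n) \<subseteq> L'"
    proof
      fix y assume "y \<in> cball x (2 * real DIM('a) * r n)"
      then show "y \<in> L'" using tri[of y x] x rd[of n] by (auto simp: L_def L'_def)
    qed
    from mollify_weak_grad[OF wg r this L\<Omega>] show ?thesis
      by (simp add: DW_def f_def fg_def[abs_def])
  qed
  \<comment> \<open>Limits of Borel functions, hence Borel, unlike \<open>w\<close> and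
    \<open>g\<close> themselves. The indicator makes them 0 off \<open>L\<close>, and 0 is at most
    \<open>k0\<close>.\<close>
  define w' where "w' x = lim (\<lambda>n. indicator L x * W n x)" for x
  define g' where "g' x = lim (\<lambda>n. indicator L x *\<^sub>R DW n x)" for x
  have dW: "(W n has_derivative (\<lambda>h. DW n x \<bullet> h)) (at x)" for n x
    using has_derivative_mollify(1)[OF r fi] by (simp add: W_def DW_def)
  have cDW: "continuous_on UNIV (DW n)" for n
    using has_derivative_mollify(2)[OF r fi] by (simp add: DW_def[abs_def])
  have cW: "continuous_on UNIV (W n)" for n
    using dW has_derivative_continuous continuous_at_imp_continuous_on by blast
  have [measurable]: "W n \<in> borel_measurable borel" "DW n \<in> borel_measurable borel" "L \<in> sets borel" for n
    using cW cDW borel_measurable_continuous_onI cL(1) borel_compact by auto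
  have c1: "AE x in lebesgue. (\<lambda>n. W n x) \<longlonglongrightarrow> f x"
    using mollify_tendsto[OF fi r r0] by (simp add: W_def)
  have c2: "AE x in lebesgue. x \<in> L \<longrightarrow> (\<lambda>n. DW n x) \<longlonglongrightarrow> fg x"
    using mollify_tendsto[OF fgi r r0] by (rule eventually_mono) (auto simp: DWL)
  have eq: "AE x in lebesgue. x \<in> L \<longrightarrow> (w' x = w x \<and> g' x = g x) \<and> (\<lambda>n. W n x) \<longlonglongrightarrow> w' x \<and> (\<lambda>n. DW n x) \<longlonglongrightarrow> g' x"
    using c1 c2
  proof eventually_elim
    fix x assume x: "(\<lambda>n. W n x) \<longlonglongrightarrow> f x" "x \<in> L \<longrightarrow> (\<lambda>n. DW n x) \<longlonglongrightarrow> fg x"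
    show "x \<in> L \<longrightarrow> (w' x = w x \<and> g' x = g x) \<and> (\<lambda>n. W n x) \<longlonglongrightarrow> w' x \<and> (\<lambda>n. DW n x) \<longlonglongrightarrow> g' x"
    proof
      assume xL: "x \<in> L"
      have "w' x = f x" "g' x = fg x" using x xL by (auto simp: w'_def g'_def intro!: limI)
      then show "(w' x = w x \<and> g' x = g x) \<and> (\<lambda>n. W n x) \<longlonglongrightarrow> w' x \<and> (\<lambda>n. DW n x) \<longlonglongrightarrow> g' x"
        using x xL LL by (auto simp: f_def fg_def)
    qed
  qed
  have AE_lb: "AE x in lborel. P x" if "AE x in lebesgue. P x" for P :: "'a \<Rightarrow> bool"
    using that by (simp add: AE_completion_iff)
  have "smooth_approximation L W DW w' g' B k0"
  proof
    show "compact L" by (rule cL)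
    show "(W n has_derivative (\<lambda>h. DW n x \<bullet> h)) (at x)" for n x by (rule dW)
    show "continuous_on UNIV (DW n)" for n by (rule cDW)
    show "W n x \<le> k0" if x: "x \<notin> L" for n x
    proof -
      \<comment> \<open>Within range of \<open>x\<close> no point of \<open>K\<close> occurs: in
        \<open>L'\<close> the hypothesis \<open>sup\<close> applies, and outside \<open>L'\<close>
        the cut-off is 0.\<close>
      have "f y \<le> k0" if "dist x y \<le> 2 * real DIM('a) * r n" for y
      proof -
        have "y \<notin> K"
        proof
          assume "y \<in> K"
          then have "infdist x K \<le> dist x y" by (rule infdist_le)
          then show False using that rd[of n] x by (simp add: L_def)
        qed
        then show ?thesis using sup[of y] L\<Omega> k0 by (auto simp: f_def indicator_def)
      qed
      then show ?thesis unfolding W_def by (intro mollify_le[OF r fi] AE_I2) auto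
    qed
    show "w' x \<le> k0" if "x \<notin> L" for x using that k0 by (simp add: w'_def limI)
    show "AE x in lborel. x \<in> L \<longrightarrow> (\<lambda>n. W n x) \<longlonglongrightarrow> w' x"
      by (rule AE_lb) (use eq in \<open>auto elim: eventually_mono\<close>)
    show "AE x in lborel. x \<in> L \<longrightarrow> (\<lambda>n. DW n x) \<longlonglongrightarrow> g' x"
      by (rule AE_lb) (use eq in \<open>auto elim: eventually_mono\<close>)
    show "\<bar>W n x\<bar> \<le> B" for n x using norm_mollify_le[OF r fi fB] by (simp add: W_def)
    show "norm (DW n x) \<le> B" if "x \<in> L" for n x using norm_mollify_le[OF r fgi fgB] by (simp add: DWL[OF that])
    show "w' \<in> borel_measurable borel" unfolding w'_def[abs_def] by (rule borel_measurable_lim_metric) measurable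
    show "g' \<in> borel_measurable borel" unfolding g'_def[abs_def] by (rule borel_measurable_lim_metric) measurable
  qed
  moreover have "AE x in lebesgue. x \<in> L \<longrightarrow> w' x = w x \<and> g' x = g x"
    using eq by (rule eventually_mono) auto
  ultimately show ?thesis using that KL LL L\<Omega> by blast
qed

section \<open>Comparison near a fixed superlevel set of u - v\<close>

lemma AE_le_0_if_le_all_pos:
  assumes "\<And>k::real. k > 0 \<Longrightarrow> AE x in M. x \<in> \<Omega> \<longrightarrow> f x \<le> k"
  shows "AE x in M. x \<in> \<Omega> \<longrightarrow> f x \<le> (0::real)"
proof -
  have "AE x in M. \<forall>n. x \<in> \<Omega> \<longrightarrow> f x \<le> inverse (real (Suc n))"
    unfolding AE_all_countable by (intro allI assms) simp
  then show ?thesis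
  proof (rule eventually_mono, intro impI)
    fix x assume "\<forall>n. x \<in> \<Omega> \<longrightarrow> f x \<le> inverse (real (Suc n))" "x \<in> \<Omega>"
    then show "f x \<le> 0" by (intro LIMSEQ_le_const[OF LIMSEQ_inverse_real_of_nat]) auto
  qed
qed

lemma Linf_loc_diff:
  assumes f: "Linf_loc \<Omega> f" and h: "Linf_loc \<Omega> h"
  shows "Linf_loc \<Omega> (\<lambda>x. f x - h x)"
  unfolding Linf_loc_def
proof (intro allI impI)
  fix K assume K: "compact K \<and> K \<subseteq> \<Omega>"
  obtain C1 where C1: "AE x in lebesgue. x \<in> K \<longrightarrow> norm (f x) \<le> C1"
    using f K unfolding Linf_loc_def by meson
  obtain C2 where C2: "AE x in lebesgue. x \<in> K \<longrightarrow> norm (h x) \<le> C2"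
    using h K unfolding Linf_loc_def by meson
  have "AE x in lebesgue. x \<in> K \<longrightarrow> norm (f x - h x) \<le> C1 + C2"
    using C1 C2
  proof eventually_elim
    fix x assume "x \<in> K \<longrightarrow> norm (f x) \<le> C1" "x \<in> K \<longrightarrow> norm (h x) \<le> C2"
    then show "x \<in> K \<longrightarrow> norm (f x - h x) \<le> C1 + C2" using norm_triangle_ineq4[of "f x" "h x"] by auto
  qed
  then show "\<exists>C. AE x in lebesgue. x \<in> K \<longrightarrow> norm (f x - h x) \<le> C" by blast
qed

lemma borel_measurable_indicator_compact:
  fixes f :: "'a::euclidean_space \<Rightarrow> 'b::euclidean_space"
  assumes f: "f \<in> borel_measurable (lebesgue_on \<Omega>)" and o: "open \<Omega>" and L: "compact L" "L \<subseteq> \<Omega>"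
  shows "(\<lambda>x. indicator L x *\<^sub>R f x) \<in> borel_measurable lebesgue"
proof -
  have "\<Omega> \<in> sets lebesgue" "L \<in> sets lebesgue"
    using o L(1) by (auto simp: borel_compact)
  then have "(\<lambda>x. indicator \<Omega> x *\<^sub>R f x) \<in> borel_measurable lebesgue"
    using f by (subst (asm) borel_measurable_restrict_space_iff) auto
  from borel_measurable_scaleR[OF borel_measurable_indicator[OF \<open>L \<in> sets lebesgue\<close>] this]
  have "(\<lambda>x. indicator L x *\<^sub>R (indicator \<Omega> x *\<^sub>R f x)) \<in> borel_measurable lebesgue" .
  also have "(\<lambda>x. indicator L x *\<^sub>R (indicator \<Omega> x *\<^sub>R f x)) = (\<lambda>x. indicator L x *\<^sub>R f x)"
    using L(2) by (auto simp: fun_eq_iff indicator_def)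
  finally show ?thesis .
qed

theorem theorem1p2:
  fixes \<Omega> :: "'a::euclidean_space set"
    and a :: "'a \<Rightarrow> 'a \<Rightarrow> 'a"
    and H :: "'a \<Rightarrow> real \<Rightarrow> 'a \<Rightarrow> real"
    and \<omega> \<tau> :: "'a \<Rightarrow> real \<Rightarrow> real"
    and u v :: "'a \<Rightarrow> real" and gu gv :: "'a \<Rightarrow> 'a"
    and p \<sigma> \<gamma> :: real
  assumes dom: "bounded_domain \<Omega>"
    and p: "1 < p" "p < 2"
    and sigma: "\<sigma> > 0"
    and a_car: "caratheodory \<Omega> a"
    and gamma: "\<gamma> > 0"
    and a_mono: "\<forall>x\<in>\<Omega>. \<forall>\<xi> \<eta>. (a x \<xi> - a x \<eta>) \<bullet> (\<xi> - \<eta>)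
                    \<ge> \<gamma> * (1 + norm \<xi> + norm \<eta>) powr (p - 2) * (norm (\<xi> - \<eta>))\<^sup>2"
    and H_cont: "continuous_on (\<Omega> \<times> UNIV \<times> UNIV) (\<lambda>(x, t, \<xi>). H x t \<xi>)"
    and omega_nonneg: "\<forall>x\<in>\<Omega>. \<forall>r>0. \<omega> x r \<ge> 0"
    and tau_nonneg: "\<forall>x\<in>\<Omega>. \<forall>r>0. \<tau> x r \<ge> 0"
    and omega_lsc: "\<forall>r>0. lsc_on \<Omega> (\<lambda>x. \<omega> x r)"
    and tau_lsc: "\<forall>r>0. lsc_on \<Omega> (\<lambda>x. \<tau> x r)"
    and omega_mono: "\<forall>x\<in>\<Omega>. mono_on {0<..} (\<omega> x)"
    and tau_mono: "\<forall>x\<in>\<Omega>. mono_on {0<..} (\<tau> x)"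
    and H1: "\<forall>x\<in>\<Omega>. \<forall>\<xi> s t. s < t \<longrightarrow>
               H x t \<xi> - H x s \<xi> \<ge> \<omega> x (t - s) + \<tau> x (t - s) * norm \<xi> powr \<sigma>"
    and H2: "\<forall>K. compact K \<and> K \<subseteq> \<Omega> \<longrightarrow> (\<exists>M>0. \<forall>x\<in>K. \<forall>t \<xi> \<eta>.
               \<bar>H x t \<eta> - H x t \<xi>\<bar> \<le> M * \<bar>norm \<eta> powr \<sigma> - norm \<xi> powr \<sigma>\<bar>)"
    and u_W: "W1inf_loc_grad \<Omega> u gu"
    and v_W: "W1inf_loc_grad \<Omega> v gv"
    and cases: "(\<sigma> < 1 \<and> (\<forall>x\<in>\<Omega>. \<forall>r>0. \<omega> x r > 0)) \<or> 1 \<le> \<sigma>"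
    and Q: "Q_le \<Omega> a H u gu v gv"
    and bdry: "le_on_boundary \<Omega> u v"
  shows "AE x in lebesgue. x \<in> \<Omega> \<longrightarrow> u x \<le> v x"
proof -
  have o: "open \<Omega>" using dom by (simp add: bounded_domain_def)
  note uW = u_W[unfolded W1inf_loc_grad_def] and vW = v_W[unfolded W1inf_loc_grad_def]
  let ?w = "\<lambda>x. u x - v x" and ?g = "\<lambda>x. gu x - gv x"
  have wg: "weak_grad \<Omega> ?w ?g" using uW vW by (intro weak_grad_diff) auto
  have lw: "Linf_loc \<Omega> ?w" and lg: "Linf_loc \<Omega> ?g" using uW vW by (auto intro!: Linf_loc_diff)
  have level: "AE x in lebesgue. x \<in> \<Omega> \<longrightarrow> ?w x \<le> k0" if k0: "k0 > 0" for k0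
  \<comment> \<open>The neighbourhoods are built from distances to \<open>K\<close>, so an empty
    superlevel set is dealt with apart.\<close>
  proof (cases "{x\<in>\<Omega>. ?w x \<ge> k0} = {}")
    case True
    then show ?thesis by (intro AE_I2) (auto simp: not_le)
  next
    case False
    define K where "K = closure {x\<in>\<Omega>. ?w x \<ge> k0}"
    have K: "compact K" "K \<subseteq> \<Omega>" unfolding K_def by (rule superlevel_compact[OF dom bdry k0])+
    have K0: "K \<noteq> {}" using False closure_subset[of "{x\<in>\<Omega>. ?w x \<ge> k0}"] unfolding K_def by blast
    have sup: "?w x \<le> k0" if "x \<in> \<Omega>" "x \<notin> K" for x
      using that closure_subset[of "{x\<in>\<Omega>. ?w x \<ge> k0}"] by (force simp: K_def)
    \<comment> \<open>From here on \<open>w\<close> and \<open>g\<close> are Borel representatives,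
      tied to \<open>?w\<close> and \<open>?g\<close> almost everywhere on \<open>L\<close>
      only.\<close>
    obtain L W DW w g B where sa: "smooth_approximation L W DW w g B k0" and KL: "K \<subseteq> L" and L\<Omega>: "L \<subseteq> \<Omega>"
      and eq: "AE x in lebesgue. x \<in> L \<longrightarrow> w x = ?w x \<and> g x = ?g x"
      by (rule smooth_approximation_exists[OF o wg lw lg K(1) K0 K(2) less_imp_le[OF k0] sup])
    interpret smooth_approximation L W DW w g B k0 by (rule sa)
    obtain M1 where M1: "AE x in lebesgue. x \<in> L \<longrightarrow> norm (gu x) \<le> M1"
      using uW L L\<Omega> unfolding Linf_loc_def by blast
    obtain M2 where M2: "AE x in lebesgue. x \<in> L \<longrightarrow> norm (gv x) \<le> M2"
      using vW L L\<Omega> unfolding Linf_loc_def by blast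
    obtain N1 where N1: "AE x in lebesgue. x \<in> L \<longrightarrow> norm (u x) \<le> N1"
      using uW L L\<Omega> unfolding Linf_loc_def by blast
    obtain N2 where N2: "AE x in lebesgue. x \<in> L \<longrightarrow> norm (v x) \<le> N2"
      using vW L L\<Omega> unfolding Linf_loc_def by blast
    define G where "G = max 1 (max M1 M2)"
    define N where "N = max N1 N2"
    have G: "AE x in lebesgue. x \<in> L \<longrightarrow> norm (gu x) \<le> G \<and> norm (gv x) \<le> G"
      using M1 M2 by eventually_elim (auto simp: G_def)
    have N: "AE x in lebesgue. x \<in> L \<longrightarrow> \<bar>u x\<bar> \<le> N \<and> \<bar>v x\<bar> \<le> N"
      using N1 N2 by eventually_elim (auto simp: N_def)
    define b where "b x = a x (gu x) - a x (gv x)" for x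
    define q where "q x = H x (v x) (gv x) - H x (u x) (gu x)" for x
    have aint: "set_integrable lebesgue L (\<lambda>x. a x (h x))"
      if h: "h \<in> borel_measurable (lebesgue_on \<Omega>)" and i: "L1_loc \<Omega> (\<lambda>x. norm (a x (h x)))" for h
      unfolding set_integrable_def
    proof (rule Bochner_Integration.integrable_bound)
      show "integrable lebesgue (\<lambda>x. indicator L x *\<^sub>R norm (a x (h x)))"
        using i L L\<Omega> unfolding L1_loc_def set_integrable_def by blast
      show "(\<lambda>x. indicator L x *\<^sub>R a x (h x)) \<in> borel_measurable lebesgue"
        by (rule borel_measurable_indicator_compact[OF caratheodory_measurable[OF a_car h] o L L\<Omega>])
    qed auto
    have b: "set_integrable lebesgue L b"
      unfolding b_def[abs_def] using Q uW vW unfolding Q_le_def by (intro set_integral_diff aint) auto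
    \<comment> \<open>By continuity \<open>H\<close> is bounded on the compact box L x [-N, N] x
      \<open>cball 0 G\<close>, where the arguments stay almost everywhere; this gives a constant
      majorant on \<open>L\<close>.\<close>
    obtain E where E: "\<And>x t \<xi>. x \<in> L \<Longrightarrow> \<bar>t\<bar> \<le> N \<Longrightarrow> norm \<xi> \<le> G \<Longrightarrow> \<bar>H x t \<xi>\<bar> \<le> E"
    proof -
      have "compact ((\<lambda>(x, t, \<xi>). H x t \<xi>) ` (L \<times> cball 0 N \<times> cball 0 G))"
        by (intro compact_continuous_image continuous_on_subset[OF H_cont] compact_Times L) (use L\<Omega> in auto)
      then obtain E where E: "\<forall>y\<in>(\<lambda>(x, t, \<xi>). H x t \<xi>) ` (L \<times> cball 0 N \<times> cball 0 G). norm y \<le> E"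
        unfolding compact_eq_bounded_closed bounded_iff by blast
      show ?thesis
      proof (rule that)
        fix x :: 'a and t and \<xi> :: 'a assume "x \<in> L" "\<bar>t\<bar> \<le> N" "norm \<xi> \<le> G"
        then have "(x, t, \<xi>) \<in> L \<times> cball 0 N \<times> cball 0 G" by simp
        from bspec[OF E imageI[OF this, of "\<lambda>(x, t, \<xi>). H x t \<xi>"]] show "\<bar>H x t \<xi>\<bar> \<le> E" by simp
      qed
    qed
    have Hint: "set_integrable lebesgue L (\<lambda>x. H x (f x) (h x))"
      if m: "f \<in> borel_measurable (lebesgue_on \<Omega>)" "h \<in> borel_measurable (lebesgue_on \<Omega>)"
        and bd: "AE x in lebesgue. x \<in> L \<longrightarrow> \<bar>f x\<bar> \<le> N \<and> norm (h x) \<le> G" for f h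
      unfolding set_integrable_def
    proof (rule Bochner_Integration.integrable_bound)
      have "emeasure lebesgue L < \<infinity>" using emeasure_compact_finite[OF L] by simp
      then show "integrable lebesgue (\<lambda>x. E * indicator L x)"
        by (intro integrable_mult_right integrable_real_indicator) auto
      show "(\<lambda>x. indicator L x *\<^sub>R H x (f x) (h x)) \<in> borel_measurable lebesgue"
        by (rule borel_measurable_indicator_compact[OF continuous_compose_measurable[OF H_cont m] o L L\<Omega>])
      show "AE x in lebesgue. norm (indicator L x *\<^sub>R H x (f x) (h x)) \<le> norm (E * indicator L x)"
        using bd
      proof (rule eventually_mono)
        fix x assume "x \<in> L \<longrightarrow> \<bar>f x\<bar> \<le> N \<and> norm (h x) \<le> G"
        then show "norm (indicator L x *\<^sub>R H x (f x) (h x)) \<le> norm (E * indicator L x)"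
          using E[of x "f x" "h x"] by (cases "x \<in> L") auto
      qed
    qed
    have q: "set_integrable lebesgue L q"
      unfolding q_def[abs_def]
    proof (intro set_integral_diff Hint)
      show "AE x in lebesgue. x \<in> L \<longrightarrow> \<bar>v x\<bar> \<le> N \<and> norm (gv x) \<le> G"
        "AE x in lebesgue. x \<in> L \<longrightarrow> \<bar>u x\<bar> \<le> N \<and> norm (gu x) \<le> G"
        using G N by (eventually_elim, auto)+
    qed (use uW vW in auto)
    \<comment> \<open>The truncated cube vanishes off \<open>L\<close> together with its gradient
      formula, so it is admissible in \<open>Q_le\<close> and the integrals over
      \<open>\<Omega>\<close> reduce to \<open>L\<close>.\<close>
    have test: "(LINT x:L|lebesgue. b x \<bullet> ((3 * (S k n x)\<^sup>2) *\<^sub>R DW n x)) \<le> (LINT x:L|lebesgue. q x * S k n x ^ 3)"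
      if k: "k \<ge> k0" for k n
    proof -
      have "{x. S k n x ^ 3 \<noteq> 0} \<subseteq> L" using outside(1)[OF k] by force
      then have cl: "closure {x. S k n x ^ 3 \<noteq> 0} \<subseteq> L" using L by (simp add: closure_minimal compact_imp_closed)
      have "C1c_grad \<Omega> (\<lambda>x. S k n x ^ 3) (\<lambda>x. (3 * (S k n x)\<^sup>2) *\<^sub>R DW n x)"
        unfolding C1c_grad_def
      proof (intro conjI allI)
        show "((\<lambda>x. S k n x ^ 3) has_derivative (\<lambda>h. ((3 * (S k n x)\<^sup>2) *\<^sub>R DW n x) \<bullet> h)) (at x)" for x
          using has_derivative_S_power[of k n 1 x] by (simp add: numeral_3_eq_3 numeral_2_eq_2)
        show "continuous_on UNIV (\<lambda>x. (3 * (S k n x)\<^sup>2) *\<^sub>R DW n x)"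
          by (intro continuous_intros continuous_S cont)
        show "compact (closure {x. S k n x ^ 3 \<noteq> 0})"
          using cl compact_Int_closed[OF L closed_closure, of "{x. S k n x ^ 3 \<noteq> 0}"] by (simp add: Int_absorb1)
        show "closure {x. S k n x ^ 3 \<noteq> 0} \<subseteq> \<Omega>" using cl L\<Omega> by auto
      qed
      moreover have "\<forall>x. 0 \<le> S k n x ^ 3" using S_nonneg by simp
      ultimately have "(LINT x:\<Omega>|lebesgue. b x \<bullet> ((3 * (S k n x)\<^sup>2) *\<^sub>R DW n x)) \<le> (LINT x:\<Omega>|lebesgue. q x * S k n x ^ 3)"
        using Q unfolding Q_le_def b_def q_def by blast
      moreover have "(LINT x:\<Omega>|lebesgue. b x \<bullet> ((3 * (S k n x)\<^sup>2) *\<^sub>R DW n x)) = (LINT x:L|lebesgue. b x \<bullet> ((3 * (S k n x)\<^sup>2) *\<^sub>R DW n x))"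
        unfolding set_lebesgue_integral_def
        by (rule Bochner_Integration.integral_cong) (use L\<Omega> outside(1)[OF k] in \<open>auto simp: indicator_def\<close>)
      moreover have "(LINT x:\<Omega>|lebesgue. q x * S k n x ^ 3) = (LINT x:L|lebesgue. q x * S k n x ^ 3)"
        unfolding set_lebesgue_integral_def
        by (rule Bochner_Integration.integral_cong) (use L\<Omega> outside(1)[OF k] in \<open>auto simp: indicator_def\<close>)
      ultimately show ?thesis by simp
    qed
    \<comment> \<open>Since p - 2 < 0, the ellipticity weight is smallest where both gradients
      attain the bound \<open>G\<close>.\<close>
    define c where "c = \<gamma> * (1 + 2 * G) powr (p - 2)"
    have G1: "G \<ge> 1" by (simp add: G_def)
    have c: "c > 0" using gamma G1 by (simp add: c_def)
    have mono: "AE x in lebesgue. x \<in> L \<longrightarrow> w x > k0 \<longrightarrow> c * (norm (g x))\<^sup>2 \<le> b x \<bullet> g x"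
      using G eq
    proof eventually_elim
      fix x assume x: "x \<in> L \<longrightarrow> norm (gu x) \<le> G \<and> norm (gv x) \<le> G" "x \<in> L \<longrightarrow> w x = ?w x \<and> g x = ?g x"
      show "x \<in> L \<longrightarrow> w x > k0 \<longrightarrow> c * (norm (g x))\<^sup>2 \<le> b x \<bullet> g x"
      proof (intro impI)
        assume xL: "x \<in> L"
        have "(1 + 2 * G) powr (p - 2) \<le> (1 + norm (gu x) + norm (gv x)) powr (p - 2)"
          using x(1) xL p norm_ge_zero[of "gu x"] norm_ge_zero[of "gv x"] by (intro powr_mono2') (auto simp del: norm_ge_zero)
        then have "c * (norm (g x))\<^sup>2 \<le> \<gamma> * (1 + norm (gu x) + norm (gv x)) powr (p - 2) * (norm (g x))\<^sup>2"
          unfolding c_def using gamma by (intro mult_right_mono mult_left_mono) auto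
        also have "\<dots> \<le> b x \<bullet> g x"
          using a_mono xL L\<Omega> x(2) by (auto simp: b_def)
        finally show "c * (norm (g x))\<^sup>2 \<le> b x \<bullet> g x" .
      qed
    qed
    obtain M where M: "M > 0" "\<And>x t \<xi> \<eta>. x \<in> L \<Longrightarrow> \<bar>H x t \<eta> - H x t \<xi>\<bar> \<le> M * \<bar>norm \<eta> powr \<sigma> - norm \<xi> powr \<sigma>\<bar>"
      using H2[rule_format, of L] L L\<Omega> by blast
    \<comment> \<open>Insert H(x, v, gu). The change in the gradient slot is bounded by
      \<open>H2\<close>; the change from v to u is bounded by \<open>H1\<close>, whose \<tau> term
      is nonnegative and whose \<omega> term is at least \<omega>(x, k0) by monotonicity.\<close>
    have decr: "q x \<le> M * \<bar>norm (gv x) powr \<sigma> - norm (gu x) powr \<sigma>\<bar> - \<omega> x k0"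
      if x: "x \<in> L" "u x - v x > k0" for x
    proof -
      have x\<Omega>: "x \<in> \<Omega>" using x L\<Omega> by auto
      have "\<omega> x (u x - v x) + \<tau> x (u x - v x) * norm (gu x) powr \<sigma> \<le> H x (u x) (gu x) - H x (v x) (gu x)"
        using H1 x\<Omega> x(2) k0 by auto
      moreover have "\<tau> x (u x - v x) \<ge> 0" using tau_nonneg x\<Omega> x(2) k0 by auto
      then have "\<tau> x (u x - v x) * norm (gu x) powr \<sigma> \<ge> 0" by simp
      moreover have "\<omega> x k0 \<le> \<omega> x (u x - v x)"
        using omega_mono x\<Omega> x(2) k0 by (auto intro: mono_onD)
      moreover have "H x (v x) (gv x) - H x (v x) (gu x) \<le> M * \<bar>norm (gv x) powr \<sigma> - norm (gu x) powr \<sigma>\<bar>"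
        using M(2)[OF x(1), of "v x" "gv x" "gu x"] by linarith
      ultimately show ?thesis unfolding q_def by linarith
    qed
    have "\<exists>C. AE x in lebesgue. x \<in> L \<longrightarrow> w x > k0 \<longrightarrow> q x \<le> C * norm (g x)"
    proof -
      \<comment> \<open>Only the norms of the gradients matter: with \<open>s\<close> and
        \<open>t\<close> their minimum and maximum, t - s is at most |gu - gv|, and what is left is
        a scalar inequality on [0, G].\<close>
      have red: "\<exists>C. AE x in lebesgue. x \<in> L \<longrightarrow> w x > k0 \<longrightarrow> q x \<le> C * norm (g x)"
        if C: "C \<ge> 0" and le: "\<And>x s t. x \<in> L \<Longrightarrow> 0 \<le> s \<Longrightarrow> s \<le> t \<Longrightarrow> t \<le> G \<Longrightarrow> M * (t powr \<sigma> - s powr \<sigma>) - \<omega> x k0 \<le> C * (t - s)" for C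
      proof (intro exI[of _ C])
        show "AE x in lebesgue. x \<in> L \<longrightarrow> w x > k0 \<longrightarrow> q x \<le> C * norm (g x)"
          using G eq
        proof eventually_elim
          fix x assume x: "x \<in> L \<longrightarrow> norm (gu x) \<le> G \<and> norm (gv x) \<le> G" "x \<in> L \<longrightarrow> w x = ?w x \<and> g x = ?g x"
          show "x \<in> L \<longrightarrow> w x > k0 \<longrightarrow> q x \<le> C * norm (g x)"
          proof (intro impI)
            assume xL: "x \<in> L" and wk: "w x > k0"
            define s where "s = min (norm (gu x)) (norm (gv x))"
            define t where "t = max (norm (gu x)) (norm (gv x))"
            have st: "0 \<le> s" "s \<le> t" "t \<le> G" using x(1) xL by (auto simp: s_def t_def)
            have pw: "s powr \<sigma> \<le> t powr \<sigma>" using st sigma by (intro powr_mono2) auto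
            have "\<bar>norm (gv x) powr \<sigma> - norm (gu x) powr \<sigma>\<bar> = t powr \<sigma> - s powr \<sigma>"
              using pw by (auto simp: s_def t_def min_def max_def split: if_splits)
            then have "q x \<le> M * (t powr \<sigma> - s powr \<sigma>) - \<omega> x k0"
              using decr[OF xL] wk x(2) xL by auto
            also have "\<dots> \<le> C * (t - s)" by (rule le[OF xL st])
            also have "t - s \<le> norm (g x)"
              using x(2) xL norm_triangle_ineq3[of "gu x" "gv x"] by (auto simp: s_def t_def min_def max_def)
            finally show "q x \<le> C * norm (g x)" using C by (simp add: mult_left_mono)
          qed
        qed
      qed
      show ?thesis
      proof (cases "1 \<le> \<sigma>")
        case True
        show ?thesis
        proof (rule red)
          show "0 \<le> M * (\<sigma> * G powr (\<sigma> - 1))" using M(1) sigma by simp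
          fix x s t assume x: "x \<in> L" and st: "0 \<le> s" "s \<le> t" "t \<le> G"
          have "M * (t powr \<sigma> - s powr \<sigma>) \<le> M * (\<sigma> * G powr (\<sigma> - 1) * (t - s))"
            using powr_diff_le_of_ge_1[OF True st] M(1) by (intro mult_left_mono) auto
          moreover have "\<omega> x k0 \<ge> 0" using omega_nonneg x L\<Omega> k0 by auto
          ultimately show "M * (t powr \<sigma> - s powr \<sigma>) - \<omega> x k0 \<le> M * (\<sigma> * G powr (\<sigma> - 1)) * (t - s)"
            by (simp add: mult.assoc)
        qed
      next
        case False
        then have \<sigma>1: "\<sigma> < 1" and pos: "\<forall>x\<in>\<Omega>. \<forall>r>0. \<omega> x r > 0" using cases by auto
        \<comment> \<open>The deficit for \<sigma> < 1: positivity and lower semicontinuity of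
          \<omega>(., k0) give one positive lower bound on all of \<open>L\<close>, so that the
          constant does not depend on \<open>x\<close>.\<close>
        obtain e where e: "e > 0" "\<And>x. x \<in> L \<Longrightarrow> e \<le> \<omega> x k0"
          by (rule lsc_on_compact_pos[of \<Omega> "\<lambda>x. \<omega> x k0" L]) (use omega_lsc L L\<Omega> pos k0 in auto)
        show ?thesis
        proof (rule red)
          show "0 \<le> M * ((e / M) powr (1 / \<sigma>)) powr (\<sigma> - 1)" using M(1) by simp
          fix x s t assume x: "x \<in> L" and st: "0 \<le> s" "s \<le> t" "t \<le> G"
          show "M * (t powr \<sigma> - s powr \<sigma>) - \<omega> x k0 \<le> M * ((e / M) powr (1 / \<sigma>)) powr (\<sigma> - 1) * (t - s)"
            using powr_diff_le_of_less_1[OF sigma \<sigma>1 st(1,2) M(1) e(1)] e(2)[OF x] by linarith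
        qed
      qed
    qed
    then obtain C where low_order: "AE x in lebesgue. x \<in> L \<longrightarrow> w x > k0 \<longrightarrow> q x \<le> C * norm (g x)" by blast
    have "AE x in lebesgue. w x \<le> k0"
      by (rule AE_completion[OF essentially_le[OF b q test mono low_order c]])
    with eq show ?thesis
    proof eventually_elim
      fix x assume "x \<in> L \<longrightarrow> w x = ?w x \<and> g x = ?g x" "w x \<le> k0"
      \<comment> \<open>Points of \<open>K\<close> lie in \<open>L\<close>, where \<open>w\<close>
        represents u - v; points of \<open>\<Omega>\<close> outside \<open>K\<close> satisfy the
        bound by \<open>sup\<close>.\<close>
      then show "x \<in> \<Omega> \<longrightarrow> ?w x \<le> k0" using sup[of x] KL by (cases "x \<in> K") auto
    qed
  qed
  have "AE x in lebesgue. x \<in> \<Omega> \<longrightarrow> ?w x \<le> 0"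
    by (rule AE_le_0_if_le_all_pos) (rule level)
  then show ?thesis by (rule eventually_mono) auto
qed

end
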